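(* Let $I\subset\mathbb R$ be a compact interval, $\mu\ge0$, $\sigma>0$, $\alpha\in(0,1]$, and let $H(t)$, $t\in I$, be a family of operators such that: (1) for every $r\ge0$, $t\mapsto H(t)$ is norm-continuous as a map $I\to\mathcal L(\mathcal H^{r+\mu},\mathcal H^r)$; (2) with $r=\mu+\sigma$ there is $c_r\in L^1(I)$, $c_r\ge0$, such that $$\left|\mathrm i\left(\langle H(t)v,\Lambda^{2r}v\rangle-\langle\Lambda^{2r}v,H(t)v\rangle\right)\right|\le c_r(t)\|v\|_r^2\qquad\text{for every }v\in\mathcal H^\infty\text{ and almost every }t\in I;$$ (3) each $H(t)$ is symmetric on $\mathcal H^\infty$; (4) $t\mapsto H(t)$ is H\"older continuous of exponent $\alpha$ as a map $I\to\mathcal L(\mathcal H^\mu,\mathcal H)$. Let $U(t,s)$ be the unitary propagator on $\mathcal H$ given by $U(t,s)u=\lim_{N\to\infty}U_N(t,s)P_Nu$ (which exists under these hypotheses). Then there is a constant $C_{I,\mu,\sigma,\alpha}>0$, independent of $N$ and of the partition $\Pi$, such that $$\|U_{N,\Pi}(t,s)P_Nu-U(t,s)u\|\le C_{I,\mu,\sigma,\alpha}\left((1+N)^{-\sigma}+(1+N)^\mu|\Pi|^\alpha\right)\|u\|_{\mu+\sigma}$$ for every $u\in\mathcal H^{\mu+\sigma}$ and every $s,t\in I$. Consequently, if $N_k\to\infty$, $|\Pi_k|\to0$ and $(1+N_k)^\mu|\Pi_k|^\alpha\to0$, then for every $u\in\mathcal H^{\mu+\sigma}$, $$U_{N_k,\Pi_k}(t,s)P_{N_k}u\longrightarrow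 U(t,s)u$$ in $\mathcal H$, uniformly for $(t,s)\in I\times I$.
   Context: $\mathcal H$ is a complex separable Hilbert space, $H_0$ a positive self-adjoint operator on $\mathcal H$ with compact resolvent (spectrum contained in $[0,\infty)$), and $\Lambda=1+H_0$. For $N>0$, $P_N=\mathbf 1_{[0,N]}(H_0)$ and $\mathcal H_N=P_N\mathcal H$ (finite-dimensional). For $r\ge0$, $\mathcal H^r=D(\Lambda^r)$ with norm $\|u\|_r=\|\Lambda^ru\|$, and $\mathcal H^\infty=\bigcap_{r\ge0}\mathcal H^r$. $H_N(t)=P_NH(t)P_N$ is viewed as a self-adjoint operator on $\mathcal H_N$, and $U_N(t,s)$ is its unitary propagator: $\mathrm i\partial_tU_N(t,s)=H_N(t)U_N(t,s)$, $U_N(s,s)=\mathbf 1_{\mathcal H_N}$. For a partition $\Pi=\{s=t_0<t_1<\dots<t_M=t\}$ with mesh $|\Pi|=\max_j(t_{j+1}-t_j)$, $$U_{N,\Pi}(t,s)=\mathrm e^{-\mathrm i(t_M-t_{M-1})H_N(t_{M-1})}\cdots\mathrm e^{-\mathrm i(t_1-t_0)H_N(t_0)}$$ on $\mathcal H_N$ (later times to the left). For $t<s$, $\Pi$ is a partition of $[t,s]$ and $U_{N,\Pi}(t,s):=U_{N,\Pi}(s,t)^{-1}$; for $t=s$ it is the identity. In the convergence statement $\Pi_k$ denotes, for each $(t,s)$, a partition of the interval between $s$ and $t$, and the conditions on $|\Pi_k|$ refer to the supremum of the meshes over $(t,s)$. *)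

theory Defs
  imports "HOL-Analysis.Analysis"
begin

section \<open>Complex Hilbert spaces\<close>

text \<open>The inner product is antilinear in its first argument. Norm and topology are those of the
  underlying real Hilbert space, whose inner product is the real part of the complex one.\<close>

class complex_hilbert_space = real_inner + complete_space +
  fixes scaleC :: "complex \<Rightarrow> 'a \<Rightarrow> 'a" (infixr "*\<^sub>C" 75)
    and cinner :: "'a \<Rightarrow> 'a \<Rightarrow> complex"
  assumes scaleC_add_right: "c *\<^sub>C (x + y) = c *\<^sub>C x + c *\<^sub>C y"
    and scaleC_add_left: "(c + d) *\<^sub>C x = c *\<^sub>C x + d *\<^sub>C x"
    and scaleC_scaleC: "c *\<^sub>C (d *\<^sub>C x) = (c * d) *\<^sub>C x"
    and scaleR_scaleC: "r *\<^sub>R x = complex_of_real r *\<^sub>C x"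
    and cinner_commute: "cinner x y = cnj (cinner y x)"
    and cinner_add_left: "cinner (x + y) z = cinner x z + cinner y z"
    and cinner_scaleC_left: "cinner (c *\<^sub>C x) y = cnj c * cinner x y"
    and inner_eq_Re_cinner: "inner x y = Re (cinner x y)"

definition csubspace :: "'a::complex_hilbert_space set \<Rightarrow> bool" where
  "csubspace V \<longleftrightarrow> 0 \<in> V \<and> (\<forall>u\<in>V. \<forall>v\<in>V. u + v \<in> V) \<and> (\<forall>c. \<forall>u\<in>V. c *\<^sub>C u \<in> V)"

definition clinear_on :: "'a::complex_hilbert_space set \<Rightarrow> ('a \<Rightarrow> 'a) \<Rightarrow> bool" where
  "clinear_on V T \<longleftrightarrow> (\<forall>u\<in>V. \<forall>v\<in>V. T (u + v) = T u + T v) \<and>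
     (\<forall>c. \<forall>u\<in>V. T (c *\<^sub>C u) = c *\<^sub>C T u)"

definition unitary_on :: "'a::complex_hilbert_space set \<Rightarrow> ('a \<Rightarrow> 'a) \<Rightarrow> bool" where
  "unitary_on V T \<longleftrightarrow> clinear_on V T \<and> T ` V = V \<and>
     (\<forall>u\<in>V. \<forall>v\<in>V. cinner (T u) (T v) = cinner u v)"

definition orth_proj :: "'a::complex_hilbert_space set \<Rightarrow> 'a \<Rightarrow> 'a" where
  "orth_proj V u = (THE w. w \<in> V \<and> (\<forall>v\<in>V. cinner v (u - w) = 0))"


section \<open>Unbounded operators\<close>

text \<open>An unbounded operator is a pair of a domain and a function, whose values outside the
  domain are irrelevant.\<close>

type_synonym 'a unbounded_op = "'a set \<times> ('a \<Rightarrow> 'a)"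

abbreviation op_dom :: "'a unbounded_op \<Rightarrow> 'a set" where
  "op_dom A \<equiv> fst A"

abbreviation op_app :: "'a unbounded_op \<Rightarrow> 'a \<Rightarrow> 'a" where
  "op_app A \<equiv> snd A"

definition densely_defined_op :: "'a::complex_hilbert_space unbounded_op \<Rightarrow> bool" where
  "densely_defined_op A \<longleftrightarrow>
     csubspace (op_dom A) \<and> closure (op_dom A) = UNIV \<and> clinear_on (op_dom A) (op_app A)"

definition adjoint_op :: "'a::complex_hilbert_space unbounded_op \<Rightarrow> 'a unbounded_op" where
  "adjoint_op A =
     ({v. \<exists>w. \<forall>u\<in>op_dom A. cinner v (op_app A u) = cinner w u},
      \<lambda>v. THE w. \<forall>u\<in>op_dom A. cinner v (op_app A u) = cinner w u)"

definition self_adjoint_op :: "'a::complex_hilbert_space unbounded_op \<Rightarrow> bool" where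
  "self_adjoint_op A \<longleftrightarrow> densely_defined_op A \<and> op_dom (adjoint_op A) = op_dom A \<and>
     (\<forall>u\<in>op_dom A. op_app (adjoint_op A) u = op_app A u)"

definition positive_op :: "'a::complex_hilbert_space unbounded_op \<Rightarrow> bool" where
  "positive_op A \<longleftrightarrow> (\<forall>u\<in>op_dom A. 0 \<le> Re (cinner u (op_app A u)))"

definition resolvent_op :: "'a::complex_hilbert_space unbounded_op \<Rightarrow> complex \<Rightarrow> 'a \<Rightarrow> 'a" where
  "resolvent_op A z = inv_into (op_dom A) (\<lambda>u. op_app A u - z *\<^sub>C u)"

definition resolvent_set :: "'a::complex_hilbert_space unbounded_op \<Rightarrow> complex set" where
  "resolvent_set A =
     {z. bij_betw (\<lambda>u. op_app A u - z *\<^sub>C u) (op_dom A) UNIV \<and> bounded_linear (resolvent_op A z)}"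

definition compact_op :: "('a::complex_hilbert_space \<Rightarrow> 'a) \<Rightarrow> bool" where
  "compact_op T \<longleftrightarrow> (\<forall>B. bounded B \<longrightarrow> compact (closure (T ` B)))"

definition compact_resolvent :: "'a::complex_hilbert_space unbounded_op \<Rightarrow> bool" where
  "compact_resolvent A \<longleftrightarrow> (\<exists>z\<in>resolvent_set A. compact_op (resolvent_op A z))"


section \<open>Functional calculus and the scale of spaces\<close>

text \<open>Eigenvalues of a self-adjoint operator are real. If the resolvent is compact, the spectral
  measure is the sum of the point masses at the eigenvalues given by the projections onto the
  eigenspaces, so that \<open>\<integral> f dE\<close> and its domain are given by the following sums.\<close>

definition eigenspace :: "'a::complex_hilbert_space unbounded_op \<Rightarrow> real \<Rightarrow> 'a set" where
  "eigenspace A x = {u \<in> op_dom A. op_app A u = x *\<^sub>R u}"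

definition eigenvalues :: "'a::complex_hilbert_space unbounded_op \<Rightarrow> real set" where
  "eigenvalues A = {x. eigenspace A x \<noteq> {0}}"

definition func_calc :: "'a::complex_hilbert_space unbounded_op \<Rightarrow> (real \<Rightarrow> real) \<Rightarrow> 'a unbounded_op" where
  "func_calc A f =
     ({u. (\<lambda>x. (f x)\<^sup>2 * (norm (orth_proj (eigenspace A x) u))\<^sup>2) summable_on eigenvalues A},
      \<lambda>u. \<Sum>\<^sub>\<infinity>x\<in>eigenvalues A. f x *\<^sub>R orth_proj (eigenspace A x) u)"

definition Lambda :: "'a::complex_hilbert_space unbounded_op \<Rightarrow> 'a unbounded_op" where
  "Lambda H\<^sub>0 = (op_dom H\<^sub>0, \<lambda>u. u + op_app H\<^sub>0 u)"

definition Lambda_pow :: "'a::complex_hilbert_space unbounded_op \<Rightarrow> real \<Rightarrow> 'a unbounded_op" where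
  "Lambda_pow H\<^sub>0 r = func_calc (Lambda H\<^sub>0) (\<lambda>x. x powr r)"

definition Hsp :: "'a::complex_hilbert_space unbounded_op \<Rightarrow> real \<Rightarrow> 'a set" where
  "Hsp H\<^sub>0 r = op_dom (Lambda_pow H\<^sub>0 r)"

definition Hnorm :: "'a::complex_hilbert_space unbounded_op \<Rightarrow> real \<Rightarrow> 'a \<Rightarrow> real" where
  "Hnorm H\<^sub>0 r u = norm (op_app (Lambda_pow H\<^sub>0 r) u)"

definition Hsp_inf :: "'a::complex_hilbert_space unbounded_op \<Rightarrow> 'a set" where
  "Hsp_inf H\<^sub>0 = (\<Inter>r\<in>{0..}. Hsp H\<^sub>0 r)"

definition P_N :: "'a::complex_hilbert_space unbounded_op \<Rightarrow> real \<Rightarrow> 'a \<Rightarrow> 'a" where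
  "P_N H\<^sub>0 N = op_app (func_calc H\<^sub>0 (indicat_real {0..N}))"

definition HN_space :: "'a::complex_hilbert_space unbounded_op \<Rightarrow> real \<Rightarrow> 'a set" where
  "HN_space H\<^sub>0 N = range (P_N H\<^sub>0 N)"


section \<open>Bounded operators between spaces of the scale\<close>

definition bounded_between ::
    "'a::complex_hilbert_space unbounded_op \<Rightarrow> real \<Rightarrow> real \<Rightarrow> ('a \<Rightarrow> 'a) \<Rightarrow> bool" where
  "bounded_between H\<^sub>0 p q T \<longleftrightarrow> T ` Hsp H\<^sub>0 p \<subseteq> Hsp H\<^sub>0 q \<and> clinear_on (Hsp H\<^sub>0 p) T \<and>
     (\<exists>K. \<forall>u\<in>Hsp H\<^sub>0 p. Hnorm H\<^sub>0 q (T u) \<le> K * Hnorm H\<^sub>0 p u)"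

definition norm_between ::
    "'a::complex_hilbert_space unbounded_op \<Rightarrow> real \<Rightarrow> real \<Rightarrow> ('a \<Rightarrow> 'a) \<Rightarrow> real" where
  "norm_between H\<^sub>0 p q T = (SUP u\<in>{u \<in> Hsp H\<^sub>0 p. Hnorm H\<^sub>0 p u \<le> 1}. Hnorm H\<^sub>0 q (T u))"

definition norm_continuous_between :: "'a::complex_hilbert_space unbounded_op \<Rightarrow> real \<Rightarrow> real \<Rightarrow>
    real set \<Rightarrow> (real \<Rightarrow> 'a \<Rightarrow> 'a) \<Rightarrow> bool" where
  "norm_continuous_between H\<^sub>0 p q I H \<longleftrightarrow> (\<forall>t\<in>I. bounded_between H\<^sub>0 p q (H t)) \<and>
     (\<forall>t\<in>I. ((\<lambda>t'. norm_between H\<^sub>0 p q (\<lambda>u. H t' u - H t u)) \<longlongrightarrow> 0) (at t within I))"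

definition holder_between :: "'a::complex_hilbert_space unbounded_op \<Rightarrow> real \<Rightarrow> real \<Rightarrow> real \<Rightarrow>
    real set \<Rightarrow> (real \<Rightarrow> 'a \<Rightarrow> 'a) \<Rightarrow> bool" where
  "holder_between H\<^sub>0 p q \<alpha> I H \<longleftrightarrow> (\<forall>t\<in>I. bounded_between H\<^sub>0 p q (H t)) \<and>
     (\<exists>L\<ge>0. \<forall>t\<in>I. \<forall>t'\<in>I. norm_between H\<^sub>0 p q (\<lambda>u. H t' u - H t u) \<le> L * \<bar>t' - t\<bar> powr \<alpha>)"


section \<open>Propagators\<close>

definition H_N ::
    "'a::complex_hilbert_space unbounded_op \<Rightarrow> (real \<Rightarrow> 'a \<Rightarrow> 'a) \<Rightarrow> real \<Rightarrow> real \<Rightarrow> 'a \<Rightarrow> 'a" where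
  "H_N H\<^sub>0 H N t u = P_N H\<^sub>0 N (H t (P_N H\<^sub>0 N u))"

definition is_propagator_of :: "real set \<Rightarrow> 'a::complex_hilbert_space set \<Rightarrow>
    (real \<Rightarrow> 'a \<Rightarrow> 'a) \<Rightarrow> (real \<Rightarrow> real \<Rightarrow> 'a \<Rightarrow> 'a) \<Rightarrow> bool" where
  "is_propagator_of I V A U \<longleftrightarrow>
     (\<forall>t\<in>I. \<forall>s\<in>I. unitary_on V (U t s)) \<and>
     (\<forall>s\<in>I. \<forall>v\<in>V. U s s v = v) \<and>
     (\<forall>s\<in>I. \<forall>v\<in>V. \<forall>t\<in>I.
        \<exists>w. ((\<lambda>t. U t s v) has_vector_derivative w) (at t within I) \<and> \<i> *\<^sub>C w = A t (U t s v))"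

text \<open>The differential equation determines \<open>U_N H\<^sub>0 H I N t s v\<close> uniquely for \<open>s\<close>, \<open>t\<close> in the
  interval \<open>I\<close> and \<open>v\<close> in \<open>HN_space H\<^sub>0 N\<close>; only these values are ever used.\<close>

definition U_N :: "'a::complex_hilbert_space unbounded_op \<Rightarrow> (real \<Rightarrow> 'a \<Rightarrow> 'a) \<Rightarrow> real set \<Rightarrow>
    real \<Rightarrow> real \<Rightarrow> real \<Rightarrow> 'a \<Rightarrow> 'a" where
  "U_N H\<^sub>0 H I N = (SOME U. is_propagator_of I (HN_space H\<^sub>0 N) (H_N H\<^sub>0 H N) U)"

definition U_lim :: "'a::complex_hilbert_space unbounded_op \<Rightarrow> (real \<Rightarrow> 'a \<Rightarrow> 'a) \<Rightarrow> real set \<Rightarrow>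
    real \<Rightarrow> real \<Rightarrow> 'a \<Rightarrow> 'a" where
  "U_lim H\<^sub>0 H I t s u = Lim at_top (\<lambda>N. U_N H\<^sub>0 H I N t s (P_N H\<^sub>0 N u))"

definition unitary_propagator ::
    "real set \<Rightarrow> (real \<Rightarrow> real \<Rightarrow> 'a::complex_hilbert_space \<Rightarrow> 'a) \<Rightarrow> bool" where
  "unitary_propagator I U \<longleftrightarrow>
     (\<forall>t\<in>I. \<forall>s\<in>I. unitary_on UNIV (U t s)) \<and>
     (\<forall>s\<in>I. \<forall>u. U s s u = u) \<and>
     (\<forall>t\<in>I. \<forall>r\<in>I. \<forall>s\<in>I. \<forall>u. U t r (U r s u) = U t s u) \<and>
     (\<forall>u. continuous_on (I \<times> I) (\<lambda>(t, s). U t s u))"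


section \<open>Products of exponentials along partitions\<close>

definition op_exp :: "('a::complex_hilbert_space \<Rightarrow> 'a) \<Rightarrow> 'a \<Rightarrow> 'a" where
  "op_exp B v = (\<Sum>n. (1 / fact n) *\<^sub>R (B ^^ n) v)"

definition is_partition :: "real \<Rightarrow> real \<Rightarrow> real list \<Rightarrow> bool" where
  "is_partition a b ts \<longleftrightarrow> ts \<noteq> [] \<and> sorted_wrt (<) ts \<and> hd ts = a \<and> last ts = b"

text \<open>The mesh of the trivial partition \<open>[a]\<close> of a one-point interval is \<open>0\<close>.\<close>

definition mesh :: "real list \<Rightarrow> real" where
  "mesh ts = Max (insert 0 {ts ! Suc j - ts ! j | j. Suc j < length ts})"

fun exp_prod :: "(real \<Rightarrow> 'a::complex_hilbert_space \<Rightarrow> 'a) \<Rightarrow> real list \<Rightarrow> 'a \<Rightarrow> 'a" where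
  "exp_prod A (t\<^sub>0 # t\<^sub>1 # ts) v =
     exp_prod A (t\<^sub>1 # ts) (op_exp (\<lambda>w. (- \<i> * complex_of_real (t\<^sub>1 - t\<^sub>0)) *\<^sub>C A t\<^sub>0 w) v)"
| "exp_prod A _ v = v"

definition U_N_Pi :: "'a::complex_hilbert_space unbounded_op \<Rightarrow> (real \<Rightarrow> 'a \<Rightarrow> 'a) \<Rightarrow> real \<Rightarrow>
    real list \<Rightarrow> real \<Rightarrow> real \<Rightarrow> 'a \<Rightarrow> 'a" where
  "U_N_Pi H\<^sub>0 H N ts t s v =
     (if s < t then exp_prod (H_N H\<^sub>0 H N) ts v
      else if t < s then inv_into (HN_space H\<^sub>0 N) (exp_prod (H_N H\<^sub>0 H N) ts) v
      else v)"

end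

theory Submission
  imports Defs
begin

text \<open>With \<open>r = \<mu> + \<sigma>\<close>, the commutator bound gives \<open>\<bar>d/dt ln \<parallel>U\<^sub>N(t,s)v\<parallel>\<^sub>r\<^sup>2\<bar> \<le> c\<^sub>r(t)\<close> for almost every \<open>t\<close>,
  hence a bound on \<open>U\<^sub>N\<close> in \<open>\<H>\<^sup>r\<close> that is uniform in \<open>N\<close>. For \<open>N \<le> M\<close> the difference of the two Galerkin
  solutions solves the equation of level \<open>M\<close> with the source \<open>(P\<^sub>M - P\<^sub>N) H(t) U\<^sub>N\<close>. As \<open>H(t)\<close> maps \<open>\<H>\<^sup>r\<close>
  to \<open>\<H>\<^sup>\<sigma>\<close>, the source is of size \<open>(1 + N)\<^sup>-\<^sup>\<sigma>\<close>, which gives the limit and its rate of convergence on \<open>\<H>\<^sup>r\<close>;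
  unitarity and density carry the limit over to the whole space.

  On one step of the partition, freezing \<open>H\<close> at the left endpoint produces the source \<open>(H(t\<^sub>j) - H(\<tau>)) U\<^sub>N\<close>,
  of size \<open>\<bar>\<Pi>\<bar>\<^sup>\<alpha> \<parallel>U\<^sub>N v\<parallel>\<^sub>\<mu>\<close> by Hoelder continuity. Since \<open>\<parallel>\<cdot>\<parallel>\<^sub>\<mu> \<le> \<parallel>\<cdot>\<parallel>\<^sub>r\<close>, the uniform bound applies again and the steps
  add up to \<open>\<bar>\<Pi>\<bar>\<^sup>\<alpha>\<close>, which is even better than \<open>(1 + N)\<^sup>\<mu> \<bar>\<Pi>\<bar>\<^sup>\<alpha>\<close>.\<close>

section \<open>Complex inner products and orthogonal projections\<close>

text \<open>The exceptional null set of the commutator hypothesis depends on the vector, while a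
  Galerkin trajectory visits different vectors at different times. Separability, together with
  continuity in the vector at fixed N, produces one null set for the whole range of P_N; only then
  does the bound apply along a trajectory. The projection drops out of the commutator because it
  commutes with the powers of \<open>Lambda\<close>, so the hypothesis on H(t) controls the
  truncated generator.

  Powers and projections are defined by sums over eigenspaces, so statements about them rest on
  completeness of the eigenspaces. This is derived from compactness of the self-adjoint operator (1
  + H_0)^(-1); afterwards norm bounds in the scale are pointwise inequalities between multipliers.

  The truncated generator is treated as a bounded skew operator on the whole space, norm-continuous
  in time. Both comparisons, of two levels and of exact with frozen generator, are instances of the
  perturbation estimate \<open>norm_perturbed_sol_le\<close>. For t < s the error of the inverse
  product is reduced to a forward error by unitarity.\<close>

instance complex_hilbert_space \<subseteq> banach ..

lemma cinner_add_right: "cinner x (y + z) = cinner x y + cinner x z"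
  for x :: "'a::complex_hilbert_space"
  by (metis cinner_add_left cinner_commute complex_cnj_add)

lemma cinner_scaleC_right: "cinner x (c *\<^sub>C y) = c * cinner x y"
  for x :: "'a::complex_hilbert_space"
  by (metis cinner_commute cinner_scaleC_left complex_cnj_cnj complex_cnj_mult)

lemma cinner_scaleR_left: "cinner (r *\<^sub>R x) y = of_real r * cinner x y"
  for x :: "'a::complex_hilbert_space"
  by (simp add: scaleR_scaleC cinner_scaleC_left)

lemma cinner_scaleR_right: "cinner x (r *\<^sub>R y) = of_real r * cinner x y"
  for x :: "'a::complex_hilbert_space"
  by (simp add: scaleR_scaleC cinner_scaleC_right)

lemma cinner_self: "cinner x x = of_real ((norm x)\<^sup>2)"
  for x :: "'a::complex_hilbert_space"
proof -
  have "Im (cinner x x) = 0"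
    using cinner_commute[of x x] by (metis Reals_cnj_iff complex_is_Real_iff)
  moreover have "Re (cinner x x) = (norm x)\<^sup>2"
    by (simp add: inner_eq_Re_cinner[symmetric] power2_norm_eq_inner)
  ultimately show ?thesis by (simp add: complex_eq_iff)
qed

lemma norm_scaleC: "norm (c *\<^sub>C x) = cmod c * norm x"
  for x :: "'a::complex_hilbert_space"
proof -
  have "of_real ((norm (c *\<^sub>C x))\<^sup>2) = cnj c * c * cinner x x"
    by (simp only: cinner_self[symmetric]) (simp add: cinner_scaleC_left cinner_scaleC_right)
  also have "\<dots> = of_real ((cmod c * norm x)\<^sup>2)"
    using complex_norm_square[of c] by (simp add: cinner_self power_mult_distrib mult.commute)
  finally show ?thesis
    by (metis mult_nonneg_nonneg norm_ge_zero of_real_eq_iff power2_eq_imp_eq)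
qed

lemma cmod_cinner_le: "cmod (cinner x y) \<le> norm x * norm y"
  for x :: "'a::complex_hilbert_space"
proof (cases "cinner x y = 0")
  case False
  \<comment> \<open>Multiplying \<open>x\<close> by this number makes the complex inner product real
    and nonnegative, so the real Cauchy-Schwarz inequality yields the full modulus.\<close>
  define c where "c = cinner x y"
  have "(cmod c)\<^sup>2 = Re (cinner (c *\<^sub>C x) y)"
    by (simp add: cinner_scaleC_left c_def cmod_power2 power2_eq_square[of "Re _"] power2_eq_square[of "Im _"])
  also have "\<dots> \<le> cmod c * norm x * norm y"
    using norm_cauchy_schwarz[of "c *\<^sub>C x" y] by (simp add: inner_eq_Re_cinner norm_scaleC)
  finally have "cmod c * cmod c \<le> cmod c * (norm x * norm y)"
    by (simp add: power2_eq_square mult.assoc)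
  then show ?thesis using False by (simp add: c_def)
qed simp

lemma bounded_bilinear_cinner:
  "bounded_bilinear (cinner :: 'a::complex_hilbert_space \<Rightarrow> 'a \<Rightarrow> complex)"
  by (unfold_locales)
    (auto simp: cinner_add_left cinner_add_right cinner_scaleR_left cinner_scaleR_right
      scaleR_conv_of_real intro!: exI[of _ 1] cmod_cinner_le)

lemmas cinner_simps =
  cinner_add_left cinner_add_right cinner_scaleC_left cinner_scaleC_right
  bounded_bilinear.diff_left[OF bounded_bilinear_cinner]
  bounded_bilinear.diff_right[OF bounded_bilinear_cinner]
  bounded_bilinear.minus_left[OF bounded_bilinear_cinner]
  bounded_bilinear.minus_right[OF bounded_bilinear_cinner]
  bounded_bilinear.zero_left[OF bounded_bilinear_cinner]
  bounded_bilinear.zero_right[OF bounded_bilinear_cinner]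

lemma bounded_linear_scaleC: "bounded_linear ((*\<^sub>C) c :: 'a::complex_hilbert_space \<Rightarrow> 'a)"
proof (rule bounded_linear_intro[where K = "cmod c"])
  fix r and x :: 'a
  show "c *\<^sub>C (r *\<^sub>R x) = r *\<^sub>R (c *\<^sub>C x)"
    by (simp add: scaleR_scaleC scaleC_scaleC mult.commute)
qed (simp_all add: scaleC_add_right norm_scaleC mult.commute)

lemma scaleC_simps [simp]:
  fixes x :: "'a::complex_hilbert_space"
  shows "c *\<^sub>C (0::'a) = 0" "1 *\<^sub>C x = x" "c *\<^sub>C (- x) = - (c *\<^sub>C x)"
    "c *\<^sub>C (x - y) = c *\<^sub>C x - c *\<^sub>C y" "c *\<^sub>C d *\<^sub>C x = (c * d) *\<^sub>C x"
    "(- c) *\<^sub>C x = - (c *\<^sub>C x)" "0 *\<^sub>C x = 0"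
proof -
  show "c *\<^sub>C (0::'a) = 0" "c *\<^sub>C (- x) = - (c *\<^sub>C x)" "c *\<^sub>C (x - y) = c *\<^sub>C x - c *\<^sub>C y"
    using linear_simps[OF bounded_linear_scaleC] by blast+
  show "1 *\<^sub>C x = x" using scaleR_scaleC[of 1 x] by simp
  show "c *\<^sub>C d *\<^sub>C x = (c * d) *\<^sub>C x" by (simp add: scaleC_scaleC)
  show "0 *\<^sub>C x = 0" using scaleR_scaleC[of 0 x] by simp
  then show "(- c) *\<^sub>C x = - (c *\<^sub>C x)"
    using scaleC_add_left[of c "- c" x] by (simp add: eq_neg_iff_add_eq_0 add.commute)
qed

lemma cinner_eq_zero_all: "(\<And>v. cinner v x = 0) \<Longrightarrow> x = 0"
  for x :: "'a::complex_hilbert_space"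
  using cinner_self[of x] by simp

section \<open>Closed complex subspaces and their orthogonal projections\<close>

lemma csubspaceD:
  assumes "csubspace V"
  shows "0 \<in> V" "u \<in> V \<Longrightarrow> v \<in> V \<Longrightarrow> u + v \<in> V" "u \<in> V \<Longrightarrow> c *\<^sub>C u \<in> V"
    "u \<in> V \<Longrightarrow> r *\<^sub>R u \<in> V" "u \<in> V \<Longrightarrow> - u \<in> V" "u \<in> V \<Longrightarrow> v \<in> V \<Longrightarrow> u - v \<in> V"
proof -
  show 1: "0 \<in> V" "u \<in> V \<Longrightarrow> v \<in> V \<Longrightarrow> u + v \<in> V" "u \<in> V \<Longrightarrow> c *\<^sub>C u \<in> V" for u v c
    using assms by (auto simp: csubspace_def)
  show 2: "u \<in> V \<Longrightarrow> r *\<^sub>R u \<in> V" for u r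
    by (simp add: scaleR_scaleC 1)
  show 3: "u \<in> V \<Longrightarrow> - u \<in> V" for u using 2[of u "-1"] by simp
  show "u \<in> V \<Longrightarrow> v \<in> V \<Longrightarrow> u - v \<in> V" using 1(2)[of u "- v"] 3[of v] by simp
qed

text \<open>The parallelogram identity makes a minimizing sequence Cauchy: midpoints stay in
  \<open>V\<close>, so their distance to \<open>u\<close> is at least the infimum
  \<open>d\<close>.\<close>

lemma ex_nearest_point:
  fixes V :: "'a::complex_hilbert_space set"
  assumes V: "csubspace V" "closed V"
  obtains w where "w \<in> V" "\<And>v. v \<in> V \<Longrightarrow> norm (u - w) \<le> norm (u - v)"
proof -
  define d where "d = (INF v\<in>V. norm (u - v))"
  have ne: "V \<noteq> {}" using csubspaceD(1)[OF V(1)] by blast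
  have bdd: "bdd_below ((\<lambda>v. norm (u - v)) ` V)" by (intro bdd_belowI[of _ 0]) auto
  have dle: "d \<le> norm (u - v)" if "v \<in> V" for v
    unfolding d_def by (rule cINF_lower[OF bdd that])
  have d0: "0 \<le> d" unfolding d_def by (rule cINF_greatest[OF ne]) auto
  have "\<exists>v\<in>V. (norm (u - v))\<^sup>2 < d\<^sup>2 + 1 / real (Suc n)" for n
  proof -
    have "d < sqrt (d\<^sup>2 + 1 / real (Suc n))"
      by (rule real_less_rsqrt) simp
    then obtain v where "v \<in> V" "norm (u - v) < sqrt (d\<^sup>2 + 1 / real (Suc n))"
      unfolding d_def using cINF_less_iff[OF ne bdd] by auto
    then show ?thesis
      by (intro bexI[of _ v]) (metis abs_norm_cancel real_sqrt_abs real_sqrt_less_iff)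
  qed
  then obtain w where wV: "\<And>n. w n \<in> V" and wd: "\<And>n. (norm (u - w n))\<^sup>2 < d\<^sup>2 + 1 / real (Suc n)"
    by metis
  have diff: "(norm (w m - w n))\<^sup>2 \<le> 2 / real (Suc m) + 2 / real (Suc n)" for m n
  proof -
    have "(norm (w m - w n))\<^sup>2 = 2 * (norm (u - w m))\<^sup>2 + 2 * (norm (u - w n))\<^sup>2
       - 4 * (norm (u - (1/2) *\<^sub>R (w m + w n)))\<^sup>2"
      by (simp add: power2_norm_eq_inner inner_simps inner_commute algebra_simps)
    moreover have "d\<^sup>2 \<le> (norm (u - (1/2) *\<^sub>R (w m + w n)))\<^sup>2"
      using dle d0 wV csubspaceD[OF V(1)] by (intro power_mono) auto
    ultimately show ?thesis using wd[of m] wd[of n] by linarith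
  qed
  have "Cauchy w"
  proof (rule CauchyI)
    fix e :: real assume "0 < e"
    then obtain k :: nat where k: "4 / e\<^sup>2 < real k" using reals_Archimedean2 by blast
    have "norm (w m - w n) < e" if "k \<le> m" "k \<le> n" for m n
    proof -
      have pos: "0 < real k" using k \<open>0 < e\<close> by (smt (verit) divide_nonneg_nonneg zero_le_power2)
      have "2 / real (Suc m) \<le> 2 / real k" "2 / real (Suc n) \<le> 2 / real k"
        using that pos by (auto intro!: divide_left_mono mult_pos_pos)
      moreover have "4 / real k < e\<^sup>2" using k pos \<open>0 < e\<close> by (simp add: field_simps)
      ultimately have "(norm (w m - w n))\<^sup>2 < e\<^sup>2" using diff[of m n] by simp
      then show ?thesis using \<open>0 < e\<close> by (simp add: power_less_imp_less_base)
    qed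
    then show "\<exists>M. \<forall>m\<ge>M. \<forall>n\<ge>M. norm (w m - w n) < e" by blast
  qed
  then obtain l where l: "w \<longlonglongrightarrow> l" using Cauchy_convergent convergent_def by blast
  have "l \<in> V" using V(2) wV l closed_sequentially by blast
  moreover have "norm (u - l) \<le> norm (u - v)" if "v \<in> V" for v
  proof -
    have "(\<lambda>n. (norm (u - w n))\<^sup>2) \<longlonglongrightarrow> (norm (u - l))\<^sup>2" by (intro tendsto_intros l)
    moreover have "(\<lambda>n. d\<^sup>2 + 1 / real (Suc n)) \<longlonglongrightarrow> d\<^sup>2 + 0"
      by (intro tendsto_intros LIMSEQ_Suc lim_1_over_n)
    ultimately have "(norm (u - l))\<^sup>2 \<le> d\<^sup>2 + 0"
      by (rule LIMSEQ_le) (intro exI allI impI less_imp_le wd)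
    then have "norm (u - l) \<le> d" using d0 power2_le_imp_le[of "norm (u - l)" d] by simp
    then show ?thesis using dle[OF that] by linarith
  qed
  ultimately show ?thesis using that by blast
qed

text \<open>First variation at the nearest point. It controls only the real part of the inner
  product; the imaginary part comes from testing with \<i> v, which again lies in
  \<open>V\<close>.\<close>

lemma ex_orth_proj:
  fixes V :: "'a::complex_hilbert_space set"
  assumes V: "csubspace V" "closed V"
  obtains w where "w \<in> V" "\<And>v. v \<in> V \<Longrightarrow> cinner v (u - w) = 0"
proof -
  obtain w where w: "w \<in> V" "\<And>v. v \<in> V \<Longrightarrow> norm (u - w) \<le> norm (u - v)"
    using ex_nearest_point[OF V] by blast
  have re: "inner v (u - w) = 0" if v: "v \<in> V" for v
  proof (cases "v = 0")
    case False
    \<comment> \<open>The minimizer of the real quadratic c -> norm (u - w - c v)^2; the distance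
      would decrease by the squared inner product over (norm v)^2.\<close>
    define c where "c = inner v (u - w) / (norm v)\<^sup>2"
    have "(norm (u - w))\<^sup>2 \<le> (norm (u - (w + c *\<^sub>R v)))\<^sup>2"
      using w v csubspaceD[OF V(1)] by (intro power_mono) auto
    also have "\<dots> = (norm (u - w))\<^sup>2 - 2 * c * inner v (u - w) + c\<^sup>2 * (norm v)\<^sup>2"
      using power2_norm_eq_inner[of "u - (w + c *\<^sub>R v)"] power2_norm_eq_inner[of "u - w"] power2_norm_eq_inner[of v]
      by (simp add: inner_simps inner_commute power2_eq_square algebra_simps diff_diff_eq)
    also have "\<dots> = (norm (u - w))\<^sup>2 - (inner v (u - w))\<^sup>2 / (norm v)\<^sup>2"
      using False by (simp add: c_def power2_eq_square field_simps)
    finally have "(inner v (u - w))\<^sup>2 / (norm v)\<^sup>2 \<le> 0" by simp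
    then have "(inner v (u - w))\<^sup>2 \<le> 0" using False by (simp add: divide_le_0_iff)
    then show ?thesis by simp
  qed simp
  have "cinner v (u - w) = 0" if v: "v \<in> V" for v
  proof -
    have "Re (cinner v (u - w)) = 0" using re[OF v] by (simp add: inner_eq_Re_cinner)
    moreover have "Im (cinner v (u - w)) = 0"
      using re[OF csubspaceD(3)[OF V(1) v, of \<i>]] by (simp add: inner_eq_Re_cinner cinner_simps)
    ultimately show ?thesis by (simp add: complex_eq_iff)
  qed
  with w(1) show ?thesis using that by blast
qed

text \<open>Two candidates differ by a vector of \<open>V\<close> that is orthogonal to itself, so
  the definite description is well defined and its values can be computed by guessing them.\<close>

lemma orth_proj_eqI:
  fixes V :: "'a::complex_hilbert_space set"
  assumes V: "csubspace V" and w: "w \<in> V" "\<And>v. v \<in> V \<Longrightarrow> cinner v (u - w) = 0"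
  shows "orth_proj V u = w"
  unfolding orth_proj_def
proof (rule the_equality)
  fix w' assume w': "w' \<in> V \<and> (\<forall>v\<in>V. cinner v (u - w') = 0)"
  have "w - w' \<in> V" using w(1) w' csubspaceD(6)[OF V] by blast
  then have "cinner (w - w') (u - w') - cinner (w - w') (u - w) = 0" using w(2) w' by simp
  then have "cinner (w - w') (w - w') = 0" by (simp add: cinner_simps algebra_simps)
  then show "w' = w" by (simp add: cinner_self)
qed (simp add: w)

locale closed_csubspace =
  fixes V :: "'a::complex_hilbert_space set"
  assumes V: "csubspace V" "closed V"
begin

lemma orth_proj_in: "orth_proj V u \<in> V"
  and orth_proj_orth: "v \<in> V \<Longrightarrow> cinner v (u - orth_proj V u) = 0"
proof -
  obtain w where w: "w \<in> V" "\<And>v. v \<in> V \<Longrightarrow> cinner v (u - w) = 0"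
    using ex_orth_proj[OF V, of u] by metis
  then have "orth_proj V u = w" by (rule orth_proj_eqI[OF V(1)])
  then show "orth_proj V u \<in> V" "v \<in> V \<Longrightarrow> cinner v (u - orth_proj V u) = 0"
    using w by simp_all
qed

lemma cinner_orth_proj: "v \<in> V \<Longrightarrow> cinner v (orth_proj V u) = cinner v u"
  using orth_proj_orth[of v u] by (simp add: cinner_simps)

lemma orth_proj_add: "orth_proj V (u + v) = orth_proj V u + orth_proj V v"
  by (rule orth_proj_eqI[OF V(1)])
    (auto intro: csubspaceD(2)[OF V(1)] orth_proj_in simp: cinner_simps cinner_orth_proj)

lemma orth_proj_scaleC: "orth_proj V (c *\<^sub>C u) = c *\<^sub>C orth_proj V u"
  by (rule orth_proj_eqI[OF V(1)])
    (auto intro: csubspaceD(3)[OF V(1)] orth_proj_in simp: cinner_simps cinner_orth_proj)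

lemma orth_proj_id: "u \<in> V \<Longrightarrow> orth_proj V u = u"
  by (rule orth_proj_eqI[OF V(1)]) (auto simp: cinner_simps)

lemma orth_proj_sym: "cinner (orth_proj V u) v = cinner u (orth_proj V v)"
  by (metis cinner_commute cinner_orth_proj orth_proj_in)

lemma norm_orth_proj_le: "norm (orth_proj V u) \<le> norm u"
proof -
  have "(norm (orth_proj V u))\<^sup>2 = cmod (cinner (orth_proj V u) u)"
  proof -
    have "cinner (orth_proj V u) u = of_real ((norm (orth_proj V u))\<^sup>2)"
      by (metis cinner_orth_proj cinner_self orth_proj_in)
    then show ?thesis by (simp only: norm_of_real abs_power2)
  qed
  also have "\<dots> \<le> norm (orth_proj V u) * norm u" by (rule cmod_cinner_le)
  finally have "norm (orth_proj V u) * norm (orth_proj V u) \<le> norm (orth_proj V u) * norm u"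
    unfolding power2_eq_square .
  then show ?thesis
    by (cases "norm (orth_proj V u) = 0") simp_all
qed

lemma bounded_linear_orth_proj: "bounded_linear (orth_proj V)"
proof (rule bounded_linear_intro[where K = 1])
  show "orth_proj V (r *\<^sub>R u) = r *\<^sub>R orth_proj V u" for r u
    unfolding scaleR_scaleC by (rule orth_proj_scaleC)
qed (simp_all add: orth_proj_add norm_orth_proj_le)

end

section \<open>Completeness of the eigenspaces\<close>

lemma closed_cinner_eq_0: "closed {x::'a::complex_hilbert_space. cinner w x = 0}"
  by (rule closed_Collect_eq[OF bounded_bilinear.continuous_on[OF bounded_bilinear_cinner]])
    (rule continuous_on_const continuous_on_id)+

section \<open>The positive self-adjoint operator and the inverse of 1 + H_0\<close>

locale positive_compact =
  fixes H\<^sub>0 :: "'a::complex_hilbert_space unbounded_op"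
  assumes H0: "self_adjoint_op H\<^sub>0" "positive_op H\<^sub>0" "compact_resolvent H\<^sub>0"
begin

abbreviation "D \<equiv> op_dom H\<^sub>0"
abbreviation "T \<equiv> op_app H\<^sub>0"

lemma csubspace_D: "csubspace D" and dense_D: "closure D = UNIV" and T_lin: "clinear_on D T"
  using H0(1) by (auto simp: self_adjoint_op_def densely_defined_op_def)

lemma T_add: "u \<in> D \<Longrightarrow> v \<in> D \<Longrightarrow> T (u + v) = T u + T v"
  and T_scaleC: "u \<in> D \<Longrightarrow> T (c *\<^sub>C u) = c *\<^sub>C T u"
  using T_lin by (auto simp: clinear_on_def)

lemma T_diff: "u \<in> D \<Longrightarrow> v \<in> D \<Longrightarrow> T (u - v) = T u - T v"
  using T_add[of u "(-1) *\<^sub>C v"] T_scaleC[of v "-1"] csubspaceD(5)[OF csubspace_D] by simp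

lemma eq_zero_if_orth_D:
  assumes "\<And>x. x \<in> D \<Longrightarrow> cinner w x = 0"
  shows "w = 0"
proof -
  have "closed {x. cinner w x = 0}"
    by (rule closed_cinner_eq_0)
  then have "closure D \<subseteq> {x. cinner w x = 0}"
    by (rule closure_minimal[rotated]) (use assms in blast)
  then have "cinner w w = 0" using dense_D by blast
  then show ?thesis by (simp add: cinner_self)
qed

text \<open>Values of the adjoint are definite descriptions; density of the domain makes the
  representing vector unique, and only then does equality with the adjoint turn into
  symmetry.\<close>

lemma T_sym:
  assumes "u \<in> D" "x \<in> D"
  shows "cinner u (T x) = cinner (T u) x"
proof -
  have "u \<in> op_dom (adjoint_op H\<^sub>0)" using H0(1) assms by (simp add: self_adjoint_op_def)
  then obtain w where w: "\<forall>x\<in>D. cinner u (T x) = cinner w x"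
    by (auto simp: adjoint_op_def)
  have "op_app (adjoint_op H\<^sub>0) u = w"
    unfolding adjoint_op_def snd_conv
  proof (rule the_equality, rule w)
    fix w' assume "\<forall>x\<in>D. cinner u (T x) = cinner w' x"
    with w have "w' - w = 0" by (intro eq_zero_if_orth_D) (simp add: cinner_simps)
    then show "w' = w" by simp
  qed
  then have "T u = w" using H0(1) assms by (simp add: self_adjoint_op_def)
  then show ?thesis using w assms by simp
qed

text \<open>The half of self-adjointness that concerns domains: a solution of the weak equation lies
  in \<open>D\<close>. Closedness of \<open>T\<close> and surjectivity of 1 + T are drawn from
  it.\<close>

lemma T_maximal:
  assumes "\<And>x. x \<in> D \<Longrightarrow> cinner v (T x) = cinner w x"
  shows "v \<in> D" "T v = w"
proof -
  have "v \<in> op_dom (adjoint_op H\<^sub>0)" using assms by (auto simp: adjoint_op_def)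
  then show v: "v \<in> D" using H0(1) by (simp add: self_adjoint_op_def)
  have "T v - w = 0"
    by (rule eq_zero_if_orth_D) (simp add: cinner_simps assms T_sym[OF v, symmetric])
  then show "T v = w" by simp
qed

text \<open>The weak equation against a fixed \<open>x\<close> in \<open>D\<close> passes to the
  limit, and \<open>T_maximal\<close> returns the strong one.\<close>

lemma T_closed:
  assumes "\<And>n::nat. u n \<in> D" "u \<longlonglongrightarrow> l" "(\<lambda>n. T (u n)) \<longlonglongrightarrow> y"
  shows "l \<in> D" "T l = y"
proof -
  have *: "cinner l (T x) = cinner y x" if "x \<in> D" for x
  proof (rule LIMSEQ_unique)
    show "(\<lambda>n. cinner (u n) (T x)) \<longlonglongrightarrow> cinner l (T x)"
      by (intro bounded_bilinear.tendsto[OF bounded_bilinear_cinner] assms tendsto_const)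
    show "(\<lambda>n. cinner (u n) (T x)) \<longlonglongrightarrow> cinner y x"
      unfolding T_sym[OF assms(1) that]
      by (intro bounded_bilinear.tendsto[OF bounded_bilinear_cinner] assms tendsto_const)
  qed
  show "l \<in> D" "T l = y" using T_maximal[OF *] by blast+
qed

lemma T_nonneg: "u \<in> D \<Longrightarrow> 0 \<le> Re (cinner u (T u))"
  using H0(2) by (simp add: positive_op_def)

definition Lop :: "'a \<Rightarrow> 'a" where "Lop u = u + T u"

text \<open>Positivity makes 1 + T bounded below by 1. Injectivity, closed range and the norm bound
  for the inverse all come from this.\<close>

lemma norm_le_L: "u \<in> D \<Longrightarrow> norm u \<le> norm (Lop u)"
proof -
  assume u: "u \<in> D"
  have "(norm u)\<^sup>2 \<le> Re (cinner u (Lop u))"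
    using T_nonneg[OF u] by (simp add: Lop_def cinner_simps cinner_self)
  also have "\<dots> \<le> norm u * norm (Lop u)"
    using cmod_cinner_le complex_Re_le_cmod order_trans by blast
  finally have "norm u * norm u \<le> norm u * norm (Lop u)" by (simp add: power2_eq_square)
  then show ?thesis by (cases "u = 0") simp_all
qed

lemma Lop_diff: "u \<in> D \<Longrightarrow> v \<in> D \<Longrightarrow> Lop (u - v) = Lop u - Lop v"
  and Lop_add: "u \<in> D \<Longrightarrow> v \<in> D \<Longrightarrow> Lop (u + v) = Lop u + Lop v"
  and Lop_scaleC: "u \<in> D \<Longrightarrow> Lop (c *\<^sub>C u) = c *\<^sub>C Lop u"
  by (simp_all add: Lop_def T_diff T_add T_scaleC scaleC_add_right)

lemma inj_L: "inj_on Lop D"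
proof (rule inj_onI)
  fix u v assume uv: "u \<in> D" "v \<in> D" "Lop u = Lop v"
  then have "norm (u - v) \<le> norm (Lop (u - v))"
    by (intro norm_le_L csubspaceD(6)[OF csubspace_D])
  then show "u = v" using uv by (simp add: Lop_diff)
qed

text \<open>The range is closed because \<open>Lop\<close> is bounded below and \<open>T\<close> is
  closed. A vector w orthogonal to the range satisfies T w = - w by maximality, so Lop w = 0 and
  hence w = 0.\<close>

lemma Lop_surj: "Lop ` D = UNIV"
proof -
  have sub: "csubspace (Lop ` D)"
    unfolding csubspace_def
  proof (intro conjI ballI allI)
    show "0 \<in> Lop ` D"
      using csubspaceD(1)[OF csubspace_D] by (metis Lop_diff diff_self imageI)
    fix u v assume "u \<in> Lop ` D" "v \<in> Lop ` D"
    then obtain x y where "x \<in> D" "y \<in> D" "u = Lop x" "v = Lop y" by blast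
    then show "u + v \<in> Lop ` D"
      by (intro image_eqI[of _ _ "x + y"] csubspaceD(2)[OF csubspace_D]) (simp_all add: Lop_add)
  next
    fix c u assume "u \<in> Lop ` D"
    then obtain x where "x \<in> D" "u = Lop x" by blast
    then show "c *\<^sub>C u \<in> Lop ` D"
      by (intro image_eqI[of _ _ "c *\<^sub>C x"] csubspaceD(3)[OF csubspace_D]) (simp_all add: Lop_scaleC)
  qed
  have "closed (Lop ` D)"
    unfolding closed_sequential_limits
  proof (intro allI impI, elim conjE)
    fix f y assume f: "\<forall>n. f n \<in> Lop ` D" and y: "f \<longlonglongrightarrow> y"
    from f have "\<forall>n. \<exists>u. u \<in> D \<and> f n = Lop u" by blast
    then obtain u where u: "\<And>n. u n \<in> D" "\<And>n. f n = Lop (u n)" by metis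
    have "Cauchy u"
    proof (rule CauchyI)
      fix e :: real assume "0 < e"
      with y obtain M where "\<forall>m\<ge>M. \<forall>n\<ge>M. norm (f m - f n) < e"
        using CauchyD[OF LIMSEQ_imp_Cauchy[OF y]] by blast
      moreover have "norm (u m - u n) \<le> norm (f m - f n)" for m n
        using norm_le_L[OF csubspaceD(6)[OF csubspace_D u(1) u(1)]] u by (simp add: Lop_diff)
      ultimately show "\<exists>M. \<forall>m\<ge>M. \<forall>n\<ge>M. norm (u m - u n) < e"
        by (meson order_le_less_trans)
    qed
    then obtain l where l: "u \<longlonglongrightarrow> l" using Cauchy_convergent convergent_def by blast
    have "(\<lambda>n. f n - u n) \<longlonglongrightarrow> y - l" by (intro tendsto_intros y l)
    then have "(\<lambda>n. T (u n)) \<longlonglongrightarrow> y - l" by (simp add: u Lop_def)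
    from T_closed[OF u(1) l this] show "y \<in> Lop ` D"
      by (intro image_eqI[of _ _ l]) (simp_all add: Lop_def)
  qed
  then interpret closed_csubspace "Lop ` D" by unfold_locales (rule sub)
  have "u \<in> Lop ` D" for u
  proof -
    define w where "w = u - orth_proj (Lop ` D) u"
    have w: "cinner (Lop x) w = 0" if "x \<in> D" for x
      unfolding w_def using that by (intro orth_proj_orth) simp
    have *: "cinner w (T x) = cinner (- w) x" if "x \<in> D" for x
    proof -
      have "cinner w (Lop x) = 0" using w[OF that] cinner_commute[of w "Lop x"] by simp
      then show ?thesis by (simp add: Lop_def cinner_simps eq_neg_iff_add_eq_0 add.commute)
    qed
    have "w \<in> D" "T w = - w" using T_maximal[OF *] by blast+
    then have "norm w \<le> norm (w + T w)" "T w = - w" using norm_le_L[of w] by (simp_all add: Lop_def)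
    then have "u = orth_proj (Lop ` D) u" by (simp add: w_def)
    then show ?thesis by (metis orth_proj_in)
  qed
  then show ?thesis by blast
qed

text \<open>This inverse is preferred to the resolvent at the point given by compactness of the
  resolvent, because it is self-adjoint wherever that point lies.\<close>

definition Sop :: "'a \<Rightarrow> 'a" where "Sop = inv_into D Lop"

lemma Sop_in: "Sop y \<in> D" and Lop_S: "Lop (Sop y) = y"
  by (simp_all add: Sop_def inv_into_into f_inv_into_f Lop_surj)

lemma Sop_L: "u \<in> D \<Longrightarrow> Sop (Lop u) = u"
  by (simp add: Sop_def inv_into_f_f[OF inj_L])

lemma Sop_diff: "Sop (x - y) = Sop x - Sop y"
  by (metis Lop_S Lop_diff Sop_L Sop_in csubspaceD(6)[OF csubspace_D])

lemma Sop_scaleC: "Sop (c *\<^sub>C x) = c *\<^sub>C Sop x"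
  by (metis Lop_S Lop_scaleC Sop_L Sop_in csubspaceD(3)[OF csubspace_D])

lemma norm_S_le: "norm (Sop y) \<le> norm y"
  using norm_le_L[OF Sop_in] by (simp add: Lop_S)

lemma Sop_scaleR: "Sop (r *\<^sub>R x) = r *\<^sub>R Sop x"
  by (simp add: scaleR_scaleC Sop_scaleC)

lemma bounded_linear_S: "bounded_linear Sop"
proof (rule bounded_linear_intro[where K = 1])
  have S0: "Sop 0 = 0" using Sop_diff[of 0 0] by simp
  show "Sop (x + y) = Sop x + Sop y" for x y
    using Sop_diff[of x "- y"] Sop_diff[of 0 y] by (simp add: S0)
qed (simp_all add: norm_S_le Sop_scaleR)

lemma Sop_sym: "cinner (Sop x) y = cinner x (Sop y)"
proof -
  have "cinner (Sop x) (Lop (Sop y)) = cinner (Lop (Sop x)) (Sop y)"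
    by (simp add: Lop_def cinner_simps T_sym Sop_in)
  then show ?thesis by (simp add: Lop_S)
qed

lemma Sop_eq_0D: "Sop x = 0 \<Longrightarrow> x = 0"
  using Lop_S[of x] Lop_diff[OF Sop_in Sop_in, of x x] by simp

text \<open>Compactness is known at some point z of the resolvent set; the resolvent identity S f =
  R(z) (f - (1 + z) S f) transfers it to the point -1.\<close>

lemma Sop_compact:
  assumes "\<And>n::nat. norm (f n) \<le> K"
  obtains l r where "strict_mono r" "(\<lambda>n. Sop (f (r n))) \<longlonglongrightarrow> l"
proof -
  obtain z where z: "z \<in> resolvent_set H\<^sub>0" "compact_op (resolvent_op H\<^sub>0 z)"
    using H0(3) by (auto simp: compact_resolvent_def)
  have inj: "inj_on (\<lambda>u. T u - z *\<^sub>C u) D"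
    using z(1) by (auto simp: resolvent_set_def bij_betw_def)
  define g where "g n = f n - (1 + z) *\<^sub>C Sop (f n)" for n
  have g: "resolvent_op H\<^sub>0 z (g n) = Sop (f n)" for n
  proof -
    have "g n = T (Sop (f n)) - z *\<^sub>C Sop (f n)"
      using Lop_S[of "f n"] scaleR_scaleC[of 1 "Sop (f n)"]
      by (simp add: g_def scaleC_add_left Lop_def algebra_simps)
    then show ?thesis
      unfolding resolvent_op_def using inv_into_f_f[OF inj Sop_in] by simp
  qed
  have "norm (g n) \<le> K + cmod (1 + z) * K" for n
  proof -
    have "norm (g n) \<le> norm (f n) + cmod (1 + z) * norm (Sop (f n))"
      unfolding g_def norm_scaleC[symmetric] by (rule norm_triangle_ineq4)
    also have "\<dots> \<le> K + cmod (1 + z) * K"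
      using norm_S_le[of "f n"] assms[of n] by (intro add_mono mult_left_mono) auto
    finally show ?thesis .
  qed
  then have "bounded (range g)" by (auto simp: bounded_iff)
  then have "compact (closure (resolvent_op H\<^sub>0 z ` range g))"
    using z(2) by (simp add: compact_op_def)
  then have sc: "seq_compact (closure (resolvent_op H\<^sub>0 z ` range g))"
    by (rule compact_imp_seq_compact)
  have "\<forall>n. Sop (f n) \<in> closure (resolvent_op H\<^sub>0 z ` range g)"
    unfolding g[symmetric] by (intro allI subsetD[OF closure_subset] imageI rangeI)
  with sc obtain l r where "strict_mono r" "((\<lambda>n. Sop (f n)) \<circ> r) \<longlonglongrightarrow> l"
    by (rule seq_compactE)
  then show ?thesis using that by (simp add: o_def)
qed

section \<open>Eigenspaces and their completeness\<close>

lemma eigenspace_iff: "u \<in> eigenspace H\<^sub>0 x \<longleftrightarrow> u \<in> D \<and> T u = x *\<^sub>R u"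
  by (simp add: eigenspace_def)

lemma closed_csubspace_eigenspace: "closed_csubspace (eigenspace H\<^sub>0 x)"
proof
  show "csubspace (eigenspace H\<^sub>0 x)"
    using T_scaleC[OF csubspaceD(1)[OF csubspace_D], of 0] csubspace_D
    by (auto simp: csubspace_def eigenspace_iff T_add T_scaleC scaleC_add_right scaleR_scaleC mult.commute)
  show "closed (eigenspace H\<^sub>0 x)"
    unfolding closed_sequential_limits
  proof (intro allI impI, elim conjE)
    fix f l assume f: "\<forall>n. f n \<in> eigenspace H\<^sub>0 x" "f \<longlonglongrightarrow> l"
    have "(\<lambda>n. x *\<^sub>R f n) \<longlonglongrightarrow> x *\<^sub>R l" by (intro tendsto_intros f)
    then have "(\<lambda>n. T (f n)) \<longlonglongrightarrow> x *\<^sub>R l" using f(1) by (simp add: eigenspace_iff)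
    from T_closed[OF _ f(2) this] f(1) show "l \<in> eigenspace H\<^sub>0 x"
      by (simp add: eigenspace_iff)
  qed
qed

lemma eigenvalues_nonneg: "x \<in> eigenvalues H\<^sub>0 \<Longrightarrow> 0 \<le> x"
proof -
  assume "x \<in> eigenvalues H\<^sub>0"
  then obtain u where u: "u \<in> eigenspace H\<^sub>0 x" "u \<noteq> 0"
    using csubspaceD(1)[OF closed_csubspace.V(1)[OF closed_csubspace_eigenspace, of x]]
    unfolding eigenvalues_def by blast
  then have "0 \<le> x * (norm u)\<^sup>2"
    using T_nonneg[of u] by (simp add: eigenspace_iff cinner_scaleR_right cinner_self)
  then show ?thesis using u(2) by (simp add: zero_le_mult_iff)
qed

lemma eigenspace_orth:
  assumes "u \<in> eigenspace H\<^sub>0 x" "v \<in> eigenspace H\<^sub>0 y" "x \<noteq> y"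
  shows "cinner u v = 0"
proof -
  have "of_real x * cinner u v = of_real y * cinner u v"
    using T_sym[of u v] assms by (simp add: eigenspace_iff cinner_scaleR_left cinner_scaleR_right)
  then show ?thesis using assms(3) by simp
qed

text \<open>An eigenvalue c of the inverse corresponds to x with c = 1 / (1 + x).\<close>

lemma Sop_eigenvector:
  assumes "Sop u = c *\<^sub>R u" "u \<noteq> 0"
  shows "c \<noteq> 0" "u \<in> eigenspace H\<^sub>0 (1 / c - 1)"
proof -
  show c: "c \<noteq> 0" using assms Sop_eq_0D by auto
  have "u = Lop (c *\<^sub>R u)" using Lop_S[of u] assms by simp
  moreover have uD: "u \<in> D"
    using csubspaceD(4)[OF csubspace_D Sop_in, of "1 / c" u] assms c by simp
  ultimately have "u = c *\<^sub>R (u + T u)"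
    using Lop_scaleC[OF uD, of "of_real c"] by (simp add: scaleR_scaleC Lop_def)
  then have "(1 / c) *\<^sub>R u = u + T u" using c by (metis divide_inverse mult_1 scaleR_scaleR left_inverse scaleR_one)
  then have "T u = (1 / c - 1) *\<^sub>R u" by (simp add: scaleR_left_diff_distrib)
  with uD show "u \<in> eigenspace H\<^sub>0 (1 / c - 1)" by (simp add: eigenspace_iff)
qed

text \<open>A nonzero orthogonal complement of the eigenspaces would be invariant under \<open>Sop\<close>. By compactness
  \<open>\<parallel>Sop u\<parallel>\<close> attains its maximum \<open>m\<close> over unit vectors of the complement, a maximizer satisfies
  \<open>Sop\<^sup>2 u = m\<^sup>2 u\<close>, and then \<open>u\<close> or \<open>Sop u - m u\<close> is an eigenvector.\<close>

lemma eigenspaces_total: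
  assumes "\<And>x v. v \<in> eigenspace H\<^sub>0 x \<Longrightarrow> cinner v u = 0"
  shows "u = 0"
proof (rule ccontr)
  assume "u \<noteq> 0"
  define W where "W = {w. \<forall>x. \<forall>v\<in>eigenspace H\<^sub>0 x. cinner v w = 0}"
  have W: "csubspace W" by (auto simp: W_def csubspace_def cinner_simps)
  have "W = (\<Inter>x. \<Inter>v\<in>eigenspace H\<^sub>0 x. {w. cinner v w = 0})" by (auto simp: W_def)
  then have closedW: "closed W"
    by (simp add: closed_INT closed_cinner_eq_0)
  have SW: "Sop w \<in> W" if "w \<in> W" for w
    unfolding W_def
  proof (intro CollectI allI ballI)
    fix x v assume v: "v \<in> eigenspace H\<^sub>0 x"
    \<comment> \<open>\<open>Sop\<close> commutes with \<open>T\<close> on \<open>v\<close>, so it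
      preserves the eigenspace; by symmetry it then preserves the complement
      \<open>W\<close>.\<close>
    have "Sop v \<in> eigenspace H\<^sub>0 x"
    proof -
      have "Sop (T v) = v - Sop v"
        using Sop_L[of v] v Sop_diff[of "Lop v" v] by (simp add: eigenspace_iff Lop_def algebra_simps)
      moreover have "T (Sop v) = v - Sop v" using Lop_S[of v] by (simp add: Lop_def algebra_simps)
      ultimately show ?thesis using v by (simp add: eigenspace_iff Sop_in Sop_scaleR)
    qed
    then show "cinner v (Sop w) = 0" using that by (simp add: Sop_sym[symmetric] W_def)
  qed
  have no_eigen: "w = 0" if "w \<in> W" "Sop w = c *\<^sub>R w" for w c
  proof (rule ccontr)
    assume "w \<noteq> 0"
    from Sop_eigenvector[OF that(2) this] that(1) have "cinner w w = 0" by (auto simp: W_def)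
    with \<open>w \<noteq> 0\<close> show False by (simp add: cinner_self)
  qed
  define m where "m = (SUP w\<in>{w\<in>W. norm w = 1}. norm (Sop w))"
  have bdd: "bdd_above ((\<lambda>w. norm (Sop w)) ` {w\<in>W. norm w = 1})"
    using norm_S_le by (intro bdd_aboveI[of _ 1]) (auto, metis)
  define u0 where "u0 = (1 / norm u) *\<^sub>R u"
  have u0: "u0 \<in> {w\<in>W. norm w = 1}"
    using assms \<open>u \<noteq> 0\<close> csubspaceD(4)[OF W] by (auto simp: u0_def W_def)
  have m_le: "norm (Sop w) \<le> m" if "w \<in> {w\<in>W. norm w = 1}" for w
    unfolding m_def by (rule cSUP_upper[OF that bdd])
  have "Sop u0 \<noteq> 0" using u0 Sop_eq_0D by force
  then have m0: "0 < m" using m_le[OF u0] by (smt (verit) zero_less_norm_iff)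
  have Sm: "norm (Sop w) \<le> m * norm w" if "w \<in> W" for w
  proof (cases "w = 0")
    case True
    then show ?thesis using Sop_diff[of 0 0] by simp
  next
    case False
    have "norm (Sop ((1 / norm w) *\<^sub>R w)) \<le> m"
      by (rule m_le) (use False that csubspaceD(4)[OF W] in auto)
    then show ?thesis using False by (simp add: Sop_scaleR field_simps)
  qed
  have "\<exists>w. w \<in> W \<and> norm w = 1 \<and> m - 1 / real (Suc n) < norm (Sop w)" for n
  proof -
    have "m - 1 / real (Suc n) < m" by simp
    then have "\<exists>w\<in>{w\<in>W. norm w = 1}. m - 1 / real (Suc n) < norm (Sop w)"
      unfolding m_def using less_cSUP_iff[OF _ bdd] u0 by blast
    then show ?thesis by blast
  qed
  then obtain f where f: "\<And>n. f n \<in> W" "\<And>n. norm (f n) = 1" "\<And>n. m - 1 / real (Suc n) < norm (Sop (f n))"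
    by metis
  have Sf: "(\<lambda>n. norm (Sop (f n))) \<longlonglongrightarrow> m"
  proof (rule tendsto_sandwich)
    show "(\<lambda>n. m - 1 / real (Suc n)) \<longlonglongrightarrow> m"
      using tendsto_diff[OF tendsto_const LIMSEQ_Suc[OF lim_1_over_n], of m] by simp
    show "\<forall>\<^sub>F n in sequentially. m - 1 / real (Suc n) \<le> norm (Sop (f n))"
      by (intro always_eventually allI less_imp_le f)
    show "\<forall>\<^sub>F n in sequentially. norm (Sop (f n)) \<le> m"
      by (intro always_eventually allI m_le) (simp add: f)
  qed simp
  obtain l r where r: "strict_mono r" and l: "(\<lambda>n. Sop (f (r n))) \<longlonglongrightarrow> l"
    using Sop_compact[of f 1] f(2) by (metis order_refl)
  have conv0: "(\<lambda>n. Sop (Sop (f n)) - m\<^sup>2 *\<^sub>R f n) \<longlonglongrightarrow> 0"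
  proof -
    \<comment> \<open>Expand the square. Symmetry turns the mixed term into norm (S f)^2, and norm
      (S S f) <= m norm (S f) on \<open>W\<close>. The three terms collapse to m^2 (m^2 - norm (S
      f)^2), which tends to 0 along the maximizing sequence.\<close>
    have le: "(norm (Sop (Sop (f n)) - m\<^sup>2 *\<^sub>R f n))\<^sup>2 \<le> m\<^sup>2 * (m\<^sup>2 - (norm (Sop (f n)))\<^sup>2)" for n
    proof -
      have ip: "inner (Sop (Sop (f n))) (f n) = (norm (Sop (f n)))\<^sup>2"
        by (simp add: inner_eq_Re_cinner Sop_sym cinner_self)
      have "(norm (Sop (Sop (f n)) - m\<^sup>2 *\<^sub>R f n))\<^sup>2
          = (norm (Sop (Sop (f n))))\<^sup>2 - 2 * m\<^sup>2 * (norm (Sop (f n)))\<^sup>2 + m\<^sup>2 * m\<^sup>2"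
        using power2_norm_eq_inner[of "Sop (Sop (f n)) - m\<^sup>2 *\<^sub>R f n"] power2_norm_eq_inner[of "Sop (Sop (f n))"]
          power2_norm_eq_inner[of "f n"] ip f(2)[of n]
        by (simp add: inner_simps inner_commute algebra_simps)
      moreover have "(norm (Sop (Sop (f n))))\<^sup>2 \<le> (m * norm (Sop (f n)))\<^sup>2"
        by (intro power_mono Sm SW f) simp
      ultimately show ?thesis by (simp add: power_mult_distrib algebra_simps)
    qed
    have lim: "(\<lambda>n. m\<^sup>2 * (m\<^sup>2 - (norm (Sop (f n)))\<^sup>2)) \<longlonglongrightarrow> m\<^sup>2 * (m\<^sup>2 - m\<^sup>2)"
      by (intro tendsto_intros Sf)
    have "(\<lambda>n. (norm (Sop (Sop (f n)) - m\<^sup>2 *\<^sub>R f n))\<^sup>2) \<longlonglongrightarrow> m\<^sup>2 * (m\<^sup>2 - m\<^sup>2)"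
    proof (rule tendsto_sandwich[OF _ _ _ lim])
      show "(\<lambda>n. 0) \<longlonglongrightarrow> m\<^sup>2 * (m\<^sup>2 - m\<^sup>2)" by simp
    qed (auto intro!: always_eventually le)
    then have "(\<lambda>n. sqrt ((norm (Sop (Sop (f n)) - m\<^sup>2 *\<^sub>R f n))\<^sup>2)) \<longlonglongrightarrow> sqrt (m\<^sup>2 * (m\<^sup>2 - m\<^sup>2))"
      by (rule tendsto_real_sqrt)
    then show ?thesis by (simp add: tendsto_norm_zero_iff)
  qed
  have Scont: "(\<lambda>n. Sop (g n)) \<longlonglongrightarrow> Sop x" if "g \<longlonglongrightarrow> x" for g :: "nat \<Rightarrow> 'a" and x
    by (rule bounded_linear.tendsto[OF bounded_linear_S that])
  \<comment> \<open>Compactness gives convergence of S f along the subsequence, not of f. Writing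
    m^2 f = S S f - (S S f - m^2 f) transfers it, with limit S l / m^2.\<close>
  define w where "w = (1 / m\<^sup>2) *\<^sub>R Sop l"
  have fw: "(\<lambda>n. f (r n)) \<longlonglongrightarrow> w"
  proof -
    have "(\<lambda>n. (1 / m\<^sup>2) *\<^sub>R (Sop (Sop (f (r n))) - (Sop (Sop (f (r n))) - m\<^sup>2 *\<^sub>R f (r n)))) \<longlonglongrightarrow> (1 / m\<^sup>2) *\<^sub>R (Sop l - 0)"
      using LIMSEQ_subseq_LIMSEQ[OF conv0 r] by (intro tendsto_intros Scont l) (simp add: o_def)
    then show ?thesis using m0 by (simp add: w_def)
  qed
  have wW: "w \<in> W" by (rule closed_sequentially[OF closedW _ fw]) (simp add: f)
  have "norm w = 1"
    using tendsto_norm[OF fw] by (simp add: f(2) LIMSEQ_const_iff)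
  have SSw: "Sop (Sop w) = m\<^sup>2 *\<^sub>R w"
  proof -
    have "(\<lambda>n. Sop (Sop (f (r n))) - m\<^sup>2 *\<^sub>R f (r n)) \<longlonglongrightarrow> Sop (Sop w) - m\<^sup>2 *\<^sub>R w"
      by (intro tendsto_intros Scont fw)
    moreover have "(\<lambda>n. Sop (Sop (f (r n))) - m\<^sup>2 *\<^sub>R f (r n)) \<longlonglongrightarrow> 0"
      using LIMSEQ_subseq_LIMSEQ[OF conv0 r] by (simp add: o_def)
    ultimately have "Sop (Sop w) - m\<^sup>2 *\<^sub>R w = 0" by (rule LIMSEQ_unique)
    then show ?thesis by simp
  qed
  have "Sop w - m *\<^sub>R w = 0"
  proof (rule no_eigen)
    show "Sop w - m *\<^sub>R w \<in> W" by (intro csubspaceD[OF W] SW wW)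
    show "Sop (Sop w - m *\<^sub>R w) = (- m) *\<^sub>R (Sop w - m *\<^sub>R w)"
      by (simp add: Sop_diff Sop_scaleR SSw algebra_simps power2_eq_square)
  qed
  then have "w = 0" using no_eigen[OF wW, of m] by simp
  with \<open>norm w = 1\<close> show False by simp
qed

end

section \<open>Functional calculus in eigenspace coordinates\<close>

lemma norm_sum_orthogonal:
  fixes f :: "'i \<Rightarrow> 'a::real_inner"
  assumes "finite F" "\<And>x y. x \<in> F \<Longrightarrow> y \<in> F \<Longrightarrow> x \<noteq> y \<Longrightarrow> inner (f x) (f y) = 0"
  shows "(norm (sum f F))\<^sup>2 = (\<Sum>x\<in>F. (norm (f x))\<^sup>2)"
  using assms
proof (induction F)
  case (insert x F)
  have "inner (f x) (sum f F) = 0"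
    unfolding inner_sum_right by (intro sum.neutral ballI insert.prems) (use insert.hyps in auto)
  then show ?case
    using insert by (simp add: power2_norm_eq_inner inner_simps inner_commute)
qed simp

text \<open>Absolute convergence may fail, so the finite partial sums are shown to be Cauchy
  directly: by Pythagoras, the distance to the sum over a large finite set is governed by the tail
  of the squared norms.\<close>

lemma orthogonal_summable_on:
  fixes f :: "'i \<Rightarrow> 'a::{real_inner,banach}"
  assumes orth: "\<And>x y. x \<in> A \<Longrightarrow> y \<in> A \<Longrightarrow> x \<noteq> y \<Longrightarrow> inner (f x) (f y) = 0"
    and sq: "(\<lambda>x. (norm (f x))\<^sup>2) summable_on A"
  shows "f summable_on A"
proof -
  let ?q = "\<lambda>x. (norm (f x))\<^sup>2"
  obtain l where l: "(sum ?q \<longlongrightarrow> l) (finite_subsets_at_top A)"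
    using sq by (auto simp: summable_on_def has_sum_def)
  have "\<exists>P. eventually P (finite_subsets_at_top A) \<and>
            (\<forall>F F'. P F \<and> P F' \<longrightarrow> dist (sum f F) (sum f F') < e)" if "e > 0" for e
  proof -
    have "0 < (e/3)\<^sup>2" using that by simp
    then have "\<forall>\<^sub>F F in finite_subsets_at_top A. l - (e/3)\<^sup>2 < sum ?q F"
      by (intro order_tendstoD(1)[OF l]) linarith
    then obtain F0 where F0: "finite F0" "F0 \<subseteq> A"
      and big: "\<And>F. finite F \<Longrightarrow> F0 \<subseteq> F \<Longrightarrow> F \<subseteq> A \<Longrightarrow> l - (e/3)\<^sup>2 < sum ?q F"
      unfolding eventually_finite_subsets_at_top by (elim exE conjE) metis
    have close: "norm (sum f F - sum f F0) \<le> e/3" if F: "finite F" "F0 \<subseteq> F" "F \<subseteq> A" for F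
    proof -
      have "sum ?q F \<le> l"
        by (rule finite_sum_le_has_sum[where A = A]) (use l F in \<open>auto simp: has_sum_def\<close>)
      moreover have "sum f F - sum f F0 = sum f (F - F0)" "sum ?q (F - F0) = sum ?q F - sum ?q F0"
        using F by (simp_all add: sum_diff)
      moreover have "(norm (sum f (F - F0)))\<^sup>2 = sum ?q (F - F0)"
        by (rule norm_sum_orthogonal) (use F in \<open>auto intro: orth\<close>)
      ultimately have "(norm (sum f F - sum f F0))\<^sup>2 \<le> (e/3)\<^sup>2"
        using big[OF F0(1) order_refl F0(2)] by simp
      then show ?thesis by (rule power2_le_imp_le) (use \<open>e > 0\<close> in simp)
    qed
    have "dist (sum f F) (sum f F') < e"
      if "finite F \<and> F0 \<subseteq> F \<and> F \<subseteq> A" "finite F' \<and> F0 \<subseteq> F' \<and> F' \<subseteq> A" for F F'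
      using norm_triangle_ineq4[of "sum f F - sum f F0" "sum f F' - sum f F0"]
        close[of F] close[of F'] that \<open>e > 0\<close> by (simp add: dist_norm)
    moreover have "\<forall>\<^sub>F F in finite_subsets_at_top A. finite F \<and> F0 \<subseteq> F \<and> F \<subseteq> A"
      unfolding eventually_finite_subsets_at_top using F0 by blast
    ultimately show ?thesis
      by (intro exI[of _ "\<lambda>F. finite F \<and> F0 \<subseteq> F \<and> F \<subseteq> A"] conjI allI impI) (assumption, elim conjE, simp)
  qed
  then have "cauchy_filter (filtermap (sum f) (finite_subsets_at_top A))"
    by (simp add: cauchy_filter_metric_filtermap)
  moreover have "complete (UNIV::'a set)"
    by (rule complete_UNIV)
  ultimately obtain s where "(sum f \<longlongrightarrow> s) (finite_subsets_at_top A)"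
    using complete_uniform[where S=UNIV] by (force simp add: filterlim_def)
  then show ?thesis by (auto simp: summable_on_def has_sum_def)
qed

section \<open>Coordinates along the eigenspaces\<close>

context positive_compact
begin

abbreviation "E \<equiv> eigenvalues H\<^sub>0"

definition Q :: "real \<Rightarrow> 'a \<Rightarrow> 'a" where "Q x = orth_proj (eigenspace H\<^sub>0 x)"

interpretation ev: closed_csubspace "eigenspace H\<^sub>0 x" for x
  by (rule closed_csubspace_eigenspace)

lemma Q_add: "Q x (u + v) = Q x u + Q x v"
  and Q_scaleC: "Q x (c *\<^sub>C u) = c *\<^sub>C Q x u"
  and Q_in: "Q x u \<in> eigenspace H\<^sub>0 x"
  and Q_sym: "cinner (Q x u) v = cinner u (Q x v)"
  and bounded_linear_Q: "bounded_linear (Q x)"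
  by (simp_all add: Q_def ev.orth_proj_add ev.orth_proj_scaleC ev.orth_proj_in ev.orth_proj_sym
      ev.bounded_linear_orth_proj)

lemma Q_diff: "Q x (u - v) = Q x u - Q x v" and Q_scaleR: "Q x (r *\<^sub>R u) = r *\<^sub>R Q x u"
  using linear_simps[OF bounded_linear_Q] by blast+

lemma Q_Q: "Q x (Q y u) = (if x = y then Q x u else 0)"
proof (cases "x = y")
  case True
  then show ?thesis by (simp add: Q_def ev.orth_proj_id ev.orth_proj_in)
next
  case False
  have "cinner v (Q x (Q y u)) = 0" for v
    using eigenspace_orth[OF Q_in Q_in False] by (simp add: Q_sym[symmetric])
  then show ?thesis using False cinner_eq_zero_all[of "Q x (Q y u)"] by simp
qed

text \<open>Completeness of the eigenspaces in its working form: identities between operators are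
  verified coordinate by coordinate.\<close>

lemma Q_eqI:
  assumes "\<And>x. x \<in> E \<Longrightarrow> Q x u = Q x v"
  shows "u = v"
proof -
  have "u - v = 0"
  proof (rule eigenspaces_total)
    fix x w assume w: "w \<in> eigenspace H\<^sub>0 x"
    show "cinner w (u - v) = 0"
    proof (cases "x \<in> E")
      case True
      have "cinner w (u - v) = cinner w (Q x (u - v))"
        unfolding Q_def using w by (simp add: ev.cinner_orth_proj)
      then show ?thesis using assms[OF True] by (simp add: Q_diff cinner_simps)
    next
      case False
      then have "w = 0" using w by (auto simp: eigenvalues_def)
      then show ?thesis by (simp add: cinner_simps)
    qed
  qed
  then show ?thesis by simp
qed

lemma Q_orth: "x \<noteq> y \<Longrightarrow> inner (Q x u) (Q y v) = 0"
  using eigenspace_orth[OF Q_in Q_in] by (simp add: inner_eq_Re_cinner)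

text \<open>Riesz-Fischer. Each \<open>Q x\<close> is bounded and so passes through the sum, where
  orthogonality leaves only the term at \<open>x\<close>.\<close>

lemma ex_of_coefficients:
  assumes "(\<lambda>x. (g x)\<^sup>2 * (norm (Q x u))\<^sup>2) summable_on E"
  shows "\<exists>w. ((\<lambda>x. g x *\<^sub>R Q x u) has_sum w) E \<and> (\<forall>x\<in>E. Q x w = g x *\<^sub>R Q x u)"
proof -
  have "(\<lambda>x. g x *\<^sub>R Q x u) summable_on E"
    by (rule orthogonal_summable_on) (use assms in \<open>simp_all add: Q_orth power_mult_distrib\<close>)
  then obtain w where w: "((\<lambda>x. g x *\<^sub>R Q x u) has_sum w) E"
    by (auto simp: summable_on_def)
  have "Q x w = g x *\<^sub>R Q x u" if "x \<in> E" for x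
  proof (rule has_sum_unique)
    show "((\<lambda>y. Q x (g y *\<^sub>R Q y u)) has_sum Q x w) E"
      by (rule has_sum_bounded_linear[OF bounded_linear_Q w])
    have "((\<lambda>y. Q x (g y *\<^sub>R Q y u)) has_sum (g x *\<^sub>R Q x u)) {x}"
      by (simp add: Q_scaleR Q_Q has_sum_finiteI)
    moreover have "((\<lambda>y. Q x (g y *\<^sub>R Q y u)) has_sum z) E
        \<longleftrightarrow> ((\<lambda>y. Q x (g y *\<^sub>R Q y u)) has_sum z) {x}" for z
      by (rule has_sum_cong_neutral) (use that in \<open>auto simp: Q_scaleR Q_Q\<close>)
    ultimately show "((\<lambda>y. Q x (g y *\<^sub>R Q y u)) has_sum (g x *\<^sub>R Q x u)) E" by blast
  qed
  with w show ?thesis by blast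
qed

lemma Q_bessel: "(\<lambda>x. (norm (Q x u))\<^sup>2) summable_on E"
proof (rule nonneg_bdd_above_summable_on)
  have "(\<Sum>x\<in>F. (norm (Q x u))\<^sup>2) \<le> (norm u)\<^sup>2" if "finite F" for F
  proof -
    define s where "s = (\<Sum>x\<in>F. Q x u)"
    have s: "(norm s)\<^sup>2 = (\<Sum>x\<in>F. (norm (Q x u))\<^sup>2)"
      unfolding s_def by (rule norm_sum_orthogonal[OF that]) (rule Q_orth)
    have "inner u (Q x u) = (norm (Q x u))\<^sup>2" for x
    proof -
      have "cinner u (Q x u) = cinner u (Q x (Q x u))" by (simp add: Q_Q)
      then show ?thesis by (simp add: inner_eq_Re_cinner Q_sym[symmetric] cinner_self)
    qed
    then have us: "inner u s = (norm s)\<^sup>2" unfolding s by (simp add: s_def inner_sum_right)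
    have "0 \<le> (norm (u - s))\<^sup>2" by simp
    also have "\<dots> = (norm u)\<^sup>2 - (norm s)\<^sup>2"
      using us by (simp add: power2_norm_eq_inner inner_simps inner_commute)
    finally show ?thesis by (simp add: s)
  qed
  then show "bdd_above (sum (\<lambda>x. (norm (Q x u))\<^sup>2) ` {F. F \<subseteq> E \<and> finite F})"
    by (intro bdd_aboveI[of _ "(norm u)\<^sup>2"]) auto
qed simp

text \<open>The sum of the coordinates exists by Bessel and has the coordinates of \<open>u\<close>,
  so it is \<open>u\<close> by \<open>Q_eqI\<close>.\<close>

lemma Q_expansion: "((\<lambda>x. Q x u) has_sum u) E"
proof -
  have "(\<lambda>x. 1\<^sup>2 * (norm (Q x u))\<^sup>2) summable_on E" by (simp add: Q_bessel)
  from ex_of_coefficients[OF this] obtain w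
    where w: "((\<lambda>x. 1 *\<^sub>R Q x u) has_sum w) E" "\<forall>x\<in>E. Q x w = 1 *\<^sub>R Q x u" by (elim exE conjE)
  have "w = u" by (rule Q_eqI) (simp add: w(2))
  then show ?thesis using w(1) by simp
qed

lemma Q_parseval: "((\<lambda>x. cinner (Q x u) (Q x v)) has_sum cinner u v) E"
proof -
  have "((\<lambda>x. cinner (Q x u) v) has_sum cinner u v) E"
    by (rule has_sum_bounded_linear[OF bounded_bilinear.bounded_linear_left[OF bounded_bilinear_cinner] Q_expansion])
  moreover have "cinner (Q x u) v = cinner (Q x u) (Q x v)" for x
    by (simp add: Q_sym[symmetric] Q_Q)
  ultimately show ?thesis by simp
qed

lemma Q_norm: "((\<lambda>x. (norm (Q x u))\<^sup>2) has_sum (norm u)\<^sup>2) E"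
  using has_sum_Re[OF Q_parseval[of u u]] by (simp add: cinner_self)

text \<open>Parseval turns inequalities between multipliers into inequalities between norms; the
  bounds for \<open>P_N\<close> and for powers of \<open>Lambda\<close> are obtained this
  way.\<close>

lemma norm_le_of_coefficients:
  assumes "\<And>x. x \<in> E \<Longrightarrow> norm (Q x u) \<le> c * norm (Q x v)" "0 \<le> c"
  shows "norm u \<le> c * norm v"
proof -
  have "(norm u)\<^sup>2 \<le> c\<^sup>2 * (norm v)\<^sup>2"
  proof (rule has_sum_mono[OF Q_norm has_sum_cmult_right[OF Q_norm]])
    fix x assume "x \<in> E"
    then show "(norm (Q x u))\<^sup>2 \<le> c\<^sup>2 * (norm (Q x v))\<^sup>2"
      using power_mono[OF assms(1), of x 2] by (simp add: power_mult_distrib)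
  qed
  then have "(norm u)\<^sup>2 \<le> (c * norm v)\<^sup>2" by (simp add: power_mult_distrib)
  then show ?thesis by (rule power2_le_imp_le) (simp add: assms(2))
qed

lemma cinner_eq_of_coefficients:
  assumes "\<And>x. x \<in> E \<Longrightarrow> cinner (Q x u) (Q x v) = cinner (Q x u') (Q x v')"
  shows "cinner u v = cinner u' v'"
proof (rule has_sum_unique[OF Q_parseval])
  show "((\<lambda>x. cinner (Q x u) (Q x v)) has_sum cinner u' v') E"
    using Q_parseval[of u' v'] by (simp add: has_sum_cong[OF assms])
qed

lemma ex_bounded_multiplier:
  assumes "\<And>x. x \<in> E \<Longrightarrow> \<bar>g x\<bar> \<le> K"
  shows "\<exists>w. ((\<lambda>x. g x *\<^sub>R Q x u) has_sum w) E \<and> (\<forall>x\<in>E. Q x w = g x *\<^sub>R Q x u)"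
proof -
  have "(\<lambda>x. (g x)\<^sup>2 * (norm (Q x u))\<^sup>2) summable_on E"
  proof (rule summable_on_comparison_test)
    show "(\<lambda>x. K\<^sup>2 * (norm (Q x u))\<^sup>2) summable_on E"
      by (rule summable_on_cmult_right[OF Q_bessel])
    show "(g x)\<^sup>2 * (norm (Q x u))\<^sup>2 \<le> K\<^sup>2 * (norm (Q x u))\<^sup>2" if "x \<in> E" for x
      using power_mono[OF assms[OF that], of 2] by (intro mult_right_mono) simp_all
  qed simp
  then show ?thesis by (rule ex_of_coefficients)
qed

text \<open>Eigenvalues are nonnegative, so the indicator of {0..N} cuts only from above.\<close>

lemma Q_P_N: "x \<in> E \<Longrightarrow> Q x (P_N H\<^sub>0 N u) = (if x \<le> N then Q x u else 0)"
proof -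
  assume x: "x \<in> E"
  have "\<bar>indicat_real {0..N} x\<bar> \<le> 1" for x by (simp add: indicator_def)
  from ex_bounded_multiplier[of "indicat_real {0..N}" 1 u, OF this] obtain w
    where w: "((\<lambda>x. indicat_real {0..N} x *\<^sub>R Q x u) has_sum w) E"
      "\<forall>x\<in>E. Q x w = indicat_real {0..N} x *\<^sub>R Q x u" by (elim exE conjE)
  have "P_N H\<^sub>0 N u = w"
    using infsumI[OF w(1)] by (simp add: P_N_def func_calc_def Q_def)
  then show ?thesis using bspec[OF w(2) x] eigenvalues_nonneg[OF x] by (simp add: indicator_def)
qed

text \<open>Powers are taken in the calculus of \<open>Lambda H\<^sub>0\<close>, projections in that
  of \<open>H\<^sub>0\<close>; the shift by 1 expresses both in the same coordinates
  \<open>Q x\<close>.\<close>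

lemma eigenspace_Lambda: "eigenspace (Lambda H\<^sub>0) y = eigenspace H\<^sub>0 (y - 1)"
proof -
  have "u + T u = y *\<^sub>R u \<longleftrightarrow> T u = (y - 1) *\<^sub>R u" for u
    by (simp add: scaleR_left_diff_distrib eq_diff_eq add.commute)
  then show ?thesis by (simp add: eigenspace_def Lambda_def)
qed

lemma eigenvalues_Lambda: "eigenvalues (Lambda H\<^sub>0) = (\<lambda>x. 1 + x) ` E"
proof (rule set_eqI)
  fix y
  have "y \<in> eigenvalues (Lambda H\<^sub>0) \<longleftrightarrow> y - 1 \<in> E"
    by (simp add: eigenvalues_def eigenspace_Lambda)
  also have "\<dots> \<longleftrightarrow> y \<in> (\<lambda>x. 1 + x) ` E"
    by (metis add.commute diff_add_cancel add_diff_cancel_left' image_iff)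
  finally show "y \<in> eigenvalues (Lambda H\<^sub>0) \<longleftrightarrow> y \<in> (\<lambda>x. 1 + x) ` E" .
qed

section \<open>Powers of \<open>Lambda\<close>, the scale of spaces and the spectral
  projections\<close>

abbreviation G :: "real \<Rightarrow> 'a \<Rightarrow> 'a" where "G r \<equiv> op_app (Lambda_pow H\<^sub>0 r)"

lemma Hsp_eq: "Hsp H\<^sub>0 r = {u. (\<lambda>x. ((1 + x) powr r)\<^sup>2 * (norm (Q x u))\<^sup>2) summable_on E}"
  unfolding Hsp_def Lambda_pow_def func_calc_def fst_conv eigenvalues_Lambda
  by (subst summable_on_reindex) (simp_all add: o_def eigenspace_Lambda Q_def)

lemma G_eq: "G r u = (\<Sum>\<^sub>\<infinity>x\<in>E. (1 + x) powr r *\<^sub>R Q x u)"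
  unfolding Lambda_pow_def func_calc_def snd_conv eigenvalues_Lambda
  by (subst infsum_reindex) (simp_all add: o_def eigenspace_Lambda Q_def)

lemma Q_G: "u \<in> Hsp H\<^sub>0 r \<Longrightarrow> x \<in> E \<Longrightarrow> Q x (G r u) = (1 + x) powr r *\<^sub>R Q x u"
proof -
  assume u: "u \<in> Hsp H\<^sub>0 r" and x: "x \<in> E"
  have "(\<lambda>x. ((1 + x) powr r)\<^sup>2 * (norm (Q x u))\<^sup>2) summable_on E" using u by (simp add: Hsp_eq)
  from ex_of_coefficients[OF this] obtain w
    where w: "((\<lambda>x. (1 + x) powr r *\<^sub>R Q x u) has_sum w) E"
      "\<forall>x\<in>E. Q x w = (1 + x) powr r *\<^sub>R Q x u" by (elim exE conjE)
  then show ?thesis using infsumI[OF w(1)] x by (simp add: G_eq)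
qed

text \<open>A vector \<open>w\<close> with the prescribed coordinates settles domain and value at
  once: Bessel for \<open>w\<close> is the summability that membership of \<open>u\<close> asks
  for.\<close>

lemma HspI:
  assumes "\<And>x. x \<in> E \<Longrightarrow> Q x w = (1 + x) powr r *\<^sub>R Q x u"
  shows "u \<in> Hsp H\<^sub>0 r" "G r u = w"
proof -
  have "(\<lambda>x. (norm (Q x w))\<^sup>2) summable_on E \<longleftrightarrow> u \<in> Hsp H\<^sub>0 r"
    unfolding Hsp_eq mem_Collect_eq
    by (rule summable_on_cong) (simp add: assms power_mult_distrib)
  then show u: "u \<in> Hsp H\<^sub>0 r" using Q_bessel by blast
  show "G r u = w" by (rule Q_eqI) (simp add: Q_G[OF u] assms)
qed

lemma Hnorm_eq: "Hnorm H\<^sub>0 r u = norm (G r u)"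
  by (simp add: Hnorm_def)

lemma Hnorm_0: "Hnorm H\<^sub>0 0 u = norm u"
proof -
  have *: "Q x u = (1 + x) powr 0 *\<^sub>R Q x u" if "x \<in> E" for x
    using eigenvalues_nonneg[OF that] by simp
  show ?thesis using HspI[OF *] by (simp_all add: Hnorm_eq)
qed

lemma Hsp_add: "u \<in> Hsp H\<^sub>0 r \<Longrightarrow> v \<in> Hsp H\<^sub>0 r \<Longrightarrow> u + v \<in> Hsp H\<^sub>0 r \<and> G r (u + v) = G r u + G r v"
  using HspI[of "G r u + G r v" r "u + v"] by (simp add: Q_G Q_add scaleR_add_right)

lemma Hsp_scaleC: "u \<in> Hsp H\<^sub>0 r \<Longrightarrow> c *\<^sub>C u \<in> Hsp H\<^sub>0 r \<and> G r (c *\<^sub>C u) = c *\<^sub>C G r u"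
  using HspI[of "c *\<^sub>C G r u" r "c *\<^sub>C u"]
  by (simp add: Q_G Q_scaleC scaleR_scaleC mult.commute)

lemma Hsp_diff: "u \<in> Hsp H\<^sub>0 r \<Longrightarrow> v \<in> Hsp H\<^sub>0 r \<Longrightarrow> u - v \<in> Hsp H\<^sub>0 r \<and> G r (u - v) = G r u - G r v"
  using HspI[of "G r u - G r v" r "u - v"] by (simp add: Q_G Q_diff scaleR_diff_right)

lemma P_N_add: "P_N H\<^sub>0 N (u + v) = P_N H\<^sub>0 N u + P_N H\<^sub>0 N v"
  and P_N_scaleC: "P_N H\<^sub>0 N (c *\<^sub>C u) = c *\<^sub>C P_N H\<^sub>0 N u"
  and P_N_P_N: "M \<le> N \<Longrightarrow> P_N H\<^sub>0 M (P_N H\<^sub>0 N u) = P_N H\<^sub>0 M u"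
    "M \<le> N \<Longrightarrow> P_N H\<^sub>0 N (P_N H\<^sub>0 M u) = P_N H\<^sub>0 M u"
  by (rule Q_eqI; simp add: Q_P_N Q_add Q_scaleC)+

lemma norm_P_N_le: "norm (P_N H\<^sub>0 N u) \<le> norm u"
  using norm_le_of_coefficients[of "P_N H\<^sub>0 N u" 1 u] by (simp add: Q_P_N)

lemma bounded_linear_P_N: "bounded_linear (P_N H\<^sub>0 N)"
proof (rule bounded_linear_intro[where K = 1])
  show "P_N H\<^sub>0 N (r *\<^sub>R u) = r *\<^sub>R P_N H\<^sub>0 N u" for r u
    unfolding scaleR_scaleC by (rule P_N_scaleC)
qed (simp_all add: P_N_add norm_P_N_le)

lemma P_N_sym: "cinner (P_N H\<^sub>0 N u) v = cinner u (P_N H\<^sub>0 N v)"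
  by (rule cinner_eq_of_coefficients) (simp add: Q_P_N cinner_simps)

lemma HN_space_iff: "u \<in> HN_space H\<^sub>0 N \<longleftrightarrow> P_N H\<^sub>0 N u = u"
proof
  assume "P_N H\<^sub>0 N u = u"
  then show "u \<in> HN_space H\<^sub>0 N" unfolding HN_space_def by (metis rangeI)
qed (auto simp: HN_space_def P_N_P_N)

text \<open>Truncation at \<open>N\<close> turns the multiplier (1 + x)^r into one bounded by (1 +
  N)^r, so the range of the projection lies in every space of the scale.\<close>

lemma Q_G_P_N:
  assumes "0 \<le> r"
  shows "P_N H\<^sub>0 N u \<in> Hsp H\<^sub>0 r"
    and "x \<in> E \<Longrightarrow> Q x (G r (P_N H\<^sub>0 N u)) = (if x \<le> N then (1 + x) powr r *\<^sub>R Q x u else 0)"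
proof -
  have bd: "\<bar>if x \<le> N then (1 + x) powr r else 0\<bar> \<le> (1 + N) powr r" if "x \<in> E" for x
    using eigenvalues_nonneg[OF that] assms by (auto intro!: powr_mono2)
  have "\<exists>w. ((\<lambda>x. (if x \<le> N then (1 + x) powr r else 0) *\<^sub>R Q x u) has_sum w) E
      \<and> (\<forall>x\<in>E. Q x w = (if x \<le> N then (1 + x) powr r else 0) *\<^sub>R Q x u)"
    by (rule ex_bounded_multiplier, rule bd)
  then obtain w
    where w: "\<forall>x\<in>E. Q x w = (if x \<le> N then (1 + x) powr r else 0) *\<^sub>R Q x u" by (elim exE conjE)
  have "Q x w = (1 + x) powr r *\<^sub>R Q x (P_N H\<^sub>0 N u)" if "x \<in> E" for x
    using that by (simp add: w Q_P_N)
  note * = HspI[OF this]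
  show "P_N H\<^sub>0 N u \<in> Hsp H\<^sub>0 r" by (rule *(1))
  show "x \<in> E \<Longrightarrow> Q x (G r (P_N H\<^sub>0 N u)) = (if x \<le> N then (1 + x) powr r *\<^sub>R Q x u else 0)"
    using *(2) w by simp
qed

lemma P_N_Hsp_inf: "P_N H\<^sub>0 N u \<in> Hsp_inf H\<^sub>0"
  by (simp add: Hsp_inf_def Q_G_P_N)

lemma norm_G_P_N_le:
  assumes "0 \<le> r"
  shows "norm (G r (P_N H\<^sub>0 N u)) \<le> (1 + N) powr r * norm u"
proof (rule norm_le_of_coefficients)
  fix x assume x: "x \<in> E"
  show "norm (Q x (G r (P_N H\<^sub>0 N u))) \<le> (1 + N) powr r * norm (Q x u)"
    using eigenvalues_nonneg[OF x] assms
    by (auto simp: Q_G_P_N(2)[OF assms x] intro!: mult_right_mono powr_mono2)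
qed simp

lemma bounded_linear_G_P_N:
  assumes "0 \<le> r"
  shows "bounded_linear (\<lambda>u. G r (P_N H\<^sub>0 N u))"
proof (rule bounded_linear_intro[where K = "(1 + N) powr r"])
  show "G r (P_N H\<^sub>0 N (u + v)) = G r (P_N H\<^sub>0 N u) + G r (P_N H\<^sub>0 N v)" for u v
    using Hsp_add[OF Q_G_P_N(1) Q_G_P_N(1)] assms by (simp add: P_N_add)
  show "G r (P_N H\<^sub>0 N (c *\<^sub>R u)) = c *\<^sub>R G r (P_N H\<^sub>0 N u)" for c u
    using Hsp_scaleC[OF Q_G_P_N(1)] assms by (simp add: P_N_scaleC scaleR_scaleC)
qed (subst mult.commute, rule norm_G_P_N_le[OF assms])

lemma Hnorm_P_N_le:
  assumes "0 \<le> r" "u \<in> Hsp H\<^sub>0 r"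
  shows "Hnorm H\<^sub>0 r (P_N H\<^sub>0 N u) \<le> Hnorm H\<^sub>0 r u"
  using norm_le_of_coefficients[of "G r (P_N H\<^sub>0 N u)" 1 "G r u"]
  by (simp add: Hnorm_eq Q_G_P_N(2)[OF assms(1)] Q_G[OF assms(2)])

lemma Hnorm_mono:
  assumes "0 \<le> q" "q \<le> r"
  shows "Hnorm H\<^sub>0 q (P_N H\<^sub>0 N u) \<le> Hnorm H\<^sub>0 r (P_N H\<^sub>0 N u)"
  unfolding Hnorm_eq
  using norm_le_of_coefficients[of "G q (P_N H\<^sub>0 N u)" 1 "G r (P_N H\<^sub>0 N u)"] assms
  by (simp add: Q_G_P_N mult_right_mono powr_mono eigenvalues_nonneg)

text \<open>One factor \<open>Lambda\<close>^r moves across the inner product. The right argument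
  can then drop its projection, since the left one is already truncated.\<close>

lemma cinner_G_P_N:
  assumes "0 \<le> r"
  shows "cinner (G r (P_N H\<^sub>0 N u)) (G r (P_N H\<^sub>0 N v)) = cinner (G (2 * r) (P_N H\<^sub>0 N u)) v"
proof (rule cinner_eq_of_coefficients)
  fix x assume "x \<in> E"
  then show "cinner (Q x (G r (P_N H\<^sub>0 N u))) (Q x (G r (P_N H\<^sub>0 N v)))
      = cinner (Q x (G (2 * r) (P_N H\<^sub>0 N u))) (Q x v)"
    using assms powr_add[of "1 + x" r r]
    by (simp add: Q_G_P_N cinner_scaleR_left cinner_scaleR_right cinner_simps)
qed

lemma P_N_G_P_N: "0 \<le> r \<Longrightarrow> P_N H\<^sub>0 N (G r (P_N H\<^sub>0 N u)) = G r (P_N H\<^sub>0 N u)"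
  by (rule Q_eqI) (simp add: Q_P_N Q_G_P_N)

text \<open>For x > N the quotient (1 + x)^r / (1 + N)^r is at least 1. This is the origin of the
  negative power of 1 + N in the rate.\<close>

lemma norm_P_N_tail_le:
  assumes "0 \<le> r" "0 < N" "u \<in> Hsp H\<^sub>0 r"
  shows "norm (u - P_N H\<^sub>0 N u) \<le> (1 + N) powr (- r) * Hnorm H\<^sub>0 r u"
  unfolding Hnorm_eq
proof (rule norm_le_of_coefficients)
  fix x assume x: "x \<in> E"
  show "norm (Q x (u - P_N H\<^sub>0 N u)) \<le> (1 + N) powr - r * norm (Q x (G r u))"
  proof (cases "x \<le> N")
    case False
    have "(1 + N) powr r \<le> (1 + x) powr r" using False assms by (intro powr_mono2) auto
    then have "1 \<le> (1 + N) powr - r * (1 + x) powr r"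
      using assms by (simp add: powr_minus field_simps)
    then have "1 * norm (Q x u) \<le> (1 + N) powr - r * (1 + x) powr r * norm (Q x u)"
      by (rule mult_right_mono) simp
    then show ?thesis using False x by (simp add: Q_diff Q_P_N Q_G[OF assms(3)] mult.assoc)
  qed (use x in \<open>simp add: Q_diff Q_P_N\<close>)
qed simp

text \<open>Once \<open>N\<close> exceeds the finitely many eigenvalues of a partial sum
  \<open>s\<close> close to \<open>u\<close>, the coordinates of u - P_N u are dominated by those of
  u - s.\<close>

lemma P_N_tendsto: "((\<lambda>N. P_N H\<^sub>0 N u) \<longlongrightarrow> u) at_top"
proof (rule tendstoI)
  fix e :: real assume "0 < e"
  then obtain F where F: "finite F" "F \<subseteq> E" "dist (\<Sum>x\<in>F. Q x u) u \<le> e / 2"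
    using has_sum_finite_approximation[OF Q_expansion, of "e/2" u] by auto
  define s where "s = (\<Sum>x\<in>F. Q x u)"
  have "dist (P_N H\<^sub>0 N u) u < e" if N: "\<forall>x\<in>F. x \<le> N" for N
  proof -
    have "norm (u - P_N H\<^sub>0 N u) \<le> 1 * norm (u - s)"
    proof (rule norm_le_of_coefficients)
      fix x assume x: "x \<in> E"
      have "Q x s = (if x \<in> F then Q x u else 0)"
        unfolding s_def linear_sum[OF bounded_linear.linear[OF bounded_linear_Q]]
        using F(1) by (simp add: Q_Q)
      then show "norm (Q x (u - P_N H\<^sub>0 N u)) \<le> 1 * norm (Q x (u - s))"
        using N x by (auto simp: Q_diff Q_P_N)
    qed simp
    then show ?thesis using F(3) \<open>0 < e\<close> by (simp add: s_def dist_norm norm_minus_commute)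
  qed
  moreover have "\<forall>\<^sub>F N in at_top. \<forall>x\<in>F. x \<le> N"
    using F(1) by (intro eventually_ball_finite ballI eventually_ge_at_top)
  ultimately show "\<forall>\<^sub>F N in at_top. dist (P_N H\<^sub>0 N u) u < e"
    by (rule eventually_mono[rotated])
qed

end

section \<open>Linear evolution equations with bounded generators\<close>

text \<open>With K = 0 this is the constancy criterion behind the conservation laws below.\<close>

lemma vector_derivative_norm_bound:
  fixes f :: "real \<Rightarrow> 'a::real_normed_vector"
  assumes "\<And>t. t \<in> {a..b} \<Longrightarrow> (f has_vector_derivative f' t) (at t within {a..b})"
    and "\<And>t. t \<in> {a..b} \<Longrightarrow> norm (f' t) \<le> K"
    and "s \<in> {a..b}" "t \<in> {a..b}"
  shows "norm (f t - f s) \<le> K * \<bar>t - s\<bar>"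
proof -
  have "norm (f t - f s) \<le> K * norm (t - s)"
  proof (rule differentiable_bound[of "{a..b}"])
    fix x assume x: "x \<in> {a..b}"
    show "(f has_derivative (\<lambda>h. h *\<^sub>R f' x)) (at x within {a..b})"
      using assms(1)[OF x] by (simp add: has_vector_derivative_def)
    show "onorm (\<lambda>h. h *\<^sub>R f' x) \<le> K"
    proof (rule onorm_le)
      fix h :: real
      show "norm (h *\<^sub>R f' x) \<le> K * norm h"
        using mult_right_mono[OF assms(2)[OF x] abs_ge_zero[of h]] by (simp add: mult.commute)
    qed
  qed (use assms in auto)
  then show ?thesis by simp
qed

text \<open>The generator acts on the whole Banach space; truncated equations fit in because
  projections on both sides extend their generators.\<close>

locale linear_ode =
  fixes B :: "real \<Rightarrow> 'a::banach \<Rightarrow>\<^sub>L 'a" and a b :: real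
  assumes cont_B: "continuous_on {a..b} B"
begin

definition sol :: "(real \<Rightarrow> 'a) \<Rightarrow> bool" where
  "sol x \<longleftrightarrow> (\<forall>t\<in>{a..b}. (x has_vector_derivative B t (x t)) (at t within {a..b}))"

lemma B_bounded: "\<exists>K\<ge>0. \<forall>t\<in>{a..b}. norm (B t) \<le> K"
proof -
  have "bounded (B ` {a..b})"
    by (intro compact_imp_bounded compact_continuous_image cont_B) simp
  then obtain K where K: "\<forall>x\<in>B ` {a..b}. norm x \<le> K" by (auto simp: bounded_iff)
  then have "\<forall>t\<in>{a..b}. norm (B t) \<le> \<bar>K\<bar>" by (auto intro: order_trans[OF _ abs_ge_self])
  then show ?thesis using abs_ge_zero by blast
qed

text \<open>Serves both the iterated integrals of a time-dependent generator and the exponential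
  series. The derivative of a partial sum of n + 1 terms is \<open>B t\<close> applied to the one of
  n terms, which converges uniformly.\<close>

lemma series_solution:
  assumes D0: "\<And>t. t \<in> {a..b} \<Longrightarrow> D 0 t = v"
    and D_Suc: "\<And>n t. t \<in> {a..b} \<Longrightarrow>
      (D (Suc n) has_vector_derivative B t (D n t)) (at t within {a..b})"
    and M: "\<And>n t. t \<in> {a..b} \<Longrightarrow> norm (D n t) \<le> M n" "summable M"
  shows "sol (\<lambda>t. \<Sum>n. D n t)"
proof -
  define x where "x t = (\<Sum>n. D n t)" for t
  \<comment> \<open>The derivative of a term is the generator applied to the previous one. The
    constant term contributes 0, which causes the shift by one in the partial sums.\<close>
  define c where "c n t = (case n of 0 \<Rightarrow> 0 | Suc m \<Rightarrow> B t (D m t))" for n t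
  obtain K where K: "0 \<le> K" "\<And>t. t \<in> {a..b} \<Longrightarrow> norm (B t) \<le> K" using B_bounded by blast
  have ul: "uniform_limit {a..b} (\<lambda>n t. \<Sum>i<n. D i t) x sequentially"
    unfolding x_def by (rule Weierstrass_m_test) (use M in auto)
  have sums: "(\<lambda>n. D n t) sums x t" if "t \<in> {a..b}" for t
    unfolding x_def
    by (rule summable_sums, rule summable_comparison_test'[OF M(2)]) (rule M(1)[OF that])
  have "(x has_vector_derivative B t (x t)) (at t within {a..b})" if t: "t \<in> {a..b}" for t
  proof -
    have "\<exists>g. \<forall>t\<in>{a..b}. (\<lambda>n. D n t) sums g t \<and> (g has_derivative (\<lambda>h. h *\<^sub>R B t (x t))) (at t within {a..b})"
    proof (rule has_derivative_series[where f' = "\<lambda>n t h. h *\<^sub>R c n t"])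
      fix n t assume t: "t \<in> {a..b}"
      show "(D n has_derivative (\<lambda>h. h *\<^sub>R c n t)) (at t within {a..b})"
      proof (cases n)
        case 0
        have "((\<lambda>_. v) has_derivative (\<lambda>h. h *\<^sub>R c n t)) (at t within {a..b})"
          by (simp add: 0 c_def)
        then show ?thesis by (rule has_derivative_transform[OF t _, rotated]) (simp add: D0 0)
      next
        case (Suc m)
        then show ?thesis using D_Suc[OF t, of m] by (simp add: c_def has_vector_derivative_def)
      qed
    next
      \<comment> \<open>The accuracy e / (K + 1) avoids a division by zero when K = 0.\<close>
      fix e :: real assume e: "0 < e"
      have "\<forall>\<^sub>F n in sequentially. \<forall>t\<in>{a..b}. dist (\<Sum>i<n. D i t) (x t) < e / (K + 1)"
        using ul K(1) e by (auto simp: uniform_limit_iff)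
      then have "\<forall>\<^sub>F n in sequentially. \<forall>t\<in>{a..b}. \<forall>h.
          norm ((\<Sum>i<Suc n. h *\<^sub>R c i t) - h *\<^sub>R B t (x t)) \<le> e * norm h"
      proof (rule eventually_mono, intro ballI allI)
        fix n t and h :: real
        assume n: "\<forall>t\<in>{a..b}. dist (\<Sum>i<n. D i t) (x t) < e / (K + 1)" and t: "t \<in> {a..b}"
        have "(\<Sum>i<Suc n. h *\<^sub>R c i t) = h *\<^sub>R B t (\<Sum>i<n. D i t)"
          by (simp only: sum.lessThan_Suc_shift)
            (simp add: c_def blinfun.sum_right scaleR_sum_right)
        then have "norm ((\<Sum>i<Suc n. h *\<^sub>R c i t) - h *\<^sub>R B t (x t))
            = norm (B t ((\<Sum>i<n. D i t) - x t)) * \<bar>h\<bar>"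
          by (simp add: blinfun.diff_right scaleR_diff_right[symmetric])
        also have "\<dots> \<le> (K * (e / (K + 1))) * \<bar>h\<bar>"
        proof (rule mult_right_mono)
          have "norm (B t ((\<Sum>i<n. D i t) - x t)) \<le> norm (B t) * norm ((\<Sum>i<n. D i t) - x t)"
            by (rule norm_blinfun)
          also have "\<dots> \<le> K * (e / (K + 1))"
            using n t K by (intro mult_mono) (auto simp: dist_norm less_imp_le)
          finally show "norm (B t ((\<Sum>i<n. D i t) - x t)) \<le> K * (e / (K + 1))" .
        qed simp
        also have "\<dots> \<le> e * norm h"
          unfolding real_norm_def using K(1) e by (intro mult_right_mono) (auto simp: field_simps)
        finally show "norm ((\<Sum>i<Suc n. h *\<^sub>R c i t) - h *\<^sub>R B t (x t)) \<le> e * norm h" .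
      qed
      then show "\<forall>\<^sub>F n in sequentially. \<forall>t\<in>{a..b}. \<forall>h.
          norm ((\<Sum>i<n. h *\<^sub>R c i t) - h *\<^sub>R B t (x t)) \<le> e * norm h"
        by (subst (asm) eventually_sequentially_Suc)
    next
      show "(\<lambda>n. D n t) sums x t" by (rule sums[OF t])
    qed (use t in auto)
    then obtain g where g: "\<And>t. t \<in> {a..b} \<Longrightarrow> (\<lambda>n. D n t) sums g t"
      "\<And>t. t \<in> {a..b} \<Longrightarrow> (g has_derivative (\<lambda>h. h *\<^sub>R B t (x t))) (at t within {a..b})"
      by blast
    have "g s = x s" if "s \<in> {a..b}" for s using sums_unique2[OF g(1) sums] that by blast
    then show ?thesis
      unfolding has_vector_derivative_def
      by (intro has_derivative_transform[OF t _ g(2)[OF t]]) simp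
  qed
  then show ?thesis by (simp add: sol_def x_def[symmetric, abs_def])
qed

lemma has_derivative_power_fact:
  assumes "(f has_real_derivative D) (at t within S)"
  shows "((\<lambda>\<tau>. c * f \<tau> ^ Suc n / fact (Suc n)) has_real_derivative c * D * f t ^ n / fact n) (at t within S)"
proof -
  have "((\<lambda>\<tau>. c * f \<tau> ^ Suc n / fact (Suc n)) has_real_derivative
      c * ((1 + of_nat n) * (D * f t ^ n)) / fact (Suc n)) (at t within S)"
    by (intro DERIV_cdivide DERIV_cmult DERIV_power_Suc assms)
  also have "c * ((1 + of_nat n) * (D * f t ^ n)) / fact (Suc n) = c * D * f t ^ n / fact n"
    by (simp add: divide_simps)
  finally show ?thesis .
qed

lemma summable_power_fact: "summable (\<lambda>n. c * (x::real) ^ n / fact n)"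
  using summable_mult[OF summable_exp, of c x] by (simp add: field_simps)

text \<open>Picard iteration as a series of iterated integrals; the n-th term is at most norm v (K
  |t - s|)^n / n!, hence summable uniformly on the interval.\<close>

lemma ex_sol:
  assumes s: "s \<in> {a..b}"
  shows "\<exists>x. sol x \<and> x s = v"
proof -
  \<comment> \<open>The integral from \<open>s\<close> to \<open>t\<close> is written as a
    difference of integrals from \<open>a\<close>, which carries the right sign for t < s as
    well.\<close>
  define D where "D = rec_nat (\<lambda>_. v)
    (\<lambda>_ d t. integral {a..t} (\<lambda>\<tau>. B \<tau> (d \<tau>)) - integral {a..s} (\<lambda>\<tau>. B \<tau> (d \<tau>)))"
  have D0: "D 0 t = v" for t by (simp add: D_def)
  have DS: "D (Suc n) t = integral {a..t} (\<lambda>\<tau>. B \<tau> (D n \<tau>)) - integral {a..s} (\<lambda>\<tau>. B \<tau> (D n \<tau>))" for n t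
    by (simp add: D_def)
  have step: "(D (Suc n) has_vector_derivative B t (D n t)) (at t within {a..b})"
    if "continuous_on {a..b} (D n)" "t \<in> {a..b}" for n t
  proof -
    have "continuous_on {a..b} (\<lambda>\<tau>. B \<tau> (D n \<tau>))"
      by (intro blinfun.continuous_on cont_B that)
    from has_vector_derivative_diff[OF integral_has_vector_derivative[OF this that(2)]
        has_vector_derivative_const]
    show ?thesis unfolding DS[abs_def] by simp
  qed
  have cont: "continuous_on {a..b} (D n)" for n
  proof (induction n)
    case 0
    then show ?case by (simp add: D0[abs_def])
  next
    case (Suc n)
    show ?case
      by (rule continuous_on_vector_derivative[OF step[OF Suc]])
  qed
  note D' = step[OF cont]
  obtain K where K: "0 \<le> K" "\<And>t. t \<in> {a..b} \<Longrightarrow> norm (B t) \<le> K" using B_bounded by blast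
  have bound: "norm (D n t) \<le> norm v * (K * \<bar>t - s\<bar>) ^ n / fact n" if "t \<in> {a..b}" for n t
    using that
  proof (induction n arbitrary: t)
    case 0
    then show ?case by (simp add: D0)
  next
    case (Suc n)
    have Ds: "D (Suc n) s = 0" by (simp add: DS)
    have at: "(D (Suc n) has_vector_derivative B \<tau> (D n \<tau>)) (at \<tau>)" if "a < \<tau>" "\<tau> < b" for \<tau>
      using D'[of \<tau> n] that by (simp add: at_within_Icc_at)
    have est: "norm (B \<tau> (D n \<tau>)) \<le> norm v * K * (K * \<bar>\<tau> - s\<bar>) ^ n / fact n" if "\<tau> \<in> {a..b}" for \<tau>
    proof -
      have "norm (B \<tau> (D n \<tau>)) \<le> norm (B \<tau>) * norm (D n \<tau>)" by (rule norm_blinfun)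
      also have "\<dots> \<le> K * (norm v * (K * \<bar>\<tau> - s\<bar>) ^ n / fact n)"
        using K that Suc.IH by (intro mult_mono) auto
      finally show ?thesis by (simp add: mult_ac)
    qed
    consider "t = s" | "s < t" | "t < s" by linarith
    then show ?case
    proof cases
      case 1
      then show ?thesis by (simp add: Ds)
    next
      case 2
      have "norm (D (Suc n) t - D (Suc n) s) \<le> norm v * (K * (t - s)) ^ Suc n / fact (Suc n)
          - norm v * (K * (s - s)) ^ Suc n / fact (Suc n)"
      proof (rule differentiable_bound_general[OF 2,
            where \<phi>' = "\<lambda>\<tau>. norm v * K * (K * (\<tau> - s)) ^ n / fact n" and f' = "\<lambda>\<tau>. B \<tau> (D n \<tau>)"])
        show "continuous_on {s..t} (D (Suc n))"
          by (rule continuous_on_subset[OF cont]) (use s Suc.prems in auto)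
        fix \<tau> assume \<tau>: "s < \<tau>" "\<tau> < t"
        show "(D (Suc n) has_vector_derivative B \<tau> (D n \<tau>)) (at \<tau>)"
          by (rule at) (use \<tau> s Suc.prems in auto)
        show "((\<lambda>\<tau>. norm v * (K * (\<tau> - s)) ^ Suc n / fact (Suc n)) has_vector_derivative
            norm v * K * (K * (\<tau> - s)) ^ n / fact n) (at \<tau>)"
          unfolding has_real_derivative_iff_has_vector_derivative[symmetric]
          by (rule has_derivative_power_fact) (auto intro!: derivative_eq_intros)
        show "norm (B \<tau> (D n \<tau>)) \<le> norm v * K * (K * (\<tau> - s)) ^ n / fact n"
          using est[of \<tau>] \<tau> s Suc.prems by simp
      qed (intro continuous_intros, simp)
      then show ?thesis using 2 by (simp add: Ds)
    next
      \<comment> \<open>The mean value estimate runs from left to right, so the majorant gets a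
        minus sign in order to increase in time.\<close>
      case 3
      have "norm (D (Suc n) s - D (Suc n) t) \<le> - norm v * (K * (s - s)) ^ Suc n / fact (Suc n)
          - (- norm v * (K * (s - t)) ^ Suc n / fact (Suc n))"
      proof (rule differentiable_bound_general[OF 3,
            where \<phi>' = "\<lambda>\<tau>. norm v * K * (K * (s - \<tau>)) ^ n / fact n" and f' = "\<lambda>\<tau>. B \<tau> (D n \<tau>)"])
        show "continuous_on {t..s} (D (Suc n))"
          by (rule continuous_on_subset[OF cont]) (use s Suc.prems in auto)
        fix \<tau> assume \<tau>: "t < \<tau>" "\<tau> < s"
        show "(D (Suc n) has_vector_derivative B \<tau> (D n \<tau>)) (at \<tau>)"
          by (rule at) (use \<tau> s Suc.prems in auto)
        have "((\<lambda>\<tau>. K * (s - \<tau>)) has_real_derivative - K) (at \<tau>)"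
          by (auto intro!: derivative_eq_intros)
        from has_derivative_power_fact[OF this, of "- norm v" n]
        show "((\<lambda>\<tau>. - norm v * (K * (s - \<tau>)) ^ Suc n / fact (Suc n)) has_vector_derivative
            norm v * K * (K * (s - \<tau>)) ^ n / fact n) (at \<tau>)"
          unfolding has_real_derivative_iff_has_vector_derivative[symmetric]
          by (simp del: power_Suc fact_Suc)
        show "norm (B \<tau> (D n \<tau>)) \<le> norm v * K * (K * (s - \<tau>)) ^ n / fact n"
          using est[of \<tau>] \<tau> s Suc.prems by simp
      qed (intro continuous_intros, simp)
      then show ?thesis using 3 by (simp add: Ds)
    qed
  qed
  have "sol (\<lambda>t. \<Sum>n. D n t)"
  proof (rule series_solution[OF D0 D'])
    show "summable (\<lambda>n. norm v * (K * (b - a)) ^ n / fact n)" by (rule summable_power_fact)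
    fix n t assume t: "t \<in> {a..b}"
    have "norm v * (K * \<bar>t - s\<bar>) ^ n / fact n \<le> norm v * (K * (b - a)) ^ n / fact n"
      using t s K(1) by (intro divide_right_mono mult_left_mono power_mono) auto
    then show "norm (D n t) \<le> norm v * (K * (b - a)) ^ n / fact n"
      using bound[OF t, of n] by linarith
  qed
  moreover have "(\<Sum>n. D n s) = (\<Sum>n\<in>{0}. D n s)"
    by (rule suminf_finite) (use DS in \<open>auto simp: not0_implies_Suc gr0_conv_Suc\<close>)
  ultimately show ?thesis by (intro exI[of _ "\<lambda>t. \<Sum>n. D n t"]) (simp add: D0)
qed

lemma sol_diff: "sol x \<Longrightarrow> sol y \<Longrightarrow> sol (\<lambda>t. x t - y t)"
  unfolding sol_def by (auto simp: blinfun.diff_right intro!: has_vector_derivative_diff)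

lemma sol_add: "sol x \<Longrightarrow> sol y \<Longrightarrow> sol (\<lambda>t. x t + y t)"
  unfolding sol_def by (auto simp: blinfun.add_right intro!: has_vector_derivative_add)

text \<open>The component x - P x has derivative 0, because values of the generator are fixed by
  \<open>P\<close>.\<close>

lemma sol_invariant:
  assumes P: "bounded_linear P" "\<And>t u. t \<in> {a..b} \<Longrightarrow> P (B t u) = B t u"
    and x: "sol x" "s \<in> {a..b}" "P (x s) = x s" and t: "t \<in> {a..b}"
  shows "P (x t) = x t"
proof -
  have "norm ((x t - P (x t)) - (x s - P (x s))) \<le> 0 * \<bar>t - s\<bar>"
  proof (rule vector_derivative_norm_bound[where f = "\<lambda>t. x t - P (x t)" and f' = "\<lambda>_. 0", OF _ _ x(2) t])
    fix \<tau> assume \<tau>: "\<tau> \<in> {a..b}"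
    have d: "(x has_vector_derivative B \<tau> (x \<tau>)) (at \<tau> within {a..b})"
      using x(1) \<tau> by (simp add: sol_def)
    show "((\<lambda>t. x t - P (x t)) has_vector_derivative 0) (at \<tau> within {a..b})"
      using has_vector_derivative_diff[OF d bounded_linear.has_vector_derivative[OF P(1) d]]
      by (simp add: P(2)[OF \<tau>])
  qed simp
  then show ?thesis using x(3) by simp
qed

end

section \<open>Skew generators: conservation, perturbation and propagators\<close>

locale skew_ode = linear_ode B a b
  for B :: "real \<Rightarrow> 'a::complex_hilbert_space \<Rightarrow>\<^sub>L 'a" and a b :: real +
  assumes skew: "t \<in> {a..b} \<Longrightarrow> cinner (B t u) v = - cinner u (B t v)"
begin

text \<open>A bounded operator of this type is only known to be real linear; having an adjoint, here
  minus itself, forces complex linearity.\<close>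

lemma B_scaleC:
  assumes "t \<in> {a..b}"
  shows "B t (c *\<^sub>C u) = c *\<^sub>C B t u"
proof -
  have "cinner (B t (c *\<^sub>C u) - c *\<^sub>C B t u) v = 0" for v
    by (simp add: cinner_simps skew[OF assms])
  from this[of "B t (c *\<^sub>C u) - c *\<^sub>C B t u"] show ?thesis by (simp add: cinner_self)
qed

lemma sol_scaleC: "sol x \<Longrightarrow> sol (\<lambda>t. c *\<^sub>C x t)"
  unfolding sol_def
  by (simp add: B_scaleC bounded_linear.has_vector_derivative[OF bounded_linear_scaleC])

text \<open>Skewness cancels the two terms of the product rule. Uniqueness and unitarity of the
  propagator follow from this conservation law.\<close>

lemma cinner_sol_const:
  assumes "sol x" "sol y" "s \<in> {a..b}" "t \<in> {a..b}"
  shows "cinner (x t) (y t) = cinner (x s) (y s)"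
proof -
  have "norm (cinner (x t) (y t) - cinner (x s) (y s)) \<le> 0 * \<bar>t - s\<bar>"
  proof (rule vector_derivative_norm_bound[where f = "\<lambda>t. cinner (x t) (y t)" and f' = "\<lambda>_. 0"])
    fix \<tau> assume \<tau>: "\<tau> \<in> {a..b}"
    have "((\<lambda>t. cinner (x t) (y t)) has_vector_derivative
        (cinner (x \<tau>) (B \<tau> (y \<tau>)) + cinner (B \<tau> (x \<tau>)) (y \<tau>))) (at \<tau> within {a..b})"
      by (rule bounded_bilinear.has_vector_derivative[OF bounded_bilinear_cinner])
        (use assms \<tau> in \<open>simp_all add: sol_def\<close>)
    then show "((\<lambda>t. cinner (x t) (y t)) has_vector_derivative 0) (at \<tau> within {a..b})"
      by (simp add: skew[OF \<tau>])
  qed (use assms in auto)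
  then show ?thesis by simp
qed

lemma norm_sol_const:
  assumes "sol x" "s \<in> {a..b}" "t \<in> {a..b}"
  shows "norm (x t) = norm (x s)"
proof -
  have "complex_of_real ((norm (x t))\<^sup>2) = of_real ((norm (x s))\<^sup>2)"
    using cinner_sol_const[OF assms(1,1,2,3)] by (simp only: cinner_self)
  then have "(norm (x t))\<^sup>2 = (norm (x s))\<^sup>2" by (simp only: of_real_eq_iff)
  then show ?thesis by (simp add: power2_eq_iff_nonneg)
qed

lemma sol_unique:
  assumes "sol x" "sol y" "s \<in> {a..b}" "x s = y s" "t \<in> {a..b}"
  shows "x t = y t"
  using norm_sol_const[OF sol_diff[OF assms(1,2)] assms(3,5)] assms(4) by simp

text \<open>Testing against the solution \<open>z\<close> of the homogeneous equation with \<open>z t = x t\<close> replaces Duhamel's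
  formula.\<close>

lemma norm_perturbed_sol_le:
  assumes x: "\<And>t. t \<in> {a..b} \<Longrightarrow> (x has_vector_derivative (B t (x t) + g t)) (at t within {a..b})"
    and g: "\<And>t. t \<in> {a..b} \<Longrightarrow> norm (g t) \<le> \<epsilon>"
    and s: "s \<in> {a..b}" and t: "t \<in> {a..b}"
  shows "norm (x t) \<le> norm (x s) + \<epsilon> * \<bar>t - s\<bar>"
proof (cases "x t = 0")
  case True
  then show ?thesis using norm_ge_zero order_trans[OF norm_ge_zero g[OF t]] by simp
next
  case False
  obtain z where z: "sol z" "z t = x t" using ex_sol[OF t] by blast
  have nz: "norm (z \<tau>) = norm (x t)" if "\<tau> \<in> {a..b}" for \<tau>
    using norm_sol_const[OF z(1) t that] z(2) by simp
  have "norm (cinner (x t) (z t) - cinner (x s) (z s)) \<le> (\<epsilon> * norm (x t)) * \<bar>t - s\<bar>"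
  proof (rule vector_derivative_norm_bound[where f = "\<lambda>t. cinner (x t) (z t)"
        and f' = "\<lambda>\<tau>. cinner (g \<tau>) (z \<tau>)", OF _ _ s t])
    fix \<tau> assume \<tau>: "\<tau> \<in> {a..b}"
    have "((\<lambda>t. cinner (x t) (z t)) has_vector_derivative
        (cinner (x \<tau>) (B \<tau> (z \<tau>)) + cinner (B \<tau> (x \<tau>) + g \<tau>) (z \<tau>))) (at \<tau> within {a..b})"
      by (rule bounded_bilinear.has_vector_derivative[OF bounded_bilinear_cinner x[OF \<tau>]])
        (use z \<tau> in \<open>simp add: sol_def\<close>)
    then show "((\<lambda>t. cinner (x t) (z t)) has_vector_derivative cinner (g \<tau>) (z \<tau>)) (at \<tau> within {a..b})"
      by (simp add: skew[OF \<tau>] cinner_add_left)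
    show "norm (cinner (g \<tau>) (z \<tau>)) \<le> \<epsilon> * norm (x t)"
      using cmod_cinner_le[of "g \<tau>" "z \<tau>"] mult_right_mono[OF g[OF \<tau>], of "norm (x t)"] nz[OF \<tau>]
      by simp
  qed
  moreover have "norm (cinner (x s) (z s)) \<le> norm (x s) * norm (x t)"
    using cmod_cinner_le[of "x s" "z s"] nz[OF s] by simp
  moreover have "norm (cinner (x t) (z t)) = norm (x t) * norm (x t)"
    by (simp add: z(2) cinner_self power2_eq_square norm_mult)
  ultimately have "norm (x t) * norm (x t) \<le> (norm (x s) + \<epsilon> * \<bar>t - s\<bar>) * norm (x t)"
    using norm_triangle_sub[of "cinner (x t) (z t)" "cinner (x s) (z s)"]
    by (simp add: algebra_simps)
  then show ?thesis using False by simp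
qed

end

text \<open>\<open>V\<close> is the range of the projection \<open>P\<close>, and \<open>B t\<close> is \<open>- \<i> A t\<close>.\<close>

locale unitary_ode = skew_ode B a b
  for B :: "real \<Rightarrow> 'a::complex_hilbert_space \<Rightarrow>\<^sub>L 'a" and a b :: real +
  fixes P :: "'a \<Rightarrow> 'a" and V :: "'a set" and A :: "real \<Rightarrow> 'a \<Rightarrow> 'a"
  assumes bounded_linear_P: "bounded_linear P"
    and V_eq: "V = {u. P u = u}"
    and P_B: "t \<in> {a..b} \<Longrightarrow> P (B t u) = B t u"
    and A_eq: "t \<in> {a..b} \<Longrightarrow> A t u = \<i> *\<^sub>C B t u"
begin

text \<open>One solution is chosen for each starting time and vector. Uniqueness makes the choice
  linear, conservation makes it isometric, and \<open>sol_invariant\<close> keeps it in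
  \<open>V\<close>.\<close>

lemma ex_propagator: "\<exists>U. is_propagator_of {a..b} V A U"
proof -
  have "\<exists>X. \<forall>s\<in>{a..b}. \<forall>v. sol (X s v) \<and> X s v s = v"
    using ex_sol by (intro bchoice ballI choice allI)
  then obtain X where X: "\<And>s v. s \<in> {a..b} \<Longrightarrow> sol (X s v)" "\<And>s v. s \<in> {a..b} \<Longrightarrow> X s v s = v"
    by blast
  have V: "X s v t \<in> V" if "s \<in> {a..b}" "t \<in> {a..b}" "v \<in> V" for s t v
    using sol_invariant[OF bounded_linear_P P_B X(1)[OF that(1)] that(1) _ that(2), of v] that X(2)
    by (simp add: V_eq)
  \<comment> \<open>Solving back to the starting time returns the starting vector, which supplies
    surjectivity onto \<open>V\<close>.\<close>
  have inv: "X t (X s v t) s = v" if "s \<in> {a..b}" "t \<in> {a..b}" for s t v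
    using sol_unique[OF X(1)[OF that(2)] X(1)[OF that(1)] that(2) _ that(1), of "X s v t" v] X(2) that
    by simp
  have "unitary_on V (\<lambda>v. X s v t)" if st: "s \<in> {a..b}" "t \<in> {a..b}" for s t
    unfolding unitary_on_def clinear_on_def
  proof (intro conjI ballI allI)
    show "X s (u + v) t = X s u t + X s v t" for u v
      by (rule sol_unique[OF X(1)[OF st(1)] sol_add[OF X(1)[OF st(1)] X(1)[OF st(1)]] st(1) _ st(2)])
        (simp add: X(2)[OF st(1)])
    show "X s (c *\<^sub>C u) t = c *\<^sub>C X s u t" for c u
      by (rule sol_unique[OF X(1)[OF st(1)] sol_scaleC[OF X(1)[OF st(1)]] st(1) _ st(2)])
        (simp add: X(2)[OF st(1)])
    show "cinner (X s u t) (X s v t) = cinner u v" for u v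
      using cinner_sol_const[OF X(1) X(1) st, OF st(1,1), of u v] X(2)[OF st(1)] by simp
    show "(\<lambda>v. X s v t) ` V = V"
    proof
      show "(\<lambda>v. X s v t) ` V \<subseteq> V" using V[OF st] by blast
      show "V \<subseteq> (\<lambda>v. X s v t) ` V"
      proof
        fix v assume "v \<in> V"
        then show "v \<in> (\<lambda>v. X s v t) ` V"
          using V[OF st(2,1)] inv[OF st(2,1)] by (intro image_eqI[of _ _ "X t v s"]) simp_all
      qed
    qed
  qed
  moreover have "\<exists>w. (X s v has_vector_derivative w) (at t within {a..b}) \<and> \<i> *\<^sub>C w = A t (X s v t)"
    if "s \<in> {a..b}" "t \<in> {a..b}" for s t v
    using X(1)[OF that(1), unfolded sol_def] that(2) A_eq[OF that(2)]
    by (intro exI[of _ "B t (X s v t)"]) simp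
  ultimately show ?thesis
    unfolding is_propagator_of_def
    by (intro exI[of _ "\<lambda>t s v. X s v t"] conjI ballI X(2))
qed

text \<open>\<open>U_N\<close> is selected by choice, so its properties must be read off from
  \<open>is_propagator_of\<close>; the factor \<i> of that formulation is removed here.\<close>

lemma propagator_sol:
  assumes U: "is_propagator_of {a..b} V A U" and "s \<in> {a..b}" "v \<in> V"
  shows "sol (\<lambda>t. U t s v)"
  unfolding sol_def
proof
  fix t assume t: "t \<in> {a..b}"
  then obtain w where w: "((\<lambda>t. U t s v) has_vector_derivative w) (at t within {a..b})"
    "\<i> *\<^sub>C w = A t (U t s v)"
    using assms unfolding is_propagator_of_def by blast
  then have "(- \<i>) *\<^sub>C (\<i> *\<^sub>C w) = (- \<i>) *\<^sub>C (\<i> *\<^sub>C B t (U t s v))" by (simp only: A_eq[OF t])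
  then have "w = B t (U t s v)" by simp
  then show "((\<lambda>t. U t s v) has_vector_derivative B t (U t s v)) (at t within {a..b})"
    using w by simp
qed

lemma propagator_simps:
  assumes U: "is_propagator_of {a..b} V A U" and "s \<in> {a..b}" "t \<in> {a..b}"
  shows "unitary_on V (U t s)" "v \<in> V \<Longrightarrow> U s s v = v" "v \<in> V \<Longrightarrow> U t s v \<in> V"
  using assms unfolding is_propagator_of_def unitary_on_def by blast+

lemma propagator_eqI:
  assumes U: "is_propagator_of {a..b} V A U" and "s \<in> {a..b}" "t \<in> {a..b}" "v \<in> V"
    and "sol x" "x s = v"
  shows "U t s v = x t"
  by (rule sol_unique[OF propagator_sol[OF U assms(2,4)] assms(5,2) _ assms(3)])
    (use assms propagator_simps(2)[OF U assms(2,2)] in simp)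

lemma propagator_comp:
  assumes U: "is_propagator_of {a..b} V A U" and "s \<in> {a..b}" "r \<in> {a..b}" "t \<in> {a..b}" "v \<in> V"
  shows "U t r (U r s v) = U t s v"
proof (rule propagator_eqI[OF U assms(3,4)])
  show "U r s v \<in> V" by (rule propagator_simps(3)[OF U assms(2,3,5)])
  show "sol (\<lambda>t. U t s v)" by (rule propagator_sol[OF U assms(2,5)])
qed simp

end

section \<open>Unitary maps, an almost everywhere Gronwall estimate and exponentials\<close>

lemma unitary_on_comp:
  assumes "unitary_on V S" "unitary_on V T"
  shows "unitary_on V (\<lambda>v. S (T v))"
proof -
  have "T v \<in> V" if "v \<in> V" for v using assms(2) that by (auto simp: unitary_on_def)
  moreover have "(\<lambda>v. S (T v)) ` V = V"
    using assms by (simp add: unitary_on_def image_image[symmetric])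
  ultimately show ?thesis using assms by (simp add: unitary_on_def clinear_on_def)
qed

lemma unitary_on_cong: "(\<And>v. v \<in> V \<Longrightarrow> S v = T v) \<Longrightarrow> csubspace V \<Longrightarrow> unitary_on V S \<Longrightarrow> unitary_on V T"
  unfolding unitary_on_def clinear_on_def csubspace_def by (simp cong: image_cong)

lemma unitary_on_norm_diff:
  assumes "unitary_on V T" "u \<in> V" "v \<in> V"
  shows "norm (T u - T v) = norm (u - v)"
proof -
  have "cinner (T u - T v) (T u - T v) = cinner (u - v) (u - v)"
    using assms by (simp add: unitary_on_def cinner_simps)
  then have "(norm (T u - T v))\<^sup>2 = (norm (u - v))\<^sup>2"
    by (simp only: cinner_self of_real_eq_iff)
  then show ?thesis by (simp add: power2_eq_iff_nonneg)
qed

text \<open>Bounding the absolute value of the logarithmic derivative makes the estimate valid in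
  both time directions. For the gauge integral, ln f is recovered from its derivative because that
  derivative exists at every point; the almost everywhere bound enters afterwards.\<close>

lemma gronwall_ae:
  fixes f f' c :: "real \<Rightarrow> real"
  assumes f: "\<And>t. t \<in> {a..b} \<Longrightarrow> 0 < f t"
      "\<And>t. t \<in> {a..b} \<Longrightarrow> (f has_real_derivative f' t) (at t within {a..b})"
    and c: "c integrable_on {a..b}" "\<And>t. t \<in> {a..b} \<Longrightarrow> 0 \<le> c t"
    and Z: "negligible Z" "\<And>t. t \<in> {a..b} \<Longrightarrow> t \<notin> Z \<Longrightarrow> \<bar>f' t\<bar> \<le> c t * f t"
    and st: "s \<in> {a..b}" "t \<in> {a..b}"
  shows "f t \<le> exp (integral {a..b} c) * f s"
proof -
  \<comment> \<open>Setting the quotient to 0 on the null set changes no integral and makes the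
    bound by \<open>c\<close> hold at every point.\<close>
  define h where "h \<tau> = (if \<tau> \<in> Z then 0 else f' \<tau> / f \<tau>)" for \<tau>
  have main: "\<bar>ln (f v) - ln (f u)\<bar> \<le> integral {a..b} c" if uv: "u \<in> {a..b}" "v \<in> {a..b}" "u \<le> v" for u v
  proof -
    have sub: "{u..v} \<subseteq> {a..b}" using uv by simp
    have "((\<lambda>\<tau>. f' \<tau> / f \<tau>) has_integral (ln (f v) - ln (f u))) {u..v}"
    proof (rule fundamental_theorem_of_calculus[OF uv(3)])
      fix \<tau> assume "\<tau> \<in> {u..v}"
      then have \<tau>: "\<tau> \<in> {a..b}" using sub by blast
      have "((\<lambda>\<tau>. ln (f \<tau>)) has_real_derivative 1 / f \<tau> * f' \<tau>) (at \<tau> within {u..v})"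
        by (rule DERIV_chain2[OF DERIV_ln_divide[OF f(1)[OF \<tau>]] DERIV_subset[OF f(2)[OF \<tau>] sub]])
      then show "((\<lambda>\<tau>. ln (f \<tau>)) has_vector_derivative f' \<tau> / f \<tau>) (at \<tau> within {u..v})"
        by (simp add: has_real_derivative_iff_has_vector_derivative)
    qed
    then have h: "(h has_integral (ln (f v) - ln (f u))) {u..v}"
      by (rule has_integral_spike[OF Z(1), rotated]) (simp add: h_def)
    have cuv: "c integrable_on {u..v}" by (rule integrable_subinterval_real[OF c(1) sub])
    have "norm (integral {u..v} h) \<le> integral {u..v} c"
    proof (rule Henstock_Kurzweil_Integration.integral_norm_bound_integral[OF has_integral_integrable[OF h] cuv])
      fix \<tau> assume "\<tau> \<in> {u..v}"
      then have \<tau>: "\<tau> \<in> {a..b}" using sub by blast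
      show "norm (h \<tau>) \<le> c \<tau>"
        using c(2)[OF \<tau>] Z(2)[OF \<tau>] f(1)[OF \<tau>]
        by (auto simp: h_def pos_divide_le_eq abs_div)
    qed
    also have "\<dots> \<le> integral {a..b} c"
      by (rule integral_subset_le[OF sub cuv c(1)]) (use c(2) in blast)
    finally show ?thesis by (simp add: integral_unique[OF h])
  qed
  have "ln (f t) - ln (f s) \<le> integral {a..b} c"
    using main[OF st] main[OF st(2,1)] by (cases "s \<le> t") linarith+
  then have "exp (ln (f t)) \<le> exp (integral {a..b} c + ln (f s))" by simp
  then show ?thesis using f(1) st by (simp add: exp_add)
qed

lemma blinfun_power_scaleR:
  fixes B\<^sub>0 :: "'a::real_normed_vector \<Rightarrow>\<^sub>L 'a"
  shows "((\<lambda>w. \<delta> *\<^sub>R blinfun_apply B\<^sub>0 w) ^^ n) v = \<delta> ^ n *\<^sub>R (blinfun_apply B\<^sub>0 ^^ n) v"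
  by (induction n) (simp_all add: blinfun.scaleR_right)

text \<open>With constant generator the terms of the exponential series satisfy the recursion
  required by \<open>series_solution\<close>.\<close>

lemma op_exp_sol:
  fixes B\<^sub>0 :: "'a::complex_hilbert_space \<Rightarrow>\<^sub>L 'a"
  shows "linear_ode.sol (\<lambda>_. B\<^sub>0) c d (\<lambda>t. op_exp (\<lambda>w. (t - c) *\<^sub>R B\<^sub>0 w) v)"
    and "op_exp (\<lambda>w. (c - c) *\<^sub>R B\<^sub>0 w) v = v"
proof -
  interpret linear_ode "\<lambda>_. B\<^sub>0" c d by unfold_locales simp
  \<comment> \<open>The coefficient 1 is kept so that the terms have the shape of
    \<open>has_derivative_power_fact\<close>.\<close>
  define D where "D n t = (1 * (t - c) ^ n / fact n) *\<^sub>R (blinfun_apply B\<^sub>0 ^^ n) v" for n t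
  have D: "op_exp (\<lambda>w. (t - c) *\<^sub>R B\<^sub>0 w) v = (\<Sum>n. D n t)" for t
    by (simp add: op_exp_def D_def blinfun_power_scaleR divide_inverse mult.commute)
  have pow: "norm ((blinfun_apply B\<^sub>0 ^^ n) v) \<le> norm B\<^sub>0 ^ n * norm v" for n
  proof (induction n)
    case (Suc n)
    have "norm (B\<^sub>0 ((blinfun_apply B\<^sub>0 ^^ n) v)) \<le> norm B\<^sub>0 * norm ((blinfun_apply B\<^sub>0 ^^ n) v)"
      by (rule norm_blinfun)
    also have "\<dots> \<le> norm B\<^sub>0 * (norm B\<^sub>0 ^ n * norm v)" by (rule mult_left_mono[OF Suc]) simp
    finally show ?case by (simp add: mult_ac)
  qed simp
  show "sol (\<lambda>t. op_exp (\<lambda>w. (t - c) *\<^sub>R B\<^sub>0 w) v)"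
    unfolding D
  proof (rule series_solution)
    show "D 0 t = v" for t by (simp add: D_def)
    show "summable (\<lambda>n. norm v * ((d - c) * norm B\<^sub>0) ^ n / fact n)" by (rule summable_power_fact)
  next
    fix n t assume t: "t \<in> {c..d}"
    have "((\<lambda>t. t - c) has_real_derivative 1) (at t within {c..d})"
      by (auto intro!: derivative_eq_intros)
    from has_derivative_power_fact[OF this, of 1 n]
    have "((\<lambda>t. (1 * (t - c) ^ Suc n / fact (Suc n))) has_vector_derivative ((t - c) ^ n / fact n))
        (at t within {c..d})"
      by (simp add: has_real_derivative_iff_has_vector_derivative del: power_Suc fact_Suc)
    from bounded_linear.has_vector_derivative[OF bounded_linear_scaleR_left[of "(blinfun_apply B\<^sub>0 ^^ Suc n) v"] this]
    show "(D (Suc n) has_vector_derivative B\<^sub>0 (D n t)) (at t within {c..d})"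
      unfolding D_def[abs_def] by (simp add: blinfun.scaleR_right del: fact_Suc power_Suc)
    have "norm (D n t) = (t - c) ^ n / fact n * norm ((blinfun_apply B\<^sub>0 ^^ n) v)"
      using t by (simp add: D_def power_abs)
    also have "\<dots> \<le> (d - c) ^ n / fact n * (norm B\<^sub>0 ^ n * norm v)"
      using t by (intro mult_mono pow divide_right_mono power_mono) auto
    finally show "norm (D n t) \<le> norm v * ((d - c) * norm B\<^sub>0) ^ n / fact n"
      by (simp add: power_mult_distrib mult_ac)
  qed
  \<comment> \<open>At the starting time only n = 0 survives, with 0^0 = 1.\<close>
  have "(\<Sum>n. D n c) = (\<Sum>n\<in>{0}. D n c)"
    by (rule suminf_finite) (auto simp: D_def)
  then show "op_exp (\<lambda>w. (c - c) *\<^sub>R B\<^sub>0 w) v = v" unfolding D by (simp add: D_def)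
qed

text \<open>By uniqueness the exponential is the propagator of the constant generator, and so
  inherits unitarity.\<close>

lemma op_exp_propagator:
  assumes "unitary_ode (\<lambda>_. B\<^sub>0) c d P V A" "c \<le> d" "csubspace V"
  shows "unitary_on V (op_exp (\<lambda>w. (d - c) *\<^sub>R blinfun_apply B\<^sub>0 w))"
proof -
  interpret unitary_ode "\<lambda>_. B\<^sub>0" c d P V A by fact
  obtain U where U: "is_propagator_of {c..d} V A U" using ex_propagator by blast
  have cd: "c \<in> {c..d}" "d \<in> {c..d}" using assms(2) by simp_all
  show ?thesis
  proof (rule unitary_on_cong[OF _ assms(3) propagator_simps(1)[OF U cd]])
    show "U d c v = op_exp (\<lambda>w. (d - c) *\<^sub>R blinfun_apply B\<^sub>0 w) v" if "v \<in> V" for v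
      by (rule propagator_eqI[OF U cd that op_exp_sol(1)]) (rule op_exp_sol(2))
  qed
qed

section \<open>Galerkin approximations\<close>

locale evolution = positive_compact H\<^sub>0 for H\<^sub>0 :: "'a::complex_hilbert_space unbounded_op" +
  fixes H :: "real \<Rightarrow> 'a \<Rightarrow> 'a" and a b \<mu> \<sigma> \<alpha> :: real
  assumes separable: "separable_space (euclidean :: 'a topology)"
    and ab: "a \<le> b"
    and params: "\<mu> \<ge> 0" "\<sigma> > 0" "0 < \<alpha>" "\<alpha> \<le> 1"
    and continuity: "\<And>r. r \<ge> 0 \<Longrightarrow> norm_continuous_between H\<^sub>0 (r + \<mu>) r {a..b} H"
    and commutator: "\<exists>c. integrable (lebesgue_on {a..b}) c \<and> (\<forall>t\<in>{a..b}. 0 \<le> c t) \<and>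
        (\<forall>v\<in>Hsp_inf H\<^sub>0. AE t in lebesgue_on {a..b}.
           cmod (\<i> * (cinner (H t v) (op_app (Lambda_pow H\<^sub>0 (2 * (\<mu> + \<sigma>))) v)
                    - cinner (op_app (Lambda_pow H\<^sub>0 (2 * (\<mu> + \<sigma>))) v) (H t v)))
             \<le> c t * (Hnorm H\<^sub>0 (\<mu> + \<sigma>) v)\<^sup>2)"
    and symmetric: "\<And>t u v. t \<in> {a..b} \<Longrightarrow> u \<in> Hsp_inf H\<^sub>0 \<Longrightarrow> v \<in> Hsp_inf H\<^sub>0 \<Longrightarrow>
        cinner (H t u) v = cinner u (H t v)"
    and holder: "holder_between H\<^sub>0 \<mu> 0 \<alpha> {a..b} H"
begin

abbreviation "Pr \<equiv> P_N H\<^sub>0"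
abbreviation "VN \<equiv> HN_space H\<^sub>0"
abbreviation "\<rho> \<equiv> \<mu> + \<sigma>"

lemma bounded_H: "t \<in> {a..b} \<Longrightarrow> 0 \<le> r \<Longrightarrow> bounded_between H\<^sub>0 (r + \<mu>) r (H t)"
  using continuity[of r] by (simp add: norm_continuous_between_def)

lemma H_in_Hsp: "t \<in> {a..b} \<Longrightarrow> 0 \<le> r \<Longrightarrow> u \<in> Hsp H\<^sub>0 (r + \<mu>) \<Longrightarrow> H t u \<in> Hsp H\<^sub>0 r"
  using bounded_H by (fastforce simp: bounded_between_def)

lemma H_lin:
  assumes "t \<in> {a..b}"
  shows "u \<in> Hsp H\<^sub>0 \<mu> \<Longrightarrow> v \<in> Hsp H\<^sub>0 \<mu> \<Longrightarrow> H t (u + v) = H t u + H t v"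
    and "u \<in> Hsp H\<^sub>0 \<mu> \<Longrightarrow> H t (c *\<^sub>C u) = c *\<^sub>C H t u"
  using bounded_H[OF assms, of 0] by (simp_all add: bounded_between_def clinear_on_def)

lemma Hnorm_scaleC:
  assumes "u \<in> Hsp H\<^sub>0 r"
  shows "Hnorm H\<^sub>0 r (c *\<^sub>C u) = cmod c * Hnorm H\<^sub>0 r u"
  using Hsp_scaleC[OF assms] by (simp add: Hnorm_eq norm_scaleC)

lemma Hnorm_diff_le:
  assumes "u \<in> Hsp H\<^sub>0 r" "v \<in> Hsp H\<^sub>0 r"
  shows "Hnorm H\<^sub>0 r (u - v) \<le> Hnorm H\<^sub>0 r u + Hnorm H\<^sub>0 r v"
  using Hsp_diff[OF assms] norm_triangle_ineq4 by (simp add: Hnorm_eq)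

text \<open>\<open>norm_between\<close> is a supremum of reals and carries information only when the
  values are bounded above. Boundedness of \<open>X\<close> and \<open>Y\<close> ensures this, and
  normalizing \<open>u\<close> gives the estimate.\<close>

lemma norm_between_bound:
  assumes T: "bounded_between H\<^sub>0 p q X" "bounded_between H\<^sub>0 p q Y" and u: "u \<in> Hsp H\<^sub>0 p"
  shows "Hnorm H\<^sub>0 q (X u - Y u) \<le> norm_between H\<^sub>0 p q (\<lambda>u. X u - Y u) * Hnorm H\<^sub>0 p u"
proof -
  obtain K K' where K: "\<forall>u\<in>Hsp H\<^sub>0 p. Hnorm H\<^sub>0 q (X u) \<le> K * Hnorm H\<^sub>0 p u"
      "\<forall>u\<in>Hsp H\<^sub>0 p. Hnorm H\<^sub>0 q (Y u) \<le> K' * Hnorm H\<^sub>0 p u"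
    using T by (auto simp: bounded_between_def)
  have in_q: "X v \<in> Hsp H\<^sub>0 q" "Y v \<in> Hsp H\<^sub>0 q" if "v \<in> Hsp H\<^sub>0 p" for v
    using T that by (auto simp: bounded_between_def)
  have bd: "Hnorm H\<^sub>0 q (X v - Y v) \<le> (K + K') * Hnorm H\<^sub>0 p v" if "v \<in> Hsp H\<^sub>0 p" for v
    using Hnorm_diff_le[OF in_q[OF that]] bspec[OF K(1) that] bspec[OF K(2) that]
    by (simp add: algebra_simps)
  have nonneg: "0 \<le> Hnorm H\<^sub>0 p v" for v by (simp add: Hnorm_eq)
  show ?thesis
  proof (cases "Hnorm H\<^sub>0 p u = 0")
    case True
    then show ?thesis using bd[OF u] by simp
  next
    case False
    define c where "c = complex_of_real (1 / Hnorm H\<^sub>0 p u)"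
    define v where "v = c *\<^sub>C u"
    have v: "v \<in> Hsp H\<^sub>0 p" using Hsp_scaleC[OF u] by (simp add: v_def)
    have "Hnorm H\<^sub>0 p v = cmod c * Hnorm H\<^sub>0 p u" unfolding v_def by (rule Hnorm_scaleC[OF u])
    also have "\<dots> = 1" using False nonneg[of u] by (simp add: c_def norm_divide)
    finally have v1: "Hnorm H\<^sub>0 p v = 1" .
    have bdd: "bdd_above ((\<lambda>u. Hnorm H\<^sub>0 q (X u - Y u)) ` {u \<in> Hsp H\<^sub>0 p. Hnorm H\<^sub>0 p u \<le> 1})"
    proof (rule bdd_aboveI2)
      fix w assume "w \<in> {u \<in> Hsp H\<^sub>0 p. Hnorm H\<^sub>0 p u \<le> 1}"
      then have w: "w \<in> Hsp H\<^sub>0 p" "Hnorm H\<^sub>0 p w \<le> 1" by simp_all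
      have "(K + K') * Hnorm H\<^sub>0 p w \<le> \<bar>K + K'\<bar> * 1"
        by (intro mult_mono) (use w nonneg in auto)
      then show "Hnorm H\<^sub>0 q (X w - Y w) \<le> \<bar>K + K'\<bar>" using bd[OF w(1)] by (simp only: mult_1_right)
    qed
    have "Hnorm H\<^sub>0 q (X v - Y v) \<le> norm_between H\<^sub>0 p q (\<lambda>u. X u - Y u)"
      unfolding norm_between_def by (rule cSUP_upper[OF _ bdd]) (simp add: v v1)
    moreover have "X v - Y v = c *\<^sub>C (X u - Y u)"
      using T u by (simp add: v_def bounded_between_def clinear_on_def)
    moreover have "Hnorm H\<^sub>0 q (c *\<^sub>C (X u - Y u)) = Hnorm H\<^sub>0 q (X u - Y u) / Hnorm H\<^sub>0 p u"
      using Hnorm_scaleC[of "X u - Y u" q c] Hsp_diff[OF in_q[OF u]] nonneg[of u]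
      by (simp add: c_def norm_divide)
    ultimately show ?thesis using False nonneg[of u] by (simp add: pos_divide_le_eq)
  qed
qed

text \<open>Norm continuity bounds H(t) near each time, and finitely many such neighbourhoods cover
  the interval. It is used with r = 0 for the truncated generator and with r = \<sigma> for the
  source between two levels.\<close>

lemma H_uniform_bound:
  assumes r: "0 \<le> r"
  shows "\<exists>K\<ge>0. \<forall>t\<in>{a..b}. \<forall>u\<in>Hsp H\<^sub>0 (r + \<mu>). Hnorm H\<^sub>0 r (H t u) \<le> K * Hnorm H\<^sub>0 (r + \<mu>) u"
proof -
  have nonneg: "0 \<le> Hnorm H\<^sub>0 p u" for p u by (simp add: Hnorm_eq)
  have loc: "\<exists>d>0. \<exists>K\<ge>0. \<forall>t'\<in>{a..b}. dist t' t < d \<longrightarrow>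
      (\<forall>u\<in>Hsp H\<^sub>0 (r + \<mu>). Hnorm H\<^sub>0 r (H t' u) \<le> K * Hnorm H\<^sub>0 (r + \<mu>) u)" if t: "t \<in> {a..b}" for t
  proof -
    obtain K where K: "\<forall>u\<in>Hsp H\<^sub>0 (r + \<mu>). Hnorm H\<^sub>0 r (H t u) \<le> K * Hnorm H\<^sub>0 (r + \<mu>) u"
      using bounded_H[OF t r] by (auto simp: bounded_between_def)
    have "((\<lambda>t'. norm_between H\<^sub>0 (r + \<mu>) r (\<lambda>u. H t' u - H t u)) \<longlongrightarrow> 0) (at t within {a..b})"
      using continuity[OF r] t by (simp add: norm_continuous_between_def)
    then have "\<forall>\<^sub>F t' in at t within {a..b}. norm_between H\<^sub>0 (r + \<mu>) r (\<lambda>u. H t' u - H t u) < 1"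
      by (rule order_tendstoD) simp
    then obtain d where d: "d > 0" "\<forall>t'\<in>{a..b}. t' \<noteq> t \<and> dist t' t < d \<longrightarrow>
        norm_between H\<^sub>0 (r + \<mu>) r (\<lambda>u. H t' u - H t u) < 1"
      unfolding eventually_at by (elim exE conjE)
    have "Hnorm H\<^sub>0 r (H t' u) \<le> (\<bar>K\<bar> + 1) * Hnorm H\<^sub>0 (r + \<mu>) u"
      if t': "t' \<in> {a..b}" "dist t' t < d" and u: "u \<in> Hsp H\<^sub>0 (r + \<mu>)" for t' u
    proof -
      have Ku: "Hnorm H\<^sub>0 r (H t u) \<le> \<bar>K\<bar> * Hnorm H\<^sub>0 (r + \<mu>) u"
        using bspec[OF K u] mult_right_mono[OF abs_ge_self[of K] nonneg[of "r + \<mu>" u]] by linarith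
      have d1: "Hnorm H\<^sub>0 r (H t' u - H t u) \<le> 1 * Hnorm H\<^sub>0 (r + \<mu>) u"
      \<comment> \<open>The limit concerns punctured neighbourhoods only, so the centre is treated
        separately.\<close>
      proof (cases "t' = t")
        case True
        then show ?thesis using Hsp_diff[OF H_in_Hsp[OF t r u] H_in_Hsp[OF t r u]] nonneg[of "r + \<mu>" u]
          by (simp add: Hnorm_eq)
      next
        case False
        have "norm_between H\<^sub>0 (r + \<mu>) r (\<lambda>u. H t' u - H t u) \<le> 1" using d(2) t' False by (simp add: less_imp_le)
        then show ?thesis
          using norm_between_bound[OF bounded_H[OF t'(1) r] bounded_H[OF t r] u]
            mult_right_mono[OF _ nonneg[of "r + \<mu>" u]] order_trans by blast
      qed
      have mem: "H t' u - H t u \<in> Hsp H\<^sub>0 r"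
        using Hsp_diff[OF H_in_Hsp[OF t'(1) r u] H_in_Hsp[OF t r u]] by blast
      have "G r (H t' u) = G r (H t' u - H t u) + G r (H t u)"
        using Hsp_add[OF mem H_in_Hsp[OF t r u]] by simp
      then have "Hnorm H\<^sub>0 r (H t' u) \<le> Hnorm H\<^sub>0 r (H t' u - H t u) + Hnorm H\<^sub>0 r (H t u)"
        by (simp add: Hnorm_eq norm_triangle_ineq)
      then show ?thesis using d1 Ku by (simp add: algebra_simps)
    qed
    then show ?thesis using d(1) by (intro exI[of _ d] conjI exI[of _ "\<bar>K\<bar> + 1"]) auto
  qed
  define good where "good t d K \<longleftrightarrow> 0 < d \<and> 0 \<le> K \<and> (\<forall>t'\<in>{a..b}. dist t' t < d \<longrightarrow>
      (\<forall>u\<in>Hsp H\<^sub>0 (r + \<mu>). Hnorm H\<^sub>0 r (H t' u) \<le> K * Hnorm H\<^sub>0 (r + \<mu>) u))" for t d K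
  have "\<forall>t\<in>{a..b}. \<exists>d K. good t d K" using loc unfolding good_def by blast
  then obtain d K where dK: "\<forall>t\<in>{a..b}. good t (d t) (K t)" by metis
  have "{a..b} \<subseteq> (\<Union>t\<in>{a..b}. ball t (d t))" using dK by (force simp: good_def)
  then obtain F where F: "F \<subseteq> {a..b}" "finite F" "{a..b} \<subseteq> (\<Union>t\<in>F. ball t (d t))"
    by (rule compactE_image[rotated 2]) simp_all
  show ?thesis
  proof (intro exI[of _ "sum K F"] conjI ballI)
    show "0 \<le> sum K F" using dK F(1) by (intro sum_nonneg) (auto simp: good_def)
    fix t u assume t: "t \<in> {a..b}" and u: "u \<in> Hsp H\<^sub>0 (r + \<mu>)"
    obtain t0 where t0: "t0 \<in> F" "dist t t0 < d t0" using F(3) t by (auto simp: dist_commute)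
    have "Hnorm H\<^sub>0 r (H t u) \<le> K t0 * Hnorm H\<^sub>0 (r + \<mu>) u"
      using dK t0 F(1) t u unfolding good_def by blast
    also have "\<dots> \<le> sum K F * Hnorm H\<^sub>0 (r + \<mu>) u"
      using dK F t0(1) by (intro mult_right_mono member_le_sum nonneg) (auto simp: good_def)
    finally show "Hnorm H\<^sub>0 r (H t u) \<le> sum K F * Hnorm H\<^sub>0 (r + \<mu>) u" .
  qed
qed

section \<open>Truncated generators and Galerkin propagators\<close>

lemma bounded_linear_H_P:
  assumes t: "t \<in> {a..b}"
  shows "bounded_linear (\<lambda>u. H t (Pr N u))"
proof -
  obtain K where K: "0 \<le> K" "\<And>t u. t \<in> {a..b} \<Longrightarrow> u \<in> Hsp H\<^sub>0 (0 + \<mu>) \<Longrightarrow>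
      Hnorm H\<^sub>0 0 (H t u) \<le> K * Hnorm H\<^sub>0 (0 + \<mu>) u"
    using H_uniform_bound[of 0] by auto
  show ?thesis
  proof (rule bounded_linear_intro[where K = "K * (1 + N) powr \<mu>"])
    show "H t (Pr N (u + v)) = H t (Pr N u) + H t (Pr N v)" for u v
      by (simp add: P_N_add H_lin(1)[OF t] Q_G_P_N(1) params)
    show "H t (Pr N (c *\<^sub>R u)) = c *\<^sub>R H t (Pr N u)" for c u
      by (simp add: scaleR_scaleC P_N_scaleC H_lin(2)[OF t] Q_G_P_N(1) params)
    fix u
    have "norm (H t (Pr N u)) \<le> K * Hnorm H\<^sub>0 \<mu> (Pr N u)"
      using K(2)[OF t, of "Pr N u"] by (simp add: Hnorm_0 Q_G_P_N(1) params)
    also have "\<dots> \<le> K * ((1 + N) powr \<mu> * norm u)"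
      unfolding Hnorm_eq by (rule mult_left_mono[OF norm_G_P_N_le[OF params(1)] K(1)])
    finally show "norm (H t (Pr N u)) \<le> norm u * (K * (1 + N) powr \<mu>)" by (simp add: mult_ac)
  qed
qed

text \<open>The truncated generator on the whole space: it kills the orthogonal complement of
  \<open>HN_space\<close> and takes values in \<open>HN_space\<close>. \<open>Blinfun\<close> has
  its intended meaning for \<open>t\<close> in {a..b}, where boundedness is known.\<close>

definition BN :: "real \<Rightarrow> real \<Rightarrow> 'a \<Rightarrow>\<^sub>L 'a" where
  "BN N t = Blinfun (\<lambda>u. (- \<i>) *\<^sub>C H_N H\<^sub>0 H N t u)"

lemma BN_apply: "t \<in> {a..b} \<Longrightarrow> BN N t u = (- \<i>) *\<^sub>C Pr N (H t (Pr N u))"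
  unfolding BN_def H_N_def
  by (subst bounded_linear_Blinfun_apply)
    (rule bounded_linear_compose[OF bounded_linear_scaleC bounded_linear_compose[OF bounded_linear_P_N bounded_linear_H_P]],
      simp_all)

text \<open>Kept in terms of the \<mu>-norm of P_N u for two purposes: bounding it by (1 + N)^\<mu>
  gives operator-norm continuity at fixed N, while the partition error inserts the \<mu>-norm of the
  trajectory.\<close>

lemma norm_BN_diff_le:
  assumes "t \<in> {a..b}" "t' \<in> {a..b}"
  shows "norm (BN N t' u - BN N t u) \<le> norm_between H\<^sub>0 \<mu> 0 (\<lambda>u. H t' u - H t u) * Hnorm H\<^sub>0 \<mu> (Pr N u)"
proof -
  have "BN N t' u - BN N t u = (- \<i>) *\<^sub>C Pr N (H t' (Pr N u) - H t (Pr N u))"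
    using linear_simps[OF bounded_linear_P_N[of N]] by (simp add: BN_apply[OF assms(1)] BN_apply[OF assms(2)])
  then have "norm (BN N t' u - BN N t u) = norm (Pr N (H t' (Pr N u) - H t (Pr N u)))"
    by (simp only: norm_scaleC) simp
  also have "\<dots> \<le> norm (H t' (Pr N u) - H t (Pr N u))" by (rule norm_P_N_le)
  also have "\<dots> \<le> norm_between H\<^sub>0 \<mu> 0 (\<lambda>u. H t' u - H t u) * Hnorm H\<^sub>0 \<mu> (Pr N u)"
    using norm_between_bound[of \<mu> 0 "H t'" "H t" "Pr N u"] bounded_H[of _ 0] assms
    by (simp add: Hnorm_0 Q_G_P_N(1) params)
  finally show ?thesis .
qed

lemma continuous_on_BN: "continuous_on {a..b} (BN N)"
  unfolding continuous_on_def
proof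
  fix t assume t: "t \<in> {a..b}"
  have "((\<lambda>t'. BN N t' - BN N t) \<longlongrightarrow> 0) (at t within {a..b})"
  proof (rule Lim_null_comparison)
    have "((\<lambda>t'. norm_between H\<^sub>0 \<mu> 0 (\<lambda>u. H t' u - H t u)) \<longlongrightarrow> 0) (at t within {a..b})"
      using continuity[of 0] t by (simp add: norm_continuous_between_def)
    from tendsto_mult_left_zero[OF tendsto_rabs_zero[OF this]]
    show "((\<lambda>t'. \<bar>norm_between H\<^sub>0 \<mu> 0 (\<lambda>u. H t' u - H t u)\<bar> * (1 + N) powr \<mu>) \<longlongrightarrow> 0) (at t within {a..b})" .
    have "norm (BN N t' - BN N t) \<le> \<bar>norm_between H\<^sub>0 \<mu> 0 (\<lambda>u. H t' u - H t u)\<bar> * (1 + N) powr \<mu>"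
      if t': "t' \<in> {a..b}" for t'
    proof (rule norm_blinfun_bound)
      fix u
      have "norm (BN N t' u - BN N t u) \<le> norm_between H\<^sub>0 \<mu> 0 (\<lambda>u. H t' u - H t u) * Hnorm H\<^sub>0 \<mu> (Pr N u)"
        by (rule norm_BN_diff_le[OF t t'])
      also have "\<dots> \<le> \<bar>norm_between H\<^sub>0 \<mu> 0 (\<lambda>u. H t' u - H t u)\<bar> * ((1 + N) powr \<mu> * norm u)"
        unfolding Hnorm_eq by (intro mult_mono norm_G_P_N_le params) simp_all
      finally show "norm ((BN N t' - BN N t) u)
          \<le> \<bar>norm_between H\<^sub>0 \<mu> 0 (\<lambda>u. H t' u - H t u)\<bar> * (1 + N) powr \<mu> * norm u"
        by (simp add: blinfun.diff_left mult.assoc)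
    qed simp
    then show "\<forall>\<^sub>F t' in at t within {a..b}. norm (BN N t' - BN N t)
        \<le> \<bar>norm_between H\<^sub>0 \<mu> 0 (\<lambda>u. H t' u - H t u)\<bar> * (1 + N) powr \<mu>"
      unfolding eventually_at by (intro exI[of _ 1]) simp
  qed
  then show "(BN N \<longlongrightarrow> BN N t) (at t within {a..b})" by (rule LIM_zero_cancel)
qed

lemma BN_skew: "t \<in> {a..b} \<Longrightarrow> cinner (BN N t u) v = - cinner u (BN N t v)"
  by (simp add: BN_apply cinner_simps P_N_sym symmetric P_N_Hsp_inf)

lemma P_N_BN: "t \<in> {a..b} \<Longrightarrow> Pr N (BN N t u) = BN N t u"
  using linear_simps(3)[OF bounded_linear_P_N]
  by (simp add: BN_apply P_N_P_N P_N_scaleC linear_simps[OF bounded_linear_P_N])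

lemma VN_eq: "VN N = {u. Pr N u = u}"
  using HN_space_iff by blast

lemma csubspace_VN: "csubspace (VN N)"
  unfolding VN_eq csubspace_def
  using linear_simps[OF bounded_linear_P_N] by (simp add: P_N_add P_N_scaleC)

lemma H_N_eq: "t \<in> {a..b} \<Longrightarrow> H_N H\<^sub>0 H N t u = \<i> *\<^sub>C BN N t u"
  by (simp add: BN_apply H_N_def)

sublocale ode: unitary_ode "BN N" a b "Pr N" "VN N" "H_N H\<^sub>0 H N" for N
  by (intro unitary_ode.intro skew_ode.intro linear_ode.intro skew_ode_axioms.intro unitary_ode_axioms.intro)
    (simp_all only: continuous_on_BN BN_skew bounded_linear_P_N VN_eq P_N_BN H_N_eq)

text \<open>The generator frozen at a node \<open>t\<close> of {a..b}; being constant, it can be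
  considered on any interval {c..d}.\<close>

lemma const_ode:
  assumes "t \<in> {a..b}"
  shows "unitary_ode (\<lambda>_. BN N t) c d (Pr N) (VN N) (\<lambda>_. H_N H\<^sub>0 H N t)"
  by (intro unitary_ode.intro skew_ode.intro linear_ode.intro skew_ode_axioms.intro unitary_ode_axioms.intro)
    (simp_all only: continuous_on_const BN_skew[OF assms] bounded_linear_P_N VN_eq
      P_N_BN[OF assms] H_N_eq[OF assms])

abbreviation "Ugal \<equiv> U_N H\<^sub>0 H {a..b}"

lemma Ugal_propagator: "is_propagator_of {a..b} (VN N) (H_N H\<^sub>0 H N) (Ugal N)"
  unfolding U_N_def by (rule someI_ex[OF ode.ex_propagator])

lemmas Ugal_sol = ode.propagator_sol[OF Ugal_propagator]
  and Ugal_unitary = ode.propagator_simps(1)[OF Ugal_propagator]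
  and Ugal_in = ode.propagator_simps(3)[OF Ugal_propagator]
  and Ugal_comp = ode.propagator_comp[OF Ugal_propagator]

lemma Ugal_refl: "s \<in> {a..b} \<Longrightarrow> v \<in> VN N \<Longrightarrow> Ugal N s s v = v"
  by (rule ode.propagator_simps(2)[OF Ugal_propagator])

lemma P_N_in: "Pr N u \<in> VN N"
  by (simp add: VN_eq P_N_P_N)

text \<open>The hypothesis excludes a null set for each single vector. Countably many of them are
  removed, one for each point of a dense set \<open>C\<close>. At fixed N both sides are continuous
  in \<open>u\<close>, since H(t) and the powers of \<open>Lambda\<close> are bounded after P_N, so
  the bound extends to the closure. The null set may depend on N, the function \<open>c\<close> does
  not.\<close>

lemma commutator_ae:
  obtains c where "c integrable_on {a..b}" "\<And>t. t \<in> {a..b} \<Longrightarrow> 0 \<le> c t"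
    "\<And>N. \<exists>Z. negligible Z \<and> (\<forall>t\<in>{a..b}. t \<notin> Z \<longrightarrow> (\<forall>u.
       cmod (\<i> * (cinner (H t (Pr N u)) (G (2 * \<rho>) (Pr N u)) - cinner (G (2 * \<rho>) (Pr N u)) (H t (Pr N u))))
         \<le> c t * (norm (G \<rho> (Pr N u)))\<^sup>2))"
proof -
  obtain c where c: "integrable (lebesgue_on {a..b}) c" "\<forall>t\<in>{a..b}. 0 \<le> c t"
    and ae: "\<forall>v\<in>Hsp_inf H\<^sub>0. AE t in lebesgue_on {a..b}.
           cmod (\<i> * (cinner (H t v) (G (2 * \<rho>) v) - cinner (G (2 * \<rho>) v) (H t v)))
             \<le> c t * (norm (G \<rho> v))\<^sup>2"
    using commutator unfolding Hnorm_eq by (elim exE conjE)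
  obtain C :: "'a set" where C: "countable C" "closure C = UNIV"
    using separable by (auto simp: separable_space_def)
  have "\<exists>Z. negligible Z \<and> (\<forall>t\<in>{a..b}. t \<notin> Z \<longrightarrow> (\<forall>u.
       cmod (\<i> * (cinner (H t (Pr N u)) (G (2 * \<rho>) (Pr N u)) - cinner (G (2 * \<rho>) (Pr N u)) (H t (Pr N u))))
         \<le> c t * (norm (G \<rho> (Pr N u)))\<^sup>2))" for N
  proof -
    let ?l = "\<lambda>t u. cmod (\<i> * (cinner (H t (Pr N u)) (G (2 * \<rho>) (Pr N u)) - cinner (G (2 * \<rho>) (Pr N u)) (H t (Pr N u))))"
    let ?r = "\<lambda>t u. c t * (norm (G \<rho> (Pr N u)))\<^sup>2"
    have "AE t in lebesgue_on {a..b}. \<forall>u\<in>C. ?l t u \<le> ?r t u"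
      by (rule AE_ball_countable'[OF _ C(1)]) (rule bspec[OF ae P_N_Hsp_inf])
    then have "AE t in lebesgue. t \<in> {a..b} \<longrightarrow> (\<forall>u\<in>C. ?l t u \<le> ?r t u)"
      by (subst (asm) AE_restrict_space_iff) simp_all
    then obtain Z where Z: "Z \<in> null_sets lebesgue"
      "{t \<in> space lebesgue. \<not> (t \<in> {a..b} \<longrightarrow> (\<forall>u\<in>C. ?l t u \<le> ?r t u))} \<subseteq> Z"
      unfolding eventually_ae_filter by (elim bexE)
    have "?l t u \<le> ?r t u" if t: "t \<in> {a..b}" "t \<notin> Z" for t u
    proof -
      have on_C: "\<forall>u\<in>C. ?l t u \<le> ?r t u" using Z(2) t by auto
      have r0: "0 \<le> \<rho>" "0 \<le> 2 * \<rho>" using params by simp_all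
      have "closed {u. ?l t u \<le> ?r t u}"
        by (intro closed_Collect_le continuous_intros
            bounded_bilinear.continuous_on[OF bounded_bilinear_cinner]
            linear_continuous_on[OF bounded_linear_H_P[OF t(1)]]
            linear_continuous_on[OF bounded_linear_G_P_N[OF r0(1)]]
            linear_continuous_on[OF bounded_linear_G_P_N[OF r0(2)]])
      then have "closure C \<subseteq> {u. ?l t u \<le> ?r t u}"
        by (rule closure_minimal[rotated]) (use on_C in blast)
      then show ?thesis using C(2) by blast
    qed
    then show ?thesis using Z(1) by (intro exI[of _ Z]) (simp add: negligible_iff_null_sets)
  qed
  moreover have "c integrable_on {a..b}" by (rule integrable_on_lebesgue_on[OF c(1)]) simp
  ultimately show ?thesis using that[of c] c(2) by simp
qed

end

section \<open>Limits along a real parameter, and partitions\<close>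

lemma tendsto_at_top_if_Cauchy:
  fixes f :: "real \<Rightarrow> 'a::banach"
  assumes "\<And>e. e > 0 \<Longrightarrow> \<exists>N0. \<forall>N\<ge>N0. \<forall>M\<ge>N. norm (f M - f N) < e"
  shows "\<exists>l. (f \<longlongrightarrow> l) at_top"
proof -
  have "\<exists>P. eventually P at_top \<and> (\<forall>M N. P M \<and> P N \<longrightarrow> dist (f M) (f N) < e)" if e: "e > 0" for e
  proof -
    obtain N0 where N0: "\<forall>N\<ge>N0. \<forall>M\<ge>N. norm (f M - f N) < e" using assms[OF e] by blast
    have "dist (f M) (f N) < e" if "N0 \<le> M" "N0 \<le> N" for M N
    proof (cases "M \<le> N")
      case True
      then show ?thesis using N0 that(1) by (simp add: dist_norm norm_minus_commute)
    next
      case False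
      then show ?thesis using N0 that(2) by (simp add: dist_norm)
    qed
    then show ?thesis
      by (intro exI[of _ "\<lambda>N. N0 \<le> N"]) (simp add: eventually_ge_at_top)
  qed
  then have "cauchy_filter (filtermap f at_top)"
    by (simp add: cauchy_filter_metric_filtermap)
  then obtain l where "(f \<longlongrightarrow> l) at_top"
    using complete_uniform[where S = "UNIV :: 'a set"] complete_UNIV by (force simp add: filterlim_def)
  then show ?thesis by blast
qed

lemma is_partition_subset:
  assumes "is_partition c d ts"
  shows "set ts \<subseteq> {c..d}"
proof
  fix x assume "x \<in> set ts"
  then obtain i where i: "i < length ts" "x = ts ! i" by (auto simp: in_set_conv_nth)
  have ts: "ts \<noteq> []" "sorted_wrt (<) ts" "hd ts = c" "last ts = d" using assms by (simp_all add: is_partition_def)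
  have "c \<le> x"
    using sorted_wrt_nth_less[OF ts(2), of 0 i] ts(1,3) i by (cases "i = 0") (simp_all add: hd_conv_nth)
  moreover have "x \<le> d"
  proof (cases "i = length ts - 1")
    case True
    then show ?thesis using ts(1,4) i by (simp add: last_conv_nth)
  next
    case False
    then have "i < length ts - 1" using i(1) by linarith
    then have "ts ! i < ts ! (length ts - 1)" using ts(1) by (intro sorted_wrt_nth_less[OF ts(2)]) simp_all
    then show ?thesis using ts(1,4) i by (simp add: last_conv_nth)
  qed
  ultimately show "x \<in> {c..d}" by simp
qed

lemma finite_steps: "finite {ts ! Suc j - ts ! j | j. Suc j < length ts}"
  by (rule finite_surj[of "{..<length ts}" _ "\<lambda>j. ts ! Suc j - ts ! j"]) auto

lemma mesh_nonneg: "0 \<le> mesh ts"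
  unfolding mesh_def using finite_steps by (intro Max_ge) simp_all

lemma step_le_mesh: "Suc j < length ts \<Longrightarrow> ts ! Suc j - ts ! j \<le> mesh ts"
  unfolding mesh_def using finite_steps by (intro Max_ge) auto

text \<open>Provides the common upper bound that makes the supremum of the meshes over all pairs of
  times dominate each of them.\<close>

lemma mesh_le:
  assumes "is_partition c d ts"
  shows "mesh ts \<le> d - c"
proof -
  have sub: "set ts \<subseteq> {c..d}" by (rule is_partition_subset[OF assms])
  moreover have "set ts \<noteq> {}" using assms by (simp add: is_partition_def)
  ultimately have "c \<le> d" by force
  moreover have "ts ! Suc j - ts ! j \<le> d - c" if "Suc j < length ts" for j
    using subsetD[OF sub nth_mem[OF that]] subsetD[OF sub nth_mem[of j ts]] that by simp
  ultimately show ?thesis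
    unfolding mesh_def using finite_steps by (intro Max.boundedI) auto
qed

section \<open>Error estimates and the limit\<close>

context evolution
begin

section \<open>Uniform \<rho>-norm bound and comparison of two levels\<close>

lemma P_N_VN: "v \<in> VN N \<Longrightarrow> Pr N v = v"
  by (simp add: VN_eq)

text \<open>Energy estimate for the squared \<rho>-norm. As P_N commutes with powers of
  \<open>Lambda\<close>, the derivative is twice the imaginary part of the pairing of
  \<open>Lambda\<close>^(2\<rho>) x with H x, which is the commutator form up to sign.\<close>

lemma Hnorm_Ugal_le:
  obtains K where "1 \<le> K"
    "\<And>N s t v. s \<in> {a..b} \<Longrightarrow> t \<in> {a..b} \<Longrightarrow> v \<in> VN N \<Longrightarrow> Hnorm H\<^sub>0 \<rho> (Ugal N t s v) \<le> K * Hnorm H\<^sub>0 \<rho> v"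
proof -
  have r0: "0 \<le> \<rho>" using params by simp
  obtain c where c: "c integrable_on {a..b}" "\<And>t. t \<in> {a..b} \<Longrightarrow> 0 \<le> c t"
    and Z: "\<And>N. \<exists>Z. negligible Z \<and> (\<forall>t\<in>{a..b}. t \<notin> Z \<longrightarrow> (\<forall>u.
       cmod (\<i> * (cinner (H t (Pr N u)) (G (2 * \<rho>) (Pr N u)) - cinner (G (2 * \<rho>) (Pr N u)) (H t (Pr N u))))
         \<le> c t * (norm (G \<rho> (Pr N u)))\<^sup>2))"
    using commutator_ae by metis
  define K where "K = exp (integral {a..b} c)"
  have K1: "1 \<le> K" unfolding K_def using integral_nonneg[OF c(1)] c(2) by simp
  have "Hnorm H\<^sub>0 \<rho> (Ugal N t s v) \<le> K * Hnorm H\<^sub>0 \<rho> v"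
    if s: "s \<in> {a..b}" and t: "t \<in> {a..b}" and v: "v \<in> VN N" for N s t v
  \<comment> \<open>\<open>gronwall_ae\<close> takes logarithms and so asks for a positive function;
    by norm conservation a trajectory vanishes always or never.\<close>
  proof (cases "v = 0")
    case True
    have "norm (Ugal N t s v) = norm (Ugal N s s v)" by (rule ode.norm_sol_const[OF Ugal_sol[OF s v] s t])
    then have "Ugal N t s v = v" using True Ugal_refl[OF s v] by simp
    moreover have "0 \<le> Hnorm H\<^sub>0 \<rho> v" by (simp add: Hnorm_eq)
    ultimately show ?thesis using mult_right_mono[OF K1, of "Hnorm H\<^sub>0 \<rho> v"] by simp
  next
    case False
    define x where "x \<tau> = Ugal N \<tau> s v" for \<tau>
    have x_sol: "ode.sol N x" unfolding x_def[abs_def] by (rule Ugal_sol[OF s v])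
    have x_V: "Pr N (x \<tau>) = x \<tau>" if "\<tau> \<in> {a..b}" for \<tau>
      unfolding x_def by (rule P_N_VN[OF Ugal_in[OF s that v]])
    define A where "A u = G \<rho> (Pr N u)" for u
    define f where "f \<tau> = inner (A (x \<tau>)) (A (x \<tau>))" for \<tau>
    define f' where "f' \<tau> = 2 * inner (A (x \<tau>)) (A (BN N \<tau> (x \<tau>)))" for \<tau>
    have f_eq: "f \<tau> = (norm (G \<rho> (Pr N (x \<tau>))))\<^sup>2" for \<tau>
      by (simp add: f_def A_def power2_norm_eq_inner)
    have pos: "0 < f \<tau>" if \<tau>: "\<tau> \<in> {a..b}" for \<tau>
    proof -
      have "norm (x \<tau>) = norm (x s)" by (rule ode.norm_sol_const[OF x_sol s \<tau>])
      then have "0 < norm (x \<tau>)" using False by (simp add: x_def Ugal_refl[OF s v])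
      also have "norm (x \<tau>) \<le> norm (G \<rho> (Pr N (x \<tau>)))"
        using Hnorm_mono[OF order_refl r0, of N "x \<tau>"] Hnorm_0[of "x \<tau>"] by (simp add: x_V[OF \<tau>] Hnorm_eq)
      finally show ?thesis by (simp add: f_eq)
    qed
    have deriv: "(f has_real_derivative f' \<tau>) (at \<tau> within {a..b})" if \<tau>: "\<tau> \<in> {a..b}" for \<tau>
    proof -
      have "(x has_vector_derivative BN N \<tau> (x \<tau>)) (at \<tau> within {a..b})"
        using x_sol \<tau> by (simp add: ode.sol_def)
      then have Ax: "((\<lambda>\<tau>. A (x \<tau>)) has_vector_derivative A (BN N \<tau> (x \<tau>))) (at \<tau> within {a..b})"
        unfolding A_def by (rule bounded_linear.has_vector_derivative[OF bounded_linear_G_P_N[OF r0]])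
      show ?thesis
        unfolding has_real_derivative_iff_has_vector_derivative f_def[abs_def] f'_def
        using bounded_bilinear.has_vector_derivative[OF bounded_bilinear_inner Ax Ax]
        by (simp add: inner_commute)
    qed
    obtain Z where Z: "negligible Z" "\<forall>t\<in>{a..b}. t \<notin> Z \<longrightarrow> (\<forall>u.
       cmod (\<i> * (cinner (H t (Pr N u)) (G (2 * \<rho>) (Pr N u)) - cinner (G (2 * \<rho>) (Pr N u)) (H t (Pr N u))))
         \<le> c t * (norm (G \<rho> (Pr N u)))\<^sup>2)"
      using Z[of N] by (elim exE conjE)
    have bound: "\<bar>f' \<tau>\<bar> \<le> c \<tau> * f \<tau>" if \<tau>: "\<tau> \<in> {a..b}" "\<tau> \<notin> Z" for \<tau>
    proof -
      define z where "z = cinner (G (2 * \<rho>) (Pr N (x \<tau>))) (H \<tau> (Pr N (x \<tau>)))"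
      have "cinner (A (x \<tau>)) (A (BN N \<tau> (x \<tau>))) = cinner (G (2 * \<rho>) (Pr N (x \<tau>))) (BN N \<tau> (x \<tau>))"
        unfolding A_def by (rule cinner_G_P_N[OF r0])
      also have "\<dots> = - \<i> * cinner (Pr N (G (2 * \<rho>) (Pr N (x \<tau>)))) (H \<tau> (Pr N (x \<tau>)))"
        by (simp add: BN_apply[OF \<tau>(1)] cinner_simps P_N_sym)
      also have "Pr N (G (2 * \<rho>) (Pr N (x \<tau>))) = G (2 * \<rho>) (Pr N (x \<tau>))"
        by (rule P_N_G_P_N) (use r0 in simp)
      finally have "f' \<tau> = 2 * Im z" by (simp add: f'_def inner_eq_Re_cinner z_def)
      moreover have "cmod (\<i> * (cnj z - z)) = \<bar>2 * Im z\<bar>"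
      proof -
        have "\<i> * (cnj z - z) = of_real (2 * Im z)" by (simp add: complex_eq_iff)
        then show ?thesis by (simp only: norm_of_real)
      qed
      moreover have "cinner (H \<tau> (Pr N (x \<tau>))) (G (2 * \<rho>) (Pr N (x \<tau>))) = cnj z"
        unfolding z_def by (rule cinner_commute)
      moreover have "cmod (\<i> * (cinner (H \<tau> (Pr N (x \<tau>))) (G (2 * \<rho>) (Pr N (x \<tau>))) - z))
          \<le> c \<tau> * (norm (G \<rho> (Pr N (x \<tau>))))\<^sup>2"
        unfolding z_def using Z(2) \<tau> by simp
      ultimately show ?thesis by (simp only: f_eq)
    qed
    have "f t \<le> K * f s"
      unfolding K_def by (rule gronwall_ae[OF pos deriv c Z(1) bound s t])
    \<comment> \<open>Gronwall gives the factor K for squares. Enlarging it to K^2 lets the root be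
      taken with constant K.\<close>
    also have "K * f s \<le> K\<^sup>2 * f s"
      using K1 pos[OF s] by (intro mult_right_mono) (simp_all add: power2_eq_square)
    finally have "(norm (G \<rho> (x t)))\<^sup>2 \<le> (K * norm (G \<rho> (x s)))\<^sup>2"
      by (simp add: f_eq x_V[OF s] x_V[OF t] power_mult_distrib)
    then have "norm (G \<rho> (x t)) \<le> K * norm (G \<rho> (x s))"
      by (rule power2_le_imp_le) (use K1 in simp)
    then show ?thesis by (simp add: Hnorm_eq x_def Ugal_refl[OF s v])
  qed
  with K1 show ?thesis by (rule that)
qed

text \<open>Fixed once by choice, so that later estimates share one constant for all levels, times
  and vectors; \<open>C\<^sub>G\<close> is introduced in the same way.\<close>

definition K\<^sub>U :: real where
  "K\<^sub>U = (SOME K. 1 \<le> K \<and> (\<forall>N. \<forall>s\<in>{a..b}. \<forall>t\<in>{a..b}. \<forall>v\<in>VN N.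
      Hnorm H\<^sub>0 \<rho> (Ugal N t s v) \<le> K * Hnorm H\<^sub>0 \<rho> v))"

lemma K\<^sub>U: "1 \<le> K\<^sub>U"
  "s \<in> {a..b} \<Longrightarrow> t \<in> {a..b} \<Longrightarrow> v \<in> VN N \<Longrightarrow> Hnorm H\<^sub>0 \<rho> (Ugal N t s v) \<le> K\<^sub>U * Hnorm H\<^sub>0 \<rho> v"
proof -
  obtain K where "1 \<le> K"
    "\<And>N s t v. s \<in> {a..b} \<Longrightarrow> t \<in> {a..b} \<Longrightarrow> v \<in> VN N \<Longrightarrow> Hnorm H\<^sub>0 \<rho> (Ugal N t s v) \<le> K * Hnorm H\<^sub>0 \<rho> v"
    using Hnorm_Ugal_le by metis
  then have "\<exists>K. 1 \<le> K \<and> (\<forall>N. \<forall>s\<in>{a..b}. \<forall>t\<in>{a..b}. \<forall>v\<in>VN N.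
      Hnorm H\<^sub>0 \<rho> (Ugal N t s v) \<le> K * Hnorm H\<^sub>0 \<rho> v)" by blast
  from someI_ex[OF this, folded K\<^sub>U_def]
  show "1 \<le> K\<^sub>U"
    "s \<in> {a..b} \<Longrightarrow> t \<in> {a..b} \<Longrightarrow> v \<in> VN N \<Longrightarrow> Hnorm H\<^sub>0 \<rho> (Ugal N t s v) \<le> K\<^sub>U * Hnorm H\<^sub>0 \<rho> v"
    by simp_all
qed

lemma Hnorm_Ugal_P_N_le:
  assumes "s \<in> {a..b}" "t \<in> {a..b}" "u \<in> Hsp H\<^sub>0 \<rho>"
  shows "Hnorm H\<^sub>0 \<rho> (Ugal N t s (Pr N u)) \<le> K\<^sub>U * Hnorm H\<^sub>0 \<rho> u"
    and "Hnorm H\<^sub>0 \<mu> (Ugal N t s (Pr N u)) \<le> K\<^sub>U * Hnorm H\<^sub>0 \<rho> u"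
proof -
  have "Hnorm H\<^sub>0 \<rho> (Ugal N t s (Pr N u)) \<le> K\<^sub>U * Hnorm H\<^sub>0 \<rho> (Pr N u)"
    by (rule K\<^sub>U(2)[OF assms(1,2) P_N_in])
  also have "\<dots> \<le> K\<^sub>U * Hnorm H\<^sub>0 \<rho> u"
    using K\<^sub>U(1) params by (intro mult_left_mono Hnorm_P_N_le assms) simp_all
  finally show 1: "Hnorm H\<^sub>0 \<rho> (Ugal N t s (Pr N u)) \<le> K\<^sub>U * Hnorm H\<^sub>0 \<rho> u" .
  have "Hnorm H\<^sub>0 \<mu> (Ugal N t s (Pr N u)) \<le> Hnorm H\<^sub>0 \<rho> (Ugal N t s (Pr N u))"
    using Hnorm_mono[of \<mu> \<rho> N "Ugal N t s (Pr N u)"] params P_N_VN[OF Ugal_in[OF assms(1,2) P_N_in]]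
    by simp
  with 1 show "Hnorm H\<^sub>0 \<mu> (Ugal N t s (Pr N u)) \<le> K\<^sub>U * Hnorm H\<^sub>0 \<rho> u" by linarith
qed

lemma Ugal_cauchy:
  obtains C where "0 < C" "\<And>N M s t u. 0 < N \<Longrightarrow> N \<le> M \<Longrightarrow> s \<in> {a..b} \<Longrightarrow> t \<in> {a..b} \<Longrightarrow> u \<in> Hsp H\<^sub>0 \<rho> \<Longrightarrow>
      norm (Ugal M t s (Pr M u) - Ugal N t s (Pr N u)) \<le> C * (1 + N) powr (- \<sigma>) * Hnorm H\<^sub>0 \<rho> u"
proof -
  obtain K where K: "0 \<le> K" "\<forall>t\<in>{a..b}. \<forall>u\<in>Hsp H\<^sub>0 (\<sigma> + \<mu>). Hnorm H\<^sub>0 \<sigma> (H t u) \<le> K * Hnorm H\<^sub>0 (\<sigma> + \<mu>) u"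
    using H_uniform_bound[of \<sigma>] params by auto
  \<comment> \<open>The 1 stems from the initial mismatch (P_M - P_N) u, of size (1 + N)^(-\<rho>)
    <= (1 + N)^(-\<sigma>). The other term is the source bound times the length of the interval,
    with \<open>K\<close> from H(t) and \<open>K\<^sub>U\<close> from the trajectory.\<close>
  define C where "C = 1 + K * K\<^sub>U * (b - a)"
  have C: "0 < C" using K(1) K\<^sub>U(1) ab by (simp add: C_def add_pos_nonneg)
  have "norm (Ugal M t s (Pr M u) - Ugal N t s (Pr N u)) \<le> C * (1 + N) powr (- \<sigma>) * Hnorm H\<^sub>0 \<rho> u"
    if N: "0 < N" "N \<le> M" and s: "s \<in> {a..b}" and t: "t \<in> {a..b}" and u: "u \<in> Hsp H\<^sub>0 \<rho>" for N M s t u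
  proof -
    define x where "x \<tau> = Ugal M \<tau> s (Pr M u)" for \<tau>
    define y where "y \<tau> = Ugal N \<tau> s (Pr N u)" for \<tau>
    define g where "g \<tau> = BN M \<tau> (y \<tau>) - BN N \<tau> (y \<tau>)" for \<tau>
    define \<epsilon> where "\<epsilon> = (1 + N) powr (- \<sigma>) * (K * (K\<^sub>U * Hnorm H\<^sub>0 \<rho> u))"
    have tail: "norm (Pr M w - Pr N w) \<le> (1 + N) powr (- r) * Hnorm H\<^sub>0 r w" if "0 \<le> r" "w \<in> Hsp H\<^sub>0 r" for w r
    proof -
      have "Pr M w - Pr N w = Pr M (w - Pr N w)"
        using linear_simps(2)[OF bounded_linear_P_N] P_N_P_N(2)[OF N(2)] by simp
      then have "norm (Pr M w - Pr N w) \<le> norm (w - Pr N w)" by (simp add: norm_P_N_le)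
      also have "\<dots> \<le> (1 + N) powr (- r) * Hnorm H\<^sub>0 r w" by (rule norm_P_N_tail_le[OF that(1) N(1) that(2)])
      finally show ?thesis .
    qed
    have y_N: "Pr N (y \<tau>) = y \<tau>" if "\<tau> \<in> {a..b}" for \<tau>
      unfolding y_def by (rule P_N_VN[OF Ugal_in[OF s that P_N_in]])
    have y_M: "Pr M (y \<tau>) = y \<tau>" if "\<tau> \<in> {a..b}" for \<tau>
      using P_N_P_N(2)[OF N(2), of "y \<tau>"] by (simp add: y_N[OF that])
    have g_le: "norm (g \<tau>) \<le> \<epsilon>" if \<tau>: "\<tau> \<in> {a..b}" for \<tau>
    proof -
      have y_in: "y \<tau> \<in> Hsp H\<^sub>0 (\<sigma> + \<mu>)"
        using Q_G_P_N(1)[of "\<sigma> + \<mu>" N "y \<tau>"] params by (simp add: y_N[OF \<tau>])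
      \<comment> \<open>As y lies in both ranges, the inner projections drop out and only the
        difference P_M - P_N of the outer ones remains.\<close>
      have "g \<tau> = (- \<i>) *\<^sub>C (Pr M (H \<tau> (y \<tau>)) - Pr N (H \<tau> (y \<tau>)))"
        by (simp add: g_def BN_apply[OF \<tau>] y_N[OF \<tau>] y_M[OF \<tau>])
      then have "norm (g \<tau>) = norm (Pr M (H \<tau> (y \<tau>)) - Pr N (H \<tau> (y \<tau>)))"
        by (simp only: norm_scaleC) simp
      also have "\<dots> \<le> (1 + N) powr (- \<sigma>) * Hnorm H\<^sub>0 \<sigma> (H \<tau> (y \<tau>))"
        using params by (intro tail H_in_Hsp[OF \<tau> _ y_in]) simp_all
      also have "\<dots> \<le> (1 + N) powr (- \<sigma>) * (K * Hnorm H\<^sub>0 \<rho> (y \<tau>))"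
        using K(2) \<tau> y_in by (intro mult_left_mono) (simp_all add: add.commute)
      also have "\<dots> \<le> \<epsilon>"
        unfolding \<epsilon>_def y_def by (intro mult_left_mono Hnorm_Ugal_P_N_le s \<tau> u K(1)) simp
      finally show ?thesis .
    qed
    have "norm (x t - y t) \<le> norm (x s - y s) + \<epsilon> * \<bar>t - s\<bar>"
    proof (rule ode.norm_perturbed_sol_le[of _ M g \<epsilon>, OF _ g_le s t])
      fix \<tau> assume \<tau>: "\<tau> \<in> {a..b}"
      have "(x has_vector_derivative BN M \<tau> (x \<tau>)) (at \<tau> within {a..b})"
        using Ugal_sol[OF s P_N_in, of M u] \<tau> by (simp add: ode.sol_def x_def[abs_def])
      moreover have "(y has_vector_derivative BN N \<tau> (y \<tau>)) (at \<tau> within {a..b})"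
        using Ugal_sol[OF s P_N_in, of N u] \<tau> by (simp add: ode.sol_def y_def[abs_def])
      ultimately have "((\<lambda>t. x t - y t) has_vector_derivative (BN M \<tau> (x \<tau>) - BN N \<tau> (y \<tau>))) (at \<tau> within {a..b})"
        by (rule has_vector_derivative_diff)
      also have "BN M \<tau> (x \<tau>) - BN N \<tau> (y \<tau>) = BN M \<tau> (x \<tau> - y \<tau>) + g \<tau>"
        by (simp add: g_def blinfun.diff_right)
      finally show "((\<lambda>t. x t - y t) has_vector_derivative (BN M \<tau> (x \<tau> - y \<tau>) + g \<tau>)) (at \<tau> within {a..b})" .
    qed
    also have "norm (x s - y s) \<le> (1 + N) powr (- \<rho>) * Hnorm H\<^sub>0 \<rho> u"
      unfolding x_def y_def Ugal_refl[OF s P_N_in] using params u by (intro tail) simp_all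
    also have "(1 + N) powr (- \<rho>) * Hnorm H\<^sub>0 \<rho> u \<le> (1 + N) powr (- \<sigma>) * Hnorm H\<^sub>0 \<rho> u"
      using N params by (intro mult_right_mono powr_mono) (simp_all add: Hnorm_eq)
    also have "\<epsilon> * \<bar>t - s\<bar> \<le> \<epsilon> * (b - a)"
      using s t order_trans[OF norm_ge_zero g_le[OF s]] by (intro mult_left_mono) auto
    finally show ?thesis by (simp add: C_def \<epsilon>_def x_def y_def algebra_simps)
  qed
  with C show ?thesis by (rule that)
qed

end

context evolution
begin

definition C\<^sub>G :: real where
  "C\<^sub>G = (SOME C. 0 < C \<and> (\<forall>N>0. \<forall>M\<ge>N. \<forall>s\<in>{a..b}. \<forall>t\<in>{a..b}. \<forall>u\<in>Hsp H\<^sub>0 \<rho>.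
      norm (Ugal M t s (Pr M u) - Ugal N t s (Pr N u)) \<le> C * (1 + N) powr (- \<sigma>) * Hnorm H\<^sub>0 \<rho> u))"

lemma C\<^sub>G: "0 < C\<^sub>G"
  "0 < N \<Longrightarrow> N \<le> M \<Longrightarrow> s \<in> {a..b} \<Longrightarrow> t \<in> {a..b} \<Longrightarrow> u \<in> Hsp H\<^sub>0 \<rho> \<Longrightarrow>
     norm (Ugal M t s (Pr M u) - Ugal N t s (Pr N u)) \<le> C\<^sub>G * (1 + N) powr (- \<sigma>) * Hnorm H\<^sub>0 \<rho> u"
proof -
  obtain C where "0 < C" "\<And>N M s t u. 0 < N \<Longrightarrow> N \<le> M \<Longrightarrow> s \<in> {a..b} \<Longrightarrow> t \<in> {a..b} \<Longrightarrow> u \<in> Hsp H\<^sub>0 \<rho> \<Longrightarrow>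
      norm (Ugal M t s (Pr M u) - Ugal N t s (Pr N u)) \<le> C * (1 + N) powr (- \<sigma>) * Hnorm H\<^sub>0 \<rho> u"
    using Ugal_cauchy by metis
  then have "\<exists>C. 0 < C \<and> (\<forall>N>0. \<forall>M\<ge>N. \<forall>s\<in>{a..b}. \<forall>t\<in>{a..b}. \<forall>u\<in>Hsp H\<^sub>0 \<rho>.
      norm (Ugal M t s (Pr M u) - Ugal N t s (Pr N u)) \<le> C * (1 + N) powr (- \<sigma>) * Hnorm H\<^sub>0 \<rho> u)"
    by (intro exI[of _ C] conjI allI impI ballI)
  from someI_ex[OF this, folded C\<^sub>G_def] show "0 < C\<^sub>G"
  "0 < N \<Longrightarrow> N \<le> M \<Longrightarrow> s \<in> {a..b} \<Longrightarrow> t \<in> {a..b} \<Longrightarrow> u \<in> Hsp H\<^sub>0 \<rho> \<Longrightarrow>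
     norm (Ugal M t s (Pr M u) - Ugal N t s (Pr N u)) \<le> C\<^sub>G * (1 + N) powr (- \<sigma>) * Hnorm H\<^sub>0 \<rho> u"
    by simp_all
qed

section \<open>The limit propagator\<close>

abbreviation "Ug N t s u \<equiv> Ugal N t s (Pr N u)"

lemma norm_Ug_diff:
  assumes "s \<in> {a..b}" "t \<in> {a..b}"
  shows "norm (Ug N t s u - Ug N t s v) \<le> norm (u - v)"
proof -
  have "norm (Ug N t s u - Ug N t s v) = norm (Pr N (u - v))"
    using unitary_on_norm_diff[OF Ugal_unitary[OF assms] P_N_in P_N_in] linear_simps(2)[OF bounded_linear_P_N]
    by simp
  then show ?thesis using norm_P_N_le[of N "u - v"] by simp
qed

lemma decay: "e > 0 \<Longrightarrow> \<exists>N0>0. \<forall>N\<ge>N0. c * (1 + N) powr (- \<sigma>) < e"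
proof -
  assume e: "e > 0"
  have "((\<lambda>N. c * (1 + N) powr (- \<sigma>)) \<longlongrightarrow> c * 0) at_top"
    using params
    by (intro tendsto_intros tendsto_neg_powr filterlim_tendsto_add_at_top[OF tendsto_const filterlim_ident]) simp
  then have "\<forall>\<^sub>F N in at_top. c * (1 + N) powr (- \<sigma>) < e"
    by (rule order_tendstoD) (use e in simp)
  then obtain N0 where "\<forall>N\<ge>N0. c * (1 + N) powr (- \<sigma>) < e" by (auto simp: eventually_at_top_linorder)
  then show ?thesis by (intro exI[of _ "max 1 N0"]) simp
qed

lemma ex_Hsp_near: "e > 0 \<Longrightarrow> \<exists>v\<in>Hsp H\<^sub>0 \<rho>. norm (u - v) < e"
proof -
  assume "e > 0"
  then have "\<forall>\<^sub>F N in at_top. dist (Pr N u) u < e" using tendstoD[OF P_N_tendsto] by blast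
  then obtain N where "dist (Pr N u) u < e" by (auto simp: eventually_at_top_linorder)
  moreover have "Pr N u \<in> Hsp H\<^sub>0 \<rho>" using params by (intro Q_G_P_N) simp
  ultimately show ?thesis by (intro bexI[of _ "Pr N u"]) (simp_all add: dist_norm norm_minus_commute)
qed

text \<open>A three-term estimate from density of the \<rho>-space and the contraction bound
  \<open>norm_Ug_diff\<close>. No constant depends on the times; this uniformity later yields joint
  continuity of the limit.\<close>

lemma Ug_uniform_cauchy:
  assumes e: "e > 0"
  shows "\<exists>N0. \<forall>N\<ge>N0. \<forall>M\<ge>N. \<forall>s\<in>{a..b}. \<forall>t\<in>{a..b}. norm (Ug M t s u - Ug N t s u) < e"
proof -
  obtain v where v: "v \<in> Hsp H\<^sub>0 \<rho>" "norm (u - v) < e / 3"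
    using ex_Hsp_near[of "e/3" u] e by auto
  obtain N0 where N0: "0 < N0" "\<forall>N\<ge>N0. (C\<^sub>G * Hnorm H\<^sub>0 \<rho> v) * (1 + N) powr (- \<sigma>) < e / 3"
    using decay[of "e/3" "C\<^sub>G * Hnorm H\<^sub>0 \<rho> v"] e by auto
  have "norm (Ug M t s u - Ug N t s u) < e"
    if N: "N0 \<le> N" "N \<le> M" and st: "s \<in> {a..b}" "t \<in> {a..b}" for N M s t
  proof -
    have "norm (Ug M t s v - Ug N t s v) \<le> C\<^sub>G * (1 + N) powr (- \<sigma>) * Hnorm H\<^sub>0 \<rho> v"
      using N N0(1) by (intro C\<^sub>G(2) st v(1)) simp_all
    also have "\<dots> < e / 3" using N0(2) N(1) by (simp add: mult_ac)
    finally have "norm (Ug M t s v - Ug N t s v) < e / 3" .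
    moreover have "norm (Ug M t s u - Ug M t s v) < e / 3" "norm (Ug N t s v - Ug N t s u) < e / 3"
      using norm_Ug_diff[OF st, of M u v] norm_Ug_diff[OF st, of N v u] v(2) by (simp_all add: norm_minus_commute)
    moreover have tri: "norm (p + q + r) \<le> norm p + norm q + norm r" for p q r :: 'a
      using norm_triangle_ineq[of "p + q" r] norm_triangle_ineq[of p q] by linarith
    have "norm (Ug M t s u - Ug N t s u)
        \<le> norm (Ug M t s u - Ug M t s v) + norm (Ug M t s v - Ug N t s v) + norm (Ug N t s v - Ug N t s u)"
      using tri[of "Ug M t s u - Ug M t s v" "Ug M t s v - Ug N t s v" "Ug N t s v - Ug N t s u"] by simp
    ultimately show ?thesis by linarith
  qed
  then show ?thesis by blast
qed

abbreviation "U \<equiv> U_lim H\<^sub>0 H {a..b}"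

lemma Ug_tendsto:
  assumes st: "s \<in> {a..b}" "t \<in> {a..b}"
  shows "((\<lambda>N. Ug N t s u) \<longlongrightarrow> U t s u) at_top"
proof -
  have "\<exists>l. ((\<lambda>N. Ug N t s u) \<longlongrightarrow> l) at_top"
  proof (rule tendsto_at_top_if_Cauchy)
    show "\<exists>N0. \<forall>N\<ge>N0. \<forall>M\<ge>N. norm (Ug M t s u - Ug N t s u) < e" if "e > 0" for e
      using Ug_uniform_cauchy[OF that, of u] st by meson
  qed
  then obtain l where "((\<lambda>N. Ug N t s u) \<longlongrightarrow> l) at_top" by (elim exE)
  then show ?thesis unfolding U_lim_def by (simp add: tendsto_Lim)
qed

lemma Ug_uniform:
  assumes e: "e > 0"
  shows "\<exists>N0. \<forall>N\<ge>N0. \<forall>s\<in>{a..b}. \<forall>t\<in>{a..b}. norm (U t s u - Ug N t s u) < e"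
proof -
  obtain N0 where N0: "\<forall>N\<ge>N0. \<forall>M\<ge>N. \<forall>s\<in>{a..b}. \<forall>t\<in>{a..b}. norm (Ug M t s u - Ug N t s u) < e / 2"
    using Ug_uniform_cauchy[of "e/2" u] e by auto
  have "norm (U t s u - Ug N t s u) < e" if N: "N0 \<le> N" and st: "s \<in> {a..b}" "t \<in> {a..b}" for N s t
  proof -
    have "norm (U t s u - Ug N t s u) \<le> e / 2"
    proof (rule tendsto_upperbound)
      show "((\<lambda>M. norm (Ug M t s u - Ug N t s u)) \<longlongrightarrow> norm (U t s u - Ug N t s u)) at_top"
        by (intro tendsto_intros Ug_tendsto st)
      show "\<forall>\<^sub>F M in at_top. norm (Ug M t s u - Ug N t s u) \<le> e / 2"
        using N0 N st by (intro eventually_at_top_linorderI[of N]) (simp add: less_imp_le)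
    qed simp
    then show ?thesis using e by simp
  qed
  then show ?thesis by blast
qed

lemma U_galerkin_error:
  assumes "0 < N" "s \<in> {a..b}" "t \<in> {a..b}" "u \<in> Hsp H\<^sub>0 \<rho>"
  shows "norm (Ug N t s u - U t s u) \<le> C\<^sub>G * (1 + N) powr (- \<sigma>) * Hnorm H\<^sub>0 \<rho> u"
proof -
  have "norm (U t s u - Ug N t s u) \<le> C\<^sub>G * (1 + N) powr (- \<sigma>) * Hnorm H\<^sub>0 \<rho> u"
  proof (rule tendsto_upperbound)
    show "((\<lambda>M. norm (Ug M t s u - Ug N t s u)) \<longlongrightarrow> norm (U t s u - Ug N t s u)) at_top"
      by (intro tendsto_intros Ug_tendsto assms)
    show "\<forall>\<^sub>F M in at_top. norm (Ug M t s u - Ug N t s u) \<le> C\<^sub>G * (1 + N) powr (- \<sigma>) * Hnorm H\<^sub>0 \<rho> u"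
      using C\<^sub>G(2)[OF assms(1) _ assms(2,3,4)] by (intro eventually_at_top_linorderI[of N])
  qed simp
  then show ?thesis by (simp add: norm_minus_commute)
qed

lemma U_refl: "s \<in> {a..b} \<Longrightarrow> U s s u = u"
proof -
  assume s: "s \<in> {a..b}"
  have "((\<lambda>N. Pr N u) \<longlongrightarrow> U s s u) at_top"
    using Ug_tendsto[OF s s, of u] by (simp add: Ugal_refl[OF s P_N_in])
  then show ?thesis using P_N_tendsto tendsto_unique trivial_limit_at_top_linorder by blast
qed

text \<open>The limit of a product of strongly convergent maps: the inner error is passed through
  the contraction \<open>Ug N t r\<close> before the outer factor converges.\<close>

lemma U_comp:
  assumes s: "s \<in> {a..b}" and r: "r \<in> {a..b}" and t: "t \<in> {a..b}"
  shows "U t r (U r s u) = U t s u"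
proof (rule tendsto_unique[OF trivial_limit_at_top_linorder _ Ug_tendsto[OF s t]])
  have "((\<lambda>N. Ug N t r (Ug N r s u) - Ug N t r (U r s u)) \<longlongrightarrow> 0) at_top"
  proof (rule Lim_null_comparison)
    show "\<forall>\<^sub>F N in at_top. norm (Ug N t r (Ug N r s u) - Ug N t r (U r s u)) \<le> norm (Ug N r s u - U r s u)"
      by (intro always_eventually allI norm_Ug_diff r t)
    show "((\<lambda>N. norm (Ug N r s u - U r s u)) \<longlongrightarrow> 0) at_top"
      using tendsto_norm[OF LIM_zero[OF Ug_tendsto[OF s r]]] by simp
  qed
  from tendsto_add[OF this Ug_tendsto[OF r t, of "U r s u"]]
  show "((\<lambda>N. Ug N t s u) \<longlongrightarrow> U t r (U r s u)) at_top"
    by (simp add: P_N_VN[OF Ugal_in[OF s r P_N_in]] Ugal_comp[OF s r t P_N_in])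
qed

text \<open>Linearity and isometry pass to strong limits; surjectivity need not, and comes from the
  inverse U(s,t) supplied by \<open>U_comp\<close>.\<close>

lemma unitary_U:
  assumes st: "s \<in> {a..b}" "t \<in> {a..b}"
  shows "unitary_on UNIV (U t s)"
  unfolding unitary_on_def clinear_on_def
proof (intro conjI ballI allI)
  note lim = Ug_tendsto[OF st]
  note uniq = tendsto_unique[OF trivial_limit_at_top_linorder]
  have un: "unitary_on (VN N) (Ugal N t s)" for N by (rule Ugal_unitary[OF st])
  show "U t s (u + v) = U t s u + U t s v" for u v
  proof (rule uniq[OF lim])
    have "Ug N t s (u + v) = Ug N t s u + Ug N t s v" for N
      using un[of N] P_N_in by (simp add: unitary_on_def clinear_on_def P_N_add)
    then show "((\<lambda>N. Ug N t s (u + v)) \<longlongrightarrow> U t s u + U t s v) at_top"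
      using tendsto_add[OF lim lim] by simp
  qed
  show "U t s (c *\<^sub>C u) = c *\<^sub>C U t s u" for c u
  proof (rule uniq[OF lim])
    have "Ug N t s (c *\<^sub>C u) = c *\<^sub>C Ug N t s u" for N
      using un[of N] P_N_in by (simp add: unitary_on_def clinear_on_def P_N_scaleC)
    then show "((\<lambda>N. Ug N t s (c *\<^sub>C u)) \<longlongrightarrow> c *\<^sub>C U t s u) at_top"
      using bounded_linear.tendsto[OF bounded_linear_scaleC lim] by simp
  qed
  show "U t s ` UNIV = UNIV"
  proof (rule surjI)
    show "U t s (U s t u) = u" for u using U_comp[OF st(2,1,2)] U_refl[OF st(2)] by simp
  qed
  show "cinner (U t s u) (U t s v) = cinner u v" for u v
  proof (rule uniq)
    show "((\<lambda>N. cinner (Ug N t s u) (Ug N t s v)) \<longlongrightarrow> cinner (U t s u) (U t s v)) at_top"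
      by (rule bounded_bilinear.tendsto[OF bounded_bilinear_cinner lim lim])
    have "cinner (Ug N t s u) (Ug N t s v) = cinner (Pr N u) (Pr N v)" for N
      using un[of N] P_N_in by (simp add: unitary_on_def)
    then show "((\<lambda>N. cinner (Ug N t s u) (Ug N t s v)) \<longlongrightarrow> cinner u v) at_top"
      using bounded_bilinear.tendsto[OF bounded_bilinear_cinner P_N_tendsto P_N_tendsto] by simp
  qed
qed

text \<open>The constant may depend on N, as continuity is wanted level by level before the uniform
  limit. Changing the starting time is reduced by composition and unitarity to the difference
  U_N(s',s) v - v.\<close>

lemma Ug_lipschitz:
  "\<exists>K\<ge>0. \<forall>s\<in>{a..b}. \<forall>t\<in>{a..b}. \<forall>s'\<in>{a..b}. \<forall>t'\<in>{a..b}.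
     norm (Ug N t s u - Ug N t' s' u) \<le> K * \<bar>t - t'\<bar> + K * \<bar>s - s'\<bar>"
proof -
  obtain K where K: "0 \<le> K" "\<forall>t\<in>{a..b}. norm (BN N t) \<le> K" using ode.B_bounded by blast
  define v where "v = Pr N u"
  have v: "v \<in> VN N" by (simp add: v_def P_N_in)
  have time: "norm (Ugal N t s v - Ugal N t' s v) \<le> (K * norm v) * \<bar>t - t'\<bar>"
    if s: "s \<in> {a..b}" and t: "t \<in> {a..b}" "t' \<in> {a..b}" for s t t'
  proof (rule vector_derivative_norm_bound[where f = "\<lambda>t. Ugal N t s v", OF _ _ t(2,1)])
    fix \<tau> assume \<tau>: "\<tau> \<in> {a..b}"
    show "((\<lambda>t. Ugal N t s v) has_vector_derivative BN N \<tau> (Ugal N \<tau> s v)) (at \<tau> within {a..b})"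
      using Ugal_sol[OF s v] \<tau> by (simp add: ode.sol_def)
    have "norm (BN N \<tau> (Ugal N \<tau> s v)) \<le> norm (BN N \<tau>) * norm (Ugal N \<tau> s v)" by (rule norm_blinfun)
    also have "norm (Ugal N \<tau> s v) = norm v"
      using ode.norm_sol_const[OF Ugal_sol[OF s v] s \<tau>] by (simp add: Ugal_refl[OF s v])
    also have "norm (BN N \<tau>) * norm v \<le> K * norm v" using K(2) \<tau> by (intro mult_right_mono) simp_all
    finally show "norm (BN N \<tau> (Ugal N \<tau> s v)) \<le> K * norm v" .
  qed
  have "norm (Ugal N t s v - Ugal N t' s' v) \<le> K * norm v * \<bar>t - t'\<bar> + K * norm v * \<bar>s - s'\<bar>"
    if st: "s \<in> {a..b}" "t \<in> {a..b}" "s' \<in> {a..b}" "t' \<in> {a..b}" for s t s' t'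
  proof -
    have "norm (Ugal N t' s v - Ugal N t' s' v)
        = norm (Ugal N t' s' (Ugal N s' s v) - Ugal N t' s' v)"
      by (simp add: Ugal_comp[OF st(1,3,4) v])
    also have "\<dots> = norm (Ugal N s' s v - v)"
      by (rule unitary_on_norm_diff[OF Ugal_unitary[OF st(3,4)] Ugal_in[OF st(1,3) v] v])
    also have "\<dots> = norm (Ugal N s' s v - Ugal N s s v)" by (simp add: Ugal_refl[OF st(1) v])
    also have "\<dots> \<le> (K * norm v) * \<bar>s' - s\<bar>" by (rule time[OF st(1,3,1)])
    finally have "norm (Ugal N t' s v - Ugal N t' s' v) \<le> K * norm v * \<bar>s - s'\<bar>"
      by (simp add: abs_minus_commute)
    then show ?thesis
      using time[OF st(1,2,4)] norm_triangle_ineq[of "Ugal N t s v - Ugal N t' s v" "Ugal N t' s v - Ugal N t' s' v"]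
      by simp
  qed
  then show ?thesis using K(1) by (intro exI[of _ "K * norm v"]) (simp add: v_def)
qed

lemma continuous_on_Ug: "continuous_on ({a..b} \<times> {a..b}) (\<lambda>(t, s). Ug N t s u)"
  unfolding continuous_on_def
proof
  fix p assume p: "p \<in> {a..b} \<times> {a..b}"
  obtain K where K: "\<forall>s\<in>{a..b}. \<forall>t\<in>{a..b}. \<forall>s'\<in>{a..b}. \<forall>t'\<in>{a..b}.
     norm (Ug N t s u - Ug N t' s' u) \<le> K * \<bar>t - t'\<bar> + K * \<bar>s - s'\<bar>"
    using Ug_lipschitz[of N u] by blast
  have "((\<lambda>q. (case q of (t, s) \<Rightarrow> Ug N t s u) - (case p of (t, s) \<Rightarrow> Ug N t s u)) \<longlongrightarrow> 0)
      (at p within {a..b} \<times> {a..b})"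
  proof (rule Lim_null_comparison)
    have "((\<lambda>q. K * \<bar>fst q - fst p\<bar> + K * \<bar>snd q - snd p\<bar>) \<longlongrightarrow> K * \<bar>fst p - fst p\<bar> + K * \<bar>snd p - snd p\<bar>)
        (at p within {a..b} \<times> {a..b})"
      by (intro tendsto_intros)
    then show "((\<lambda>q. K * \<bar>fst q - fst p\<bar> + K * \<bar>snd q - snd p\<bar>) \<longlongrightarrow> 0) (at p within {a..b} \<times> {a..b})"
      by simp
    have "norm ((case q of (t, s) \<Rightarrow> Ug N t s u) - (case p of (t, s) \<Rightarrow> Ug N t s u))
        \<le> K * \<bar>fst q - fst p\<bar> + K * \<bar>snd q - snd p\<bar>" if "q \<in> {a..b} \<times> {a..b}" for q
      using K p that by (cases p, cases q) simp
    then show "\<forall>\<^sub>F q in at p within {a..b} \<times> {a..b}.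
        norm ((case q of (t, s) \<Rightarrow> Ug N t s u) - (case p of (t, s) \<Rightarrow> Ug N t s u))
        \<le> K * \<bar>fst q - fst p\<bar> + K * \<bar>snd q - snd p\<bar>"
      unfolding eventually_at by (intro exI[of _ 1]) simp
  qed
  then show "((\<lambda>(t, s). Ug N t s u) \<longlongrightarrow> (case p of (t, s) \<Rightarrow> Ug N t s u)) (at p within {a..b} \<times> {a..b})"
    by (rule LIM_zero_cancel)
qed

lemma continuous_on_U: "continuous_on ({a..b} \<times> {a..b}) (\<lambda>(t, s). U t s u)"
proof (rule uniform_limit_theorem)
  show "\<forall>\<^sub>F N in at_top. continuous_on ({a..b} \<times> {a..b}) (\<lambda>(t, s). Ug N t s u)"
    by (intro always_eventually allI continuous_on_Ug)
  show "uniform_limit ({a..b} \<times> {a..b}) (\<lambda>N (t, s). Ug N t s u) (\<lambda>(t, s). U t s u) at_top"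
  proof (rule uniform_limitI)
    fix e :: real assume "e > 0"
    then obtain N0 where N0: "\<forall>N\<ge>N0. \<forall>s\<in>{a..b}. \<forall>t\<in>{a..b}. norm (U t s u - Ug N t s u) < e"
      using Ug_uniform by blast
    show "\<forall>\<^sub>F N in at_top. \<forall>p\<in>{a..b} \<times> {a..b}. dist (case p of (t, s) \<Rightarrow> Ug N t s u) (case p of (t, s) \<Rightarrow> U t s u) < e"
      by (rule eventually_at_top_linorderI[of N0])
        (use N0 in \<open>auto simp: dist_norm norm_minus_commute\<close>)
  qed
qed simp

lemma unitary_propagator_U: "unitary_propagator {a..b} U"
  unfolding unitary_propagator_def
  by (intro conjI ballI allI unitary_U U_refl U_comp continuous_on_U)

section \<open>Products of exponentials along partitions\<close>

lemma step_eq: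
  assumes "t\<^sub>0 \<in> {a..b}"
  shows "op_exp (\<lambda>w. (- \<i> * complex_of_real d) *\<^sub>C H_N H\<^sub>0 H N t\<^sub>0 w) = op_exp (\<lambda>w. d *\<^sub>R BN N t\<^sub>0 w)"
proof -
  have "- \<i> * complex_of_real d * \<i> = of_real d" by (simp add: complex_eq_iff)
  then show ?thesis by (simp only: H_N_eq[OF assms] scaleR_scaleC scaleC_scaleC)
qed

lemma unitary_step:
  assumes "t\<^sub>0 \<in> {a..b}" "t\<^sub>0 \<le> t\<^sub>1"
  shows "unitary_on (VN N) (op_exp (\<lambda>w. (- \<i> * complex_of_real (t\<^sub>1 - t\<^sub>0)) *\<^sub>C H_N H\<^sub>0 H N t\<^sub>0 w))"
  unfolding step_eq[OF assms(1)]
  by (rule op_exp_propagator[OF const_ode[OF assms(1)] assms(2) csubspace_VN])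

text \<open>Bijectivity gives sense to the inverse in \<open>U_N_Pi\<close> for t < s, and isometry
  lets errors be measured before or after the product.\<close>

lemma unitary_exp_prod:
  assumes "sorted_wrt (<) ts" "set ts \<subseteq> {a..b}"
  shows "unitary_on (VN N) (exp_prod (H_N H\<^sub>0 H N) ts)"
  using assms
proof (induction ts rule: induct_list012)
  case 1
  then show ?case by (simp add: unitary_on_def clinear_on_def)
next
  case (2 x)
  then show ?case by (simp add: unitary_on_def clinear_on_def)
next
  case (3 t0 t1 ts)
  have "unitary_on (VN N) (exp_prod (H_N H\<^sub>0 H N) (t1 # ts))" by (rule 3) (use 3(3,4) in simp_all)
  moreover have "unitary_on (VN N) (op_exp (\<lambda>w. (- \<i> * complex_of_real (t1 - t0)) *\<^sub>C H_N H\<^sub>0 H N t0 w))"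
    by (rule unitary_step) (use 3(3,4) in simp_all)
  ultimately show ?case unfolding exp_prod.simps(1) by (rule unitary_on_comp)
qed

lemma holder_bound:
  obtains L where "0 \<le> L" "\<And>N t t' u. t \<in> {a..b} \<Longrightarrow> t' \<in> {a..b} \<Longrightarrow> u \<in> VN N \<Longrightarrow>
    norm (BN N t' u - BN N t u) \<le> L * \<bar>t' - t\<bar> powr \<alpha> * Hnorm H\<^sub>0 \<mu> u"
proof -
  obtain L where L: "0 \<le> L" "\<forall>t\<in>{a..b}. \<forall>t'\<in>{a..b}.
      norm_between H\<^sub>0 \<mu> 0 (\<lambda>u. H t' u - H t u) \<le> L * \<bar>t' - t\<bar> powr \<alpha>"
    using holder unfolding holder_between_def by blast
  have "norm (BN N t' u - BN N t u) \<le> L * \<bar>t' - t\<bar> powr \<alpha> * Hnorm H\<^sub>0 \<mu> u"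
    if t: "t \<in> {a..b}" "t' \<in> {a..b}" and u: "u \<in> VN N" for N t t' u
  proof -
    have "norm (BN N t' u - BN N t u) \<le> norm_between H\<^sub>0 \<mu> 0 (\<lambda>u. H t' u - H t u) * Hnorm H\<^sub>0 \<mu> u"
      using norm_BN_diff_le[OF t, of N u] by (simp add: P_N_VN[OF u])
    also have "\<dots> \<le> L * \<bar>t' - t\<bar> powr \<alpha> * Hnorm H\<^sub>0 \<mu> u"
      using L(2) t by (intro mult_right_mono) (simp_all add: Hnorm_eq)
    finally show ?thesis .
  qed
  with L(1) show ?thesis by (rule that)
qed

text \<open>Frozen and exact flow start from different vectors \<open>v\<close> and
  \<open>w\<close>, so that the error accumulated earlier enters additively and the estimate can be
  iterated. The bound \<open>K\<close> refers to the exact trajectory.\<close>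

lemma step_error:
  assumes L: "0 \<le> L" "\<And>N t t' u. t \<in> {a..b} \<Longrightarrow> t' \<in> {a..b} \<Longrightarrow> u \<in> VN N \<Longrightarrow>
      norm (BN N t' u - BN N t u) \<le> L * \<bar>t' - t\<bar> powr \<alpha> * Hnorm H\<^sub>0 \<mu> u"
    and t: "t\<^sub>0 \<in> {a..b}" "t\<^sub>1 \<in> {a..b}" "t\<^sub>0 \<le> t\<^sub>1" "t\<^sub>1 - t\<^sub>0 \<le> m"
    and w: "w \<in> VN N" and K: "\<And>\<tau>. \<tau> \<in> {a..b} \<Longrightarrow> Hnorm H\<^sub>0 \<mu> (Ugal N \<tau> t\<^sub>0 w) \<le> K"
  shows "norm (op_exp (\<lambda>w. (- \<i> * complex_of_real (t\<^sub>1 - t\<^sub>0)) *\<^sub>C H_N H\<^sub>0 H N t\<^sub>0 w) v - Ugal N t\<^sub>1 t\<^sub>0 w)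
    \<le> norm (v - w) + L * m powr \<alpha> * K * (t\<^sub>1 - t\<^sub>0)"
proof -
  interpret c: unitary_ode "\<lambda>_. BN N t\<^sub>0" "t\<^sub>0" "t\<^sub>1" "Pr N" "VN N" "\<lambda>_. H_N H\<^sub>0 H N t\<^sub>0"
    by (rule const_ode[OF t(1)])
  define x where "x \<tau> = op_exp (\<lambda>w. (\<tau> - t\<^sub>0) *\<^sub>R BN N t\<^sub>0 w) v" for \<tau>
  define y where "y \<tau> = Ugal N \<tau> t\<^sub>0 w" for \<tau>
  define g where "g \<tau> = BN N t\<^sub>0 (y \<tau>) - BN N \<tau> (y \<tau>)" for \<tau>
  have sub: "{t\<^sub>0..t\<^sub>1} \<subseteq> {a..b}" using t by auto
  have "norm (x t\<^sub>1 - y t\<^sub>1) \<le> norm (x t\<^sub>0 - y t\<^sub>0) + (L * m powr \<alpha> * K) * \<bar>t\<^sub>1 - t\<^sub>0\<bar>"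
  proof (rule c.norm_perturbed_sol_le[where g = g])
    fix \<tau> assume \<tau>: "\<tau> \<in> {t\<^sub>0..t\<^sub>1}"
    then have \<tau>': "\<tau> \<in> {a..b}" using sub by blast
    have "(x has_vector_derivative BN N t\<^sub>0 (x \<tau>)) (at \<tau> within {t\<^sub>0..t\<^sub>1})"
      using op_exp_sol(1)[of "BN N t\<^sub>0" "t\<^sub>0" "t\<^sub>1" v] \<tau> by (simp add: c.sol_def x_def[abs_def])
    moreover have "(y has_vector_derivative BN N \<tau> (y \<tau>)) (at \<tau> within {t\<^sub>0..t\<^sub>1})"
    proof (rule has_vector_derivative_within_subset[OF _ sub])
      show "(y has_vector_derivative BN N \<tau> (y \<tau>)) (at \<tau> within {a..b})"
        using Ugal_sol[OF t(1) w] \<tau>' by (simp add: ode.sol_def y_def[abs_def])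
    qed
    ultimately have "((\<lambda>t. x t - y t) has_vector_derivative (BN N t\<^sub>0 (x \<tau>) - BN N \<tau> (y \<tau>))) (at \<tau> within {t\<^sub>0..t\<^sub>1})"
      by (rule has_vector_derivative_diff)
    also have "BN N t\<^sub>0 (x \<tau>) - BN N \<tau> (y \<tau>) = BN N t\<^sub>0 (x \<tau> - y \<tau>) + g \<tau>"
      by (simp add: g_def blinfun.diff_right)
    finally show "((\<lambda>t. x t - y t) has_vector_derivative (BN N t\<^sub>0 (x \<tau> - y \<tau>) + g \<tau>)) (at \<tau> within {t\<^sub>0..t\<^sub>1})" .
    have "norm (g \<tau>) \<le> L * \<bar>t\<^sub>0 - \<tau>\<bar> powr \<alpha> * Hnorm H\<^sub>0 \<mu> (y \<tau>)"
      unfolding g_def y_def by (rule L(2)[OF \<tau>' t(1) Ugal_in[OF t(1) \<tau>' w]])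
    also have "\<dots> \<le> L * m powr \<alpha> * K"
    proof (rule mult_mono)
      show "L * \<bar>t\<^sub>0 - \<tau>\<bar> powr \<alpha> \<le> L * m powr \<alpha>"
        using L(1) t \<tau> params by (intro mult_left_mono powr_mono2) auto
      show "Hnorm H\<^sub>0 \<mu> (y \<tau>) \<le> K" unfolding y_def by (rule K[OF \<tau>'])
    qed (use L(1) in \<open>simp_all add: Hnorm_eq\<close>)
    finally show "norm (g \<tau>) \<le> L * m powr \<alpha> * K" .
  qed (use t in simp_all)
  moreover have "x t\<^sub>0 = v" "y t\<^sub>0 = w"
    unfolding x_def y_def by (rule op_exp_sol(2), rule Ugal_refl[OF t(1) w])
  ultimately show ?thesis using t(3) unfolding step_eq[OF t(1)] by (simp add: x_def y_def)
qed

text \<open>Induction from the earliest step: \<open>v\<close> is replaced by its frozen image and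
  \<open>w\<close> by its exact image, and the step lengths in the local errors add up to the total
  length.\<close>

lemma exp_prod_error:
  assumes L: "0 \<le> L" "\<And>N t t' u. t \<in> {a..b} \<Longrightarrow> t' \<in> {a..b} \<Longrightarrow> u \<in> VN N \<Longrightarrow>
      norm (BN N t' u - BN N t u) \<le> L * \<bar>t' - t\<bar> powr \<alpha> * Hnorm H\<^sub>0 \<mu> u"
    and ts: "ts \<noteq> []" "sorted_wrt (<) ts" "set ts \<subseteq> {a..b}"
      "\<And>j. Suc j < length ts \<Longrightarrow> ts ! Suc j - ts ! j \<le> m"
    and w: "w \<in> VN N" and K: "\<And>\<tau>. \<tau> \<in> {a..b} \<Longrightarrow> Hnorm H\<^sub>0 \<mu> (Ugal N \<tau> (hd ts) w) \<le> K"
  shows "norm (exp_prod (H_N H\<^sub>0 H N) ts v - Ugal N (last ts) (hd ts) w)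
    \<le> norm (v - w) + L * m powr \<alpha> * K * (last ts - hd ts)"
  using ts w K
proof (induction ts arbitrary: v w rule: induct_list012)
  case 1
  then show ?case by simp
next
  case (2 t0)
  then show ?case using Ugal_refl[of t0 w N] by simp
next
  case (3 t0 t1 ts)
  let ?E = "op_exp (\<lambda>w. (- \<i> * complex_of_real (t1 - t0)) *\<^sub>C H_N H\<^sub>0 H N t0 w)"
  have t01: "t0 \<in> {a..b}" "t1 \<in> {a..b}" "t0 \<le> t1" "t1 - t0 \<le> m"
    using "3.prems"(2,3) "3.prems"(4)[of 0] by simp_all
  have last_in: "last (t1 # ts) \<in> {a..b}" using "3.prems"(3) last_in_set[of "t1 # ts"] by auto
  note w = "3.prems"(5)
  have K: "Hnorm H\<^sub>0 \<mu> (Ugal N \<tau> t0 w) \<le> K" if "\<tau> \<in> {a..b}" for \<tau>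
    using "3.prems"(6)[OF that] by simp
  have "norm (exp_prod (H_N H\<^sub>0 H N) (t1 # ts) (?E v) - Ugal N (last (t1 # ts)) (hd (t1 # ts)) (Ugal N t1 t0 w))
      \<le> norm (?E v - Ugal N t1 t0 w) + L * m powr \<alpha> * K * (last (t1 # ts) - hd (t1 # ts))"
  proof (rule "3.IH"(2))
    show "(t1 # ts) ! Suc j - (t1 # ts) ! j \<le> m" if "Suc j < length (t1 # ts)" for j
      using "3.prems"(4)[of "Suc j"] that by simp
    show "Ugal N t1 t0 w \<in> VN N" by (rule Ugal_in[OF t01(1,2) w])
    \<comment> \<open>Moving the base point to \<open>t1\<close> leaves the exact trajectory
      unchanged, so the same \<open>K\<close> serves every step.\<close>
    show "Hnorm H\<^sub>0 \<mu> (Ugal N \<tau> (hd (t1 # ts)) (Ugal N t1 t0 w)) \<le> K" if "\<tau> \<in> {a..b}" for \<tau>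
      using K[OF that] by (simp add: Ugal_comp[OF t01(1,2) that w])
  qed (use "3.prems" in simp_all)
  moreover have "norm (?E v - Ugal N t1 t0 w) \<le> norm (v - w) + L * m powr \<alpha> * K * (t1 - t0)"
    by (rule step_error[OF L t01 w K])
  moreover have "Ugal N (last (t1 # ts)) t1 (Ugal N t1 t0 w) = Ugal N (last (t1 # ts)) t0 w"
    by (rule Ugal_comp[OF t01(1,2) last_in w])
  ultimately show ?case by (simp add: algebra_simps)
qed

lemma U_N_Pi_galerkin_error:
  obtains C where "0 \<le> C" "\<And>N s t ts u. s \<in> {a..b} \<Longrightarrow> t \<in> {a..b} \<Longrightarrow> is_partition (min s t) (max s t) ts \<Longrightarrow>
    u \<in> Hsp H\<^sub>0 \<rho> \<Longrightarrow> norm (U_N_Pi H\<^sub>0 H N ts t s (Pr N u) - Ug N t s u) \<le> C * mesh ts powr \<alpha> * Hnorm H\<^sub>0 \<rho> u"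
proof -
  obtain L where L: "0 \<le> L" "\<And>N t t' u. t \<in> {a..b} \<Longrightarrow> t' \<in> {a..b} \<Longrightarrow> u \<in> VN N \<Longrightarrow>
      norm (BN N t' u - BN N t u) \<le> L * \<bar>t' - t\<bar> powr \<alpha> * Hnorm H\<^sub>0 \<mu> u"
    by (rule holder_bound) metis
  \<comment> \<open>Hoelder constant times growth of the \<rho>-norm along the trajectory times
    length of the whole interval.\<close>
  define C where "C = L * K\<^sub>U * (b - a)"
  have C: "0 \<le> C" using L(1) K\<^sub>U(1) ab by (simp add: C_def)
  have "norm (U_N_Pi H\<^sub>0 H N ts t s (Pr N u) - Ug N t s u) \<le> C * mesh ts powr \<alpha> * Hnorm H\<^sub>0 \<rho> u"
    if s: "s \<in> {a..b}" and t: "t \<in> {a..b}" and ts: "is_partition (min s t) (max s t) ts" and u: "u \<in> Hsp H\<^sub>0 \<rho>"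
    for N s t ts u
  proof -
    let ?X = "exp_prod (H_N H\<^sub>0 H N) ts"
    define K where "K = K\<^sub>U * Hnorm H\<^sub>0 \<rho> u"
    have K0: "0 \<le> K" using K\<^sub>U(1) by (simp add: K_def Hnorm_eq)
    have K: "Hnorm H\<^sub>0 \<mu> (Ugal N \<tau> s (Pr N u)) \<le> K" if "\<tau> \<in> {a..b}" for \<tau>
      unfolding K_def by (rule Hnorm_Ugal_P_N_le(2)[OF s that u])
    have "{min s t..max s t} \<subseteq> {a..b}" using s t by auto
    then have ts': "ts \<noteq> []" "sorted_wrt (<) ts" "set ts \<subseteq> {a..b}" "hd ts = min s t" "last ts = max s t"
      using ts order_trans[OF is_partition_subset[OF ts]] by (simp_all add: is_partition_def)
    have final: "L * mesh ts powr \<alpha> * K * (last ts - hd ts) \<le> C * mesh ts powr \<alpha> * Hnorm H\<^sub>0 \<rho> u"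
    proof -
      have "L * mesh ts powr \<alpha> * K * (last ts - hd ts) \<le> L * mesh ts powr \<alpha> * K * (b - a)"
        using s t L(1) K0 by (intro mult_left_mono) (auto simp: ts'(4,5))
      then show ?thesis by (simp add: C_def K_def mult_ac)
    qed
    consider "s < t" | "t < s" | "s = t" by linarith
    then show ?thesis
    proof cases
      case 1
      have "norm (?X (Pr N u) - Ugal N (last ts) (hd ts) (Pr N u))
          \<le> norm (Pr N u - Pr N u) + L * mesh ts powr \<alpha> * K * (last ts - hd ts)"
        by (rule exp_prod_error[OF L ts'(1,2,3) step_le_mesh P_N_in]) (use 1 K ts'(4) in simp_all)
      then show ?thesis using final 1 ts'(4,5) by (simp add: U_N_Pi_def)
    next
      case 2
      \<comment> \<open>Backward case. Let z be the inverse product X^(-1) of P_N u. Applying the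
        isometry X to z - y gives P_N u - X y, and P_N u is the exact forward evolution of y, so the
        forward estimate for the vector y applies.\<close>
      define y where "y = Ug N t s u"
      have y: "y \<in> VN N" unfolding y_def by (rule Ugal_in[OF s t P_N_in])
      have comp: "Ugal N \<tau> t y = Ugal N \<tau> s (Pr N u)" if "\<tau> \<in> {a..b}" for \<tau>
        unfolding y_def by (rule Ugal_comp[OF s t that P_N_in])
      have un: "unitary_on (VN N) ?X" by (rule unitary_exp_prod[OF ts'(2,3)])
      then have img: "?X ` VN N = VN N" by (simp add: unitary_on_def)
      define z where "z = inv_into (VN N) ?X (Pr N u)"
      have z: "z \<in> VN N" "?X z = Pr N u"
        unfolding z_def using P_N_in[of N u] by (auto intro: inv_into_into f_inv_into_f simp: img)
      have "norm (z - y) = norm (?X z - ?X y)" by (rule unitary_on_norm_diff[OF un z(1) y, symmetric])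
      also have "\<dots> = norm (?X y - Pr N u)" by (simp add: z(2) norm_minus_commute)
      also have "Pr N u = Ugal N (last ts) (hd ts) y"
        using 2 comp[OF s] by (simp add: ts'(4,5) Ugal_refl[OF s P_N_in])
      also have "norm (?X y - Ugal N (last ts) (hd ts) y)
          \<le> norm (y - y) + L * mesh ts powr \<alpha> * K * (last ts - hd ts)"
        by (rule exp_prod_error[OF L ts'(1,2,3) step_le_mesh y]) (use 2 K comp ts'(4) in simp_all)
      finally show ?thesis using final 2 by (simp add: U_N_Pi_def z_def y_def)
    next
      case 3
      then show ?thesis using C by (simp add: U_N_Pi_def Ugal_refl[OF t P_N_in] Hnorm_eq)
    qed
  qed
  with C show ?thesis by (rule that)
qed

section \<open>Combined error and uniform convergence\<close>

lemma total_error: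
  obtains C where "0 < C" "\<And>N s t ts u. 0 < N \<Longrightarrow> s \<in> {a..b} \<Longrightarrow> t \<in> {a..b} \<Longrightarrow>
    is_partition (min s t) (max s t) ts \<Longrightarrow> u \<in> Hsp H\<^sub>0 \<rho> \<Longrightarrow>
    norm (U_N_Pi H\<^sub>0 H N ts t s (Pr N u) - U t s u)
      \<le> C * ((1 + N) powr (- \<sigma>) + (1 + N) powr \<mu> * mesh ts powr \<alpha>) * Hnorm H\<^sub>0 \<rho> u"
proof -
  obtain C' where C': "0 \<le> C'" "\<And>N s t ts u. s \<in> {a..b} \<Longrightarrow> t \<in> {a..b} \<Longrightarrow> is_partition (min s t) (max s t) ts \<Longrightarrow>
    u \<in> Hsp H\<^sub>0 \<rho> \<Longrightarrow> norm (U_N_Pi H\<^sub>0 H N ts t s (Pr N u) - Ug N t s u) \<le> C' * mesh ts powr \<alpha> * Hnorm H\<^sub>0 \<rho> u"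
    by (rule U_N_Pi_galerkin_error) metis
  have "norm (U_N_Pi H\<^sub>0 H N ts t s (Pr N u) - U t s u)
      \<le> (C\<^sub>G + C') * ((1 + N) powr (- \<sigma>) + (1 + N) powr \<mu> * mesh ts powr \<alpha>) * Hnorm H\<^sub>0 \<rho> u"
    if N: "0 < N" and s: "s \<in> {a..b}" and t: "t \<in> {a..b}" and ts: "is_partition (min s t) (max s t) ts"
      and u: "u \<in> Hsp H\<^sub>0 \<rho>" for N s t ts u
  proof -
    let ?x = "(1 + N) powr (- \<sigma>)" and ?y = "mesh ts powr \<alpha>" and ?z = "(1 + N) powr \<mu> * mesh ts powr \<alpha>"
    have "1 \<le> (1 + N) powr \<mu>" using N params by (simp add: ge_one_powr_ge_zero)
    \<comment> \<open>The factor (1 + N)^\<mu> is introduced here, as a weakening of the product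
      estimate to the stated form.\<close>
    then have yz: "?y \<le> ?z" using mult_right_mono[of 1 "(1 + N) powr \<mu>" ?y] by simp
    have "norm (U_N_Pi H\<^sub>0 H N ts t s (Pr N u) - U t s u)
        \<le> norm (U_N_Pi H\<^sub>0 H N ts t s (Pr N u) - Ug N t s u) + norm (Ug N t s u - U t s u)"
      using norm_triangle_ineq[of "U_N_Pi H\<^sub>0 H N ts t s (Pr N u) - Ug N t s u" "Ug N t s u - U t s u"] by simp
    also have "\<dots> \<le> C' * ?y * Hnorm H\<^sub>0 \<rho> u + C\<^sub>G * ?x * Hnorm H\<^sub>0 \<rho> u"
      by (rule add_mono[OF C'(2)[OF s t ts u] U_galerkin_error[OF N s t u]])
    also have "\<dots> = (C' * ?y + C\<^sub>G * ?x) * Hnorm H\<^sub>0 \<rho> u" by (simp add: distrib_right)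
    also have "\<dots> \<le> ((C\<^sub>G + C') * (?x + ?z)) * Hnorm H\<^sub>0 \<rho> u"
    proof (rule mult_right_mono)
      have "C' * ?y \<le> (C\<^sub>G + C') * ?z" using C'(1) C\<^sub>G(1) yz by (intro mult_mono) simp_all
      moreover have "C\<^sub>G * ?x \<le> (C\<^sub>G + C') * ?x" using C'(1) by (intro mult_right_mono) simp_all
      ultimately show "C' * ?y + C\<^sub>G * ?x \<le> (C\<^sub>G + C') * (?x + ?z)" by (simp add: distrib_left)
    qed (simp add: Hnorm_eq)
    finally show ?thesis .
  qed
  moreover have "0 < C\<^sub>G + C'" using C'(1) C\<^sub>G(1) by simp
  ultimately show ?thesis using that by blast
qed

lemma uniform_convergence:
  fixes n :: "nat \<Rightarrow> real" and \<tau> :: "nat \<Rightarrow> real \<Rightarrow> real \<Rightarrow> real list"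
  assumes C: "\<And>N s t ts u. 0 < N \<Longrightarrow> s \<in> {a..b} \<Longrightarrow> t \<in> {a..b} \<Longrightarrow>
    is_partition (min s t) (max s t) ts \<Longrightarrow> u \<in> Hsp H\<^sub>0 \<rho> \<Longrightarrow>
    norm (U_N_Pi H\<^sub>0 H N ts t s (Pr N u) - U t s u)
      \<le> C * ((1 + N) powr (- \<sigma>) + (1 + N) powr \<mu> * mesh ts powr \<alpha>) * Hnorm H\<^sub>0 \<rho> u" and C0: "0 < C"
    and n: "\<And>k. 0 < n k" "filterlim n at_top sequentially"
    and part: "\<And>k t s. t \<in> {a..b} \<Longrightarrow> s \<in> {a..b} \<Longrightarrow> is_partition (min s t) (max s t) (\<tau> k t s)"
    and lim: "(\<lambda>k. (1 + n k) powr \<mu> * (SUP (t, s)\<in>{a..b} \<times> {a..b}. mesh (\<tau> k t s)) powr \<alpha>) \<longlonglongrightarrow> 0"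
    and u: "u \<in> Hsp H\<^sub>0 \<rho>"
  shows "uniform_limit ({a..b} \<times> {a..b}) (\<lambda>k (t, s). U_N_Pi H\<^sub>0 H (n k) (\<tau> k t s) t s (Pr (n k) u))
      (\<lambda>(t, s). U t s u) sequentially"
proof (rule uniform_limitI)
  fix e :: real assume e: "e > 0"
  define m where "m k = (SUP (t, s)\<in>{a..b} \<times> {a..b}. mesh (\<tau> k t s))" for k
  define \<epsilon> where "\<epsilon> k = C * ((1 + n k) powr (- \<sigma>) + (1 + n k) powr \<mu> * m k powr \<alpha>) * Hnorm H\<^sub>0 \<rho> u" for k
  have "\<epsilon> \<longlonglongrightarrow> C * (0 + 0) * Hnorm H\<^sub>0 \<rho> u"
    unfolding \<epsilon>_def using params
    by (intro tendsto_intros tendsto_neg_powr lim[folded m_def]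
        filterlim_tendsto_add_at_top[OF tendsto_const n(2)]) simp
  then have "\<forall>\<^sub>F k in sequentially. \<epsilon> k < e" by (rule order_tendstoD) (use e in simp)
  moreover have "dist (U_N_Pi H\<^sub>0 H (n k) (\<tau> k t s) t s (Pr (n k) u)) (U t s u) \<le> \<epsilon> k"
    if st: "t \<in> {a..b}" "s \<in> {a..b}" for k t s
  proof -
    \<comment> \<open>The supremum dominates single meshes only over a set bounded above; all
      partitions lie in {a..b}, so b - a is a bound.\<close>
    have bdd: "bdd_above ((\<lambda>(t, s). mesh (\<tau> k t s)) ` ({a..b} \<times> {a..b}))"
    proof (rule bdd_aboveI2)
      fix p assume "p \<in> {a..b} \<times> {a..b}"
      then obtain t s where p: "p = (t, s)" "t \<in> {a..b}" "s \<in> {a..b}" by blast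
      show "(case p of (t, s) \<Rightarrow> mesh (\<tau> k t s)) \<le> b - a"
        using mesh_le[OF part[OF p(2,3), of k]] p by auto
    qed
    have "mesh (\<tau> k t s) \<le> m k"
      unfolding m_def using cSUP_upper[OF _ bdd, of "(t, s)"] st by simp
    then have "mesh (\<tau> k t s) powr \<alpha> \<le> m k powr \<alpha>"
      using params by (intro powr_mono2 mesh_nonneg) simp_all
    then have "C * ((1 + n k) powr (- \<sigma>) + (1 + n k) powr \<mu> * mesh (\<tau> k t s) powr \<alpha>) * Hnorm H\<^sub>0 \<rho> u \<le> \<epsilon> k"
      unfolding \<epsilon>_def using C0 by (intro mult_right_mono mult_left_mono add_left_mono) (simp_all add: Hnorm_eq)
    then show ?thesis
      unfolding dist_norm by (rule order_trans[OF C[OF n(1) st(2,1) part[OF st] u]])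
  qed
  ultimately show "\<forall>\<^sub>F k in sequentially. \<forall>p\<in>{a..b} \<times> {a..b}.
      dist (case p of (t, s) \<Rightarrow> U_N_Pi H\<^sub>0 H (n k) (\<tau> k t s) t s (Pr (n k) u)) (case p of (t, s) \<Rightarrow> U t s u) < e"
  proof (elim eventually_mono, intro ballI)
    fix k p assume k: "\<epsilon> k < e" and "p \<in> {a..b} \<times> {a..b}"
    then obtain t s where p: "p = (t, s)" "t \<in> {a..b}" "s \<in> {a..b}" by blast
    show "dist (case p of (t, s) \<Rightarrow> U_N_Pi H\<^sub>0 H (n k) (\<tau> k t s) t s (Pr (n k) u)) (case p of (t, s) \<Rightarrow> U t s u) < e"
      using \<open>\<And>t s k. t \<in> {a..b} \<Longrightarrow> s \<in> {a..b} \<Longrightarrow> dist (U_N_Pi H\<^sub>0 H (n k) (\<tau> k t s) t s (Pr (n k) u)) (U t s u) \<le> \<epsilon> k\<close>[OF p(2,3), of k] k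
      by (simp add: p(1))
  qed
qed

end

theorem theorem3p25:
  fixes H\<^sub>0 :: "'a::complex_hilbert_space unbounded_op"
    and H :: "real \<Rightarrow> 'a \<Rightarrow> 'a"
    and I :: "real set"
    and a b \<mu> \<sigma> \<alpha> :: real
  assumes separable: "separable_space (euclidean :: 'a topology)"
    and H0: "self_adjoint_op H\<^sub>0" "positive_op H\<^sub>0" "compact_resolvent H\<^sub>0"
    and I: "a \<le> b" "I = {a..b}"
    and params: "\<mu> \<ge> 0" "\<sigma> > 0" "0 < \<alpha>" "\<alpha> \<le> 1"
    and continuity: "\<And>r. r \<ge> 0 \<Longrightarrow> norm_continuous_between H\<^sub>0 (r + \<mu>) r I H"
    and commutator: "\<exists>c. integrable (lebesgue_on I) c \<and> (\<forall>t\<in>I. 0 \<le> c t) \<and>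
        (\<forall>v\<in>Hsp_inf H\<^sub>0. AE t in lebesgue_on I.
           cmod (\<i> * (cinner (H t v) (op_app (Lambda_pow H\<^sub>0 (2 * (\<mu> + \<sigma>))) v)
                    - cinner (op_app (Lambda_pow H\<^sub>0 (2 * (\<mu> + \<sigma>))) v) (H t v)))
             \<le> c t * (Hnorm H\<^sub>0 (\<mu> + \<sigma>) v)\<^sup>2)"
    and symmetric: "\<And>t u v. t \<in> I \<Longrightarrow> u \<in> Hsp_inf H\<^sub>0 \<Longrightarrow> v \<in> Hsp_inf H\<^sub>0 \<Longrightarrow>
        cinner (H t u) v = cinner u (H t v)"
    and holder: "holder_between H\<^sub>0 \<mu> 0 \<alpha> I H"
  shows "(\<forall>t\<in>I. \<forall>s\<in>I. \<forall>u. ((\<lambda>N. U_N H\<^sub>0 H I N t s (P_N H\<^sub>0 N u)) \<longlongrightarrow> U_lim H\<^sub>0 H I t s u) at_top) \<and>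
    unitary_propagator I (U_lim H\<^sub>0 H I) \<and>
    (\<exists>C>0. \<forall>N>0. \<forall>t\<in>I. \<forall>s\<in>I. \<forall>\<tau>. is_partition (min s t) (max s t) \<tau> \<longrightarrow>
       (\<forall>u\<in>Hsp H\<^sub>0 (\<mu> + \<sigma>).
          norm (U_N_Pi H\<^sub>0 H N \<tau> t s (P_N H\<^sub>0 N u) - U_lim H\<^sub>0 H I t s u)
            \<le> C * ((1 + N) powr (- \<sigma>) + (1 + N) powr \<mu> * mesh \<tau> powr \<alpha>)
                * Hnorm H\<^sub>0 (\<mu> + \<sigma>) u)) \<and>
    (\<forall>(n :: nat \<Rightarrow> real) (\<tau> :: nat \<Rightarrow> real \<Rightarrow> real \<Rightarrow> real list).
       (\<forall>k. n k > 0) \<and> filterlim n at_top sequentially \<and>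
       (\<forall>k. \<forall>t\<in>I. \<forall>s\<in>I. is_partition (min s t) (max s t) (\<tau> k t s)) \<and>
       (\<lambda>k. SUP (t, s)\<in>I \<times> I. mesh (\<tau> k t s)) \<longlonglongrightarrow> 0 \<and>
       (\<lambda>k. (1 + n k) powr \<mu> * (SUP (t, s)\<in>I \<times> I. mesh (\<tau> k t s)) powr \<alpha>) \<longlonglongrightarrow> 0
       \<longrightarrow> (\<forall>u\<in>Hsp H\<^sub>0 (\<mu> + \<sigma>).
              uniform_limit (I \<times> I)
                (\<lambda>k (t, s). U_N_Pi H\<^sub>0 H (n k) (\<tau> k t s) t s (P_N H\<^sub>0 (n k) u))
                (\<lambda>(t, s). U_lim H\<^sub>0 H I t s u) sequentially))"
proof -
  interpret evolution H\<^sub>0 H a b \<mu> \<sigma> \<alpha>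
    by (unfold_locales; (rule H0 separable params I(1)
      | rule continuity[unfolded I(2)] commutator[unfolded I(2)] symmetric[unfolded I(2)] holder[unfolded I(2)]; assumption?))
  obtain C where C: "0 < C" "\<And>N s t ts u. 0 < N \<Longrightarrow> s \<in> {a..b} \<Longrightarrow> t \<in> {a..b} \<Longrightarrow>
    is_partition (min s t) (max s t) ts \<Longrightarrow> u \<in> Hsp H\<^sub>0 (\<mu> + \<sigma>) \<Longrightarrow>
    norm (U_N_Pi H\<^sub>0 H N ts t s (P_N H\<^sub>0 N u) - U_lim H\<^sub>0 H {a..b} t s u)
      \<le> C * ((1 + N) powr (- \<sigma>) + (1 + N) powr \<mu> * mesh ts powr \<alpha>) * Hnorm H\<^sub>0 (\<mu> + \<sigma>) u"
    by (rule total_error) metis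
  show ?thesis
    unfolding I(2)
  proof (intro conjI allI impI ballI)
    show "((\<lambda>N. U_N H\<^sub>0 H {a..b} N t s (P_N H\<^sub>0 N u)) \<longlongrightarrow> U_lim H\<^sub>0 H {a..b} t s u) at_top"
      if "t \<in> {a..b}" "s \<in> {a..b}" for t s u
      by (rule Ug_tendsto[OF that(2,1)])
    show "unitary_propagator {a..b} (U_lim H\<^sub>0 H {a..b})" by (rule unitary_propagator_U)
    show "\<exists>C>0. \<forall>N>0. \<forall>t\<in>{a..b}. \<forall>s\<in>{a..b}. \<forall>\<tau>. is_partition (min s t) (max s t) \<tau> \<longrightarrow>
       (\<forall>u\<in>Hsp H\<^sub>0 (\<mu> + \<sigma>).
          norm (U_N_Pi H\<^sub>0 H N \<tau> t s (P_N H\<^sub>0 N u) - U_lim H\<^sub>0 H {a..b} t s u)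
            \<le> C * ((1 + N) powr (- \<sigma>) + (1 + N) powr \<mu> * mesh \<tau> powr \<alpha>)
                * Hnorm H\<^sub>0 (\<mu> + \<sigma>) u)"
      by (intro exI[of _ C] conjI allI impI ballI C)
  next
    fix n :: "nat \<Rightarrow> real" and \<tau> :: "nat \<Rightarrow> real \<Rightarrow> real \<Rightarrow> real list" and u
    assume *: "(\<forall>k. n k > 0) \<and> filterlim n at_top sequentially \<and>
       (\<forall>k. \<forall>t\<in>{a..b}. \<forall>s\<in>{a..b}. is_partition (min s t) (max s t) (\<tau> k t s)) \<and>
       (\<lambda>k. SUP (t, s)\<in>{a..b} \<times> {a..b}. mesh (\<tau> k t s)) \<longlonglongrightarrow> 0 \<and>
       (\<lambda>k. (1 + n k) powr \<mu> * (SUP (t, s)\<in>{a..b} \<times> {a..b}. mesh (\<tau> k t s)) powr \<alpha>) \<longlonglongrightarrow> 0"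
      and u: "u \<in> Hsp H\<^sub>0 (\<mu> + \<sigma>)"
    show "uniform_limit ({a..b} \<times> {a..b})
        (\<lambda>k (t, s). U_N_Pi H\<^sub>0 H (n k) (\<tau> k t s) t s (P_N H\<^sub>0 (n k) u))
        (\<lambda>(t, s). U_lim H\<^sub>0 H {a..b} t s u) sequentially"
      by (rule uniform_convergence[OF C(2,1)]) (use * u in simp_all)
  qed
qed

end
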